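(* There are an absolute constant $c>0$, constants $C_n, C'_n>0$ depending only on $n$, and an algorithm which, given as input a finite subset $F$ of $\mathbb{Z}^2$, decides whether $F$ tiles $\mathbb{Z}^2$ (i.e. whether there exists $A \subset \mathbb{Z}^2$ with $\mathbf{1}_F * \mathbf{1}_A = 1$ identically on $\mathbb{Z}^2$), and whose running time, counting each arithmetic operation as costing time $O(1)$, is at most $$C_{|F|} \exp\left( C'_{|F|}\, \mathrm{diam}(F)^{c|F|^4} \right).$$
   Context: $\mathbf{1}_S$ is the indicator function of $S$; $f*g(x) = \sum_{y \in \mathbb{Z}^2} f(y)g(x-y)$. The condition $\mathbf{1}_F * \mathbf{1}_A = 1$ means that every element of $\mathbb{Z}^2$ has exactly one representation $f+a$ with $f \in F$, $a \in A$. $\mathrm{diam}(F)$ is the Euclidean diameter of $F$ (with $\mathrm{diam}(\emptyset)=0$). *)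

theory Defs
  imports "HOL-Analysis.Analysis"
begin

definition convolution :: "(int \<times> int \<Rightarrow> real) \<Rightarrow> (int \<times> int \<Rightarrow> real) \<Rightarrow> int \<times> int \<Rightarrow> real" where
  "convolution f g x = (\<Sum>\<^sub>\<infinity>y\<in>UNIV. f y * g (x - y))"

definition tiles_plane :: "(int \<times> int) set \<Rightarrow> bool" where
  "tiles_plane F \<longleftrightarrow> (\<exists>A. \<forall>x. convolution (indicator F) (indicator A) x = 1)"

text \<open>The distance on \<^typ>\<open>real \<times> real\<close> is the Euclidean one, and
  \<^const>\<open>diameter\<close> of the empty set is 0.\<close>

definition diam :: "(int \<times> int) set \<Rightarrow> real" where
  "diam F = diameter ((\<lambda>(x, y). (real_of_int x, real_of_int y)) ` F)"


text \<open>
  Algorithms are while programs acting on a memory of integer cells of unbounded size,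
  which are addressed by integers; addresses may be computed. An expression costs 1 for each
  constant, memory access, arithmetic operation, comparison and Boolean connective occurring in
  it, regardless of the size of the integers involved. A command costs 1 for each elementary
  command or control decision executed, plus the costs of the expressions evaluated on the way.
\<close>

type_synonym memory = "int \<Rightarrow> int"

datatype aexp =
    Const int
  | Cell aexp
  | Plus aexp aexp
  | Minus aexp aexp
  | Times aexp aexp
  | Div aexp aexp
  | Mod aexp aexp

datatype bexp =
    Less aexp aexp
  | Equal aexp aexp
  | Neg bexp
  | Conj bexp bexp

datatype com =
    Skip
  | Assign aexp aexp
  | Seq com com
  | Cond bexp com com
  | While bexp com

primrec aval :: "aexp \<Rightarrow> memory \<Rightarrow> int" where
  "aval (Const k) m = k"
| "aval (Cell a) m = m (aval a m)"
| "aval (Plus a b) m = aval a m + aval b m"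
| "aval (Minus a b) m = aval a m - aval b m"
| "aval (Times a b) m = aval a m * aval b m"
| "aval (Div a b) m = aval a m div aval b m"
| "aval (Mod a b) m = aval a m mod aval b m"

primrec acost :: "aexp \<Rightarrow> nat" where
  "acost (Const k) = 1"
| "acost (Cell a) = 1 + acost a"
| "acost (Plus a b) = 1 + acost a + acost b"
| "acost (Minus a b) = 1 + acost a + acost b"
| "acost (Times a b) = 1 + acost a + acost b"
| "acost (Div a b) = 1 + acost a + acost b"
| "acost (Mod a b) = 1 + acost a + acost b"

primrec bval :: "bexp \<Rightarrow> memory \<Rightarrow> bool" where
  "bval (Less a b) m \<longleftrightarrow> aval a m < aval b m"
| "bval (Equal a b) m \<longleftrightarrow> aval a m = aval b m"
| "bval (Neg b) m \<longleftrightarrow> \<not> bval b m"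
| "bval (Conj b1 b2) m \<longleftrightarrow> bval b1 m \<and> bval b2 m"

primrec bcost :: "bexp \<Rightarrow> nat" where
  "bcost (Less a b) = 1 + acost a + acost b"
| "bcost (Equal a b) = 1 + acost a + acost b"
| "bcost (Neg b) = 1 + bcost b"
| "bcost (Conj b1 b2) = 1 + bcost b1 + bcost b2"

text \<open>\<open>exec P m t m'\<close>: started in memory \<open>m\<close>, the program \<open>P\<close> terminates in time \<open>t\<close> with memory
  \<open>m'\<close>. In \<^term>\<open>Assign a b\<close>, the expression \<open>a\<close> computes the address of the cell to be written.\<close>

inductive exec :: "com \<Rightarrow> memory \<Rightarrow> nat \<Rightarrow> memory \<Rightarrow> bool" where
  Skip: "exec Skip m 1 m"
| Assign: "exec (Assign a b) m (1 + acost a + acost b) (m(aval a m := aval b m))"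
| Seq: "exec P m t m' \<Longrightarrow> exec Q m' t' m'' \<Longrightarrow> exec (Seq P Q) m (t + t') m''"
| CondTrue: "bval b m \<Longrightarrow> exec P m t m' \<Longrightarrow> exec (Cond b P Q) m (1 + bcost b + t) m'"
| CondFalse: "\<not> bval b m \<Longrightarrow> exec Q m t m' \<Longrightarrow> exec (Cond b P Q) m (1 + bcost b + t) m'"
| WhileFalse: "\<not> bval b m \<Longrightarrow> exec (While b P) m (1 + bcost b) m"
| WhileTrue: "bval b m \<Longrightarrow> exec P m t m' \<Longrightarrow> exec (While b P) m' t' m'' \<Longrightarrow>
    exec (While b P) m (1 + bcost b + t + t') m''"

inductive_cases SkipE: "exec Skip m t m'"
inductive_cases AssignE: "exec (Assign a b) m t m'"
inductive_cases SeqE: "exec (Seq P Q) m t m'"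
inductive_cases CondE: "exec (Cond b P Q) m t m'"
inductive_cases WhileE: "exec (While b P) m t m'"

lemma exec_deterministic:
  "exec P m t m1 \<Longrightarrow> exec P m u m2 \<Longrightarrow> u = t \<and> m2 = m1"
proof (induction arbitrary: u m2 rule: exec.induct)
  case (Skip m)
  then show ?case by (auto elim: SkipE)
next
  case (Assign a b m)
  then show ?case by (auto elim: AssignE)
next
  case (Seq P m t m' Q t' m'')
  from Seq.prems obtain s n s' where "u = s + s'" "exec P m s n" "exec Q n s' m2"
    by (rule SeqE)
  with Seq.IH show ?case by metis
next
  case (CondTrue b m P t m' Q)
  from CondTrue.prems CondTrue.hyps(1) obtain s
    where "u = Suc (bcost b + s)" "exec P m s m2" by (auto elim: CondE)
  with CondTrue.IH show ?case by fastforce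
next
  case (CondFalse b m Q t m' P)
  from CondFalse.prems CondFalse.hyps(1) obtain s
    where "u = Suc (bcost b + s)" "exec Q m s m2" by (auto elim: CondE)
  with CondFalse.IH show ?case by fastforce
next
  case (WhileFalse b m P)
  then show ?case by (auto elim: WhileE)
next
  case (WhileTrue b m P t m' t' m'')
  from WhileTrue.prems show ?case
  proof (rule WhileE)
    assume "\<not> bval b m"
    with WhileTrue.hyps(1) show ?thesis by simp
  next
    fix s n s'
    assume u: "u = Suc (bcost b + s + s')" and 1: "exec P m s n" and 2: "exec (While b P) n s' m2"
    from WhileTrue.IH(1)[OF 1] have n: "s = t" "n = m'" by simp_all
    from WhileTrue.IH(2)[OF 2[unfolded n]] u n show ?thesis by simp
  qed
qed

text \<open>A list \<open>[(x\<^sub>1, y\<^sub>1), \<dots>, (x\<^sub>n, y\<^sub>n)]\<close> of lattice points is presented to a program by storing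
  \<open>n, x\<^sub>1, y\<^sub>1, \<dots>, x\<^sub>n, y\<^sub>n\<close> in the cells \<open>0, \<dots>, 2 n\<close>; all other cells contain 0.\<close>

definition input_memory :: "(int \<times> int) list \<Rightarrow> memory" where
  "input_memory xs i =
    (let w = int (length xs) # concat (map (\<lambda>(x, y). [x, y]) xs)
     in if 0 \<le> i \<and> i < int (length w) then w ! nat i else 0)"

text \<open>A finite set is given to a program as an arbitrary enumeration of its elements without
  repetitions; the answer (1 for yes, 0 for no) is returned in cell 0.\<close>

definition decides_in_time ::
  "com \<Rightarrow> ((int \<times> int) set \<Rightarrow> bool) \<Rightarrow> ((int \<times> int) set \<Rightarrow> real) \<Rightarrow> bool" where
  "decides_in_time P Q T \<longleftrightarrow>
    (\<forall>F xs. finite F \<longrightarrow> distinct xs \<longrightarrow> set xs = F \<longrightarrow>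
      (\<exists>t m. exec P (input_memory xs) t m \<and> m 0 = (if Q F then 1 else 0) \<and> real t \<le> T F))"

end

theory Submission
  imports Defs "HOL-Complex_Analysis.Great_Picard" "HOL-Computational_Algebra.Primes"
begin

text \<open>
  Let \<open>F\<close> have \<open>n\<close> elements, and let \<open>a\<close> be the indicator function of a set \<open>A\<close> such that every
  lattice point is uniquely \<open>f + x\<close> with \<open>f \<in> F\<close> and \<open>x \<in> A\<close>. The heart of the matter is that \<open>A\<close>
  can be replaced by a set which is periodic with respect to some \<open>M \<int> \<times> M \<int>\<close> where, for fixed
  \<open>n\<close>, \<open>M\<close> is at most a power of the diameter with exponent of order \<open>n ^ 4\<close> (\<open>periodic_tiling\<close>).
  Given such a bound, one can try every \<open>M\<close> below it and every subset of the torus of side \<open>M\<close>;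
  there are \<open>2 ^ (M * M)\<close> of them, which accounts for the exponential in the running time.

  The Frobenius endomorphism shows that \<open>F\<close> may be dilated by any \<open>r\<close> coprime to \<open>n!\<close> without
  destroying the tiling by \<open>A\<close> (\<open>dilation\<close>). For \<open>g \<in> F\<close> this reads
  \<open>a x = 1 - (\<Sum>f\<noteq>g. a (x - r (f - g)))\<close>, and averaging over \<open>r = 1 + n! k\<close> expresses \<open>a\<close> as 1
  minus a sum of nonnegative functions, each periodic along one difference \<open>f - g\<close> (\<open>averaging\<close>).
  Collecting parallel differences leaves one function \<open>\<phi> i\<close> for each direction \<open>i\<close>.

  Since \<open>a\<close> is integer valued, differencing along the periods of all the other functions shows
  that \<open>\<phi> i\<close> is a polynomial modulo 1 on every coset of a suitable lattice. Now there are two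
  possibilities. If \<open>\<phi> i\<close> takes a value slightly below 1, then on the line of direction \<open>i\<close>
  through that point the other functions are squeezed into a short interval at 0; there a
  polynomial modulo 1 is a bounded real polynomial, so it is constant, and everything is periodic
  modulo 1 (\<open>rigid\<close>). Otherwise the values of \<open>\<phi> i\<close> leave a gap below 1. Polynomial recurrence
  provides a step, bounded in terms of \<open>n\<close> only, along which \<open>\<phi> i\<close> is nearly constant for a long
  time, and from there on it follows a real polynomial which moves so slowly that it can never
  cross the gap; so it is constant along that step (\<open>avoiding_polynomial_periodic\<close>). Either way
  all \<open>\<phi> i\<close> are periodic modulo 1 with a controlled period. On a coset of the resulting lattice,
  either all \<open>\<phi> i\<close> are constant or \<open>a\<close> is \<open>1 - \<phi> i\<close> for a single \<open>i\<close>, so \<open>a\<close> is a sum of indicator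
  functions \<open>\<alpha> i\<close>, each periodic in direction \<open>i\<close> (\<open>weakly_periodic\<close>).

  The sums of the translates of the \<open>\<alpha> i\<close> by \<open>F\<close>, and by its dilates, take the values 0 and 1 and
  add up to 1. Since lines of different directions meet, this forces them to be doubly periodic. A
  second averaging over dilations yields that already the translates of \<open>\<alpha> i\<close> by the part of \<open>F\<close>
  on any one line of direction \<open>i\<close> have a doubly periodic sum (\<open>slice_period\<close>). Hence the lines of
  \<open>\<alpha> i\<close> in one strip may be copied periodically over all the others without changing the sum over
  \<open>F\<close>, and the copies make up a doubly periodic tiling (\<open>biperiodic_tiling\<close>).
\<close>

section \<open>Polynomials modulo 1 on the integers\<close>

text \<open>
  The functions that are polynomials of degree less than \<open>k\<close> modulo 1, defined by repeated
  differences so that no coefficients enter: the class is then visibly closed under translations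
  and affine changes of the variable.
\<close>

fun poly_mod1 :: "nat \<Rightarrow> (int \<Rightarrow> real) \<Rightarrow> bool" where
  "poly_mod1 0 f \<longleftrightarrow> (\<forall>x. f x \<in> \<int>)"
| "poly_mod1 (Suc k) f \<longleftrightarrow> (\<forall>h. poly_mod1 k (\<lambda>x. f (x + h) - f x))"

text \<open>
  The real polynomials of degree less than \<open>k\<close>, restricted to the integers.
\<close>

fun poly_exact :: "nat \<Rightarrow> (int \<Rightarrow> real) \<Rightarrow> bool" where
  "poly_exact 0 f \<longleftrightarrow> (\<forall>x. f x = 0)"
| "poly_exact (Suc k) f \<longleftrightarrow> (\<forall>h. poly_exact k (\<lambda>x. f (x + h) - f x))"

lemma poly_exact_imp_poly_mod1: "poly_exact k f \<Longrightarrow> poly_mod1 k f"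
  by (induction k arbitrary: f) auto

lemma poly_mod1_diff: "poly_mod1 k f \<Longrightarrow> poly_mod1 k g \<Longrightarrow> poly_mod1 k (\<lambda>x. f x - g x)"
proof (induction k arbitrary: f g)
  case (Suc k)
  have "poly_mod1 k (\<lambda>x. (f (x + h) - f x) - (g (x + h) - g x))" for h
    using Suc by auto
  then show ?case by (simp add: algebra_simps)
qed auto

lemma poly_mod1_Suc: "poly_mod1 k f \<Longrightarrow> poly_mod1 (Suc k) f"
  by (induction k arbitrary: f) auto

lemma poly_mod1_mono: "poly_mod1 k f \<Longrightarrow> k \<le> l \<Longrightarrow> poly_mod1 l f"
proof (induction l)
  case (Suc l)
  then show ?case using poly_mod1_Suc by (metis le_Suc_eq)
qed auto

lemma poly_mod1_scale: "poly_mod1 k f \<Longrightarrow> poly_mod1 k (\<lambda>y. f (c + j * y))"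
proof (induction k arbitrary: f c)
  case (Suc k)
  have "poly_mod1 k (\<lambda>y. f ((c + j * y) + j * h) - f (c + j * y))" for h
    using Suc.IH[of "\<lambda>x. f (x + j * h) - f x" c] Suc.prems by simp
  then show ?case by (simp add: algebra_simps)
qed auto

lemma poly_mod1_diff_const: "poly_mod1 k f \<Longrightarrow> k > 0 \<Longrightarrow> poly_mod1 k (\<lambda>x. f x - c)"
  by (cases k) auto

lemma poly_exact_add: "poly_exact k f \<Longrightarrow> poly_exact k g \<Longrightarrow> poly_exact k (\<lambda>x. f x + g x)"
proof (induction k arbitrary: f g)
  case (Suc k)
  have "poly_exact k (\<lambda>x. (f (x + h) - f x) + (g (x + h) - g x))" for h
    using Suc by auto
  then show ?case by (simp add: algebra_simps)
qed auto

lemma poly_exact_cmult: "poly_exact k f \<Longrightarrow> poly_exact k (\<lambda>x. c * f x)"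
proof (induction k arbitrary: f)
  case (Suc k)
  have "poly_exact k (\<lambda>x. c * (f (x + h) - f x))" for h
    using Suc by auto
  then show ?case by (simp add: algebra_simps)
qed auto

lemma poly_exact_Suc: "poly_exact k f \<Longrightarrow> poly_exact (Suc k) f"
  by (induction k arbitrary: f) auto

lemma poly_exact_shift: "poly_exact k f \<Longrightarrow> poly_exact k (\<lambda>x. f (x + h))"
proof (induction k arbitrary: f)
  case (Suc k)
  have "poly_exact k (\<lambda>x. f ((x + h) + h') - f (x + h))" for h'
    using Suc.IH[of "\<lambda>x. f (x + h') - f x"] Suc.prems by simp
  then show ?case by (simp add: algebra_simps)
qed auto

lemma poly_exact_mult_linear: "poly_exact k f \<Longrightarrow> poly_exact (Suc k) (\<lambda>x. (real_of_int x - c) * f x)"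
proof (induction k arbitrary: f)
  case (Suc k)
  have "poly_exact (Suc k) (\<lambda>x. (real_of_int x - c) * (f (x + h) - f x) + h * f (x + h))" for h
  proof (rule poly_exact_add)
    show "poly_exact (Suc k) (\<lambda>x. (real_of_int x - c) * (f (x + h) - f x))"
      using Suc.IH[of "\<lambda>x. f (x + h) - f x"] Suc.prems by simp
    show "poly_exact (Suc k) (\<lambda>x. h * f (x + h))"
      by (rule poly_exact_cmult[OF poly_exact_shift[OF Suc.prems]])
  qed
  then show ?case
    unfolding poly_exact.simps(2)[of "Suc k"] by (simp add: algebra_simps del: poly_exact.simps)
qed auto

lemma poly_exact_prod_linear: "poly_exact (Suc k) (\<lambda>x. \<Prod>j<k. (real_of_int x - real j))"
proof (induction k)
  case (Suc k)
  from poly_exact_mult_linear[OF this, of "real k"] show ?case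
    by (simp add: mult.commute del: poly_exact.simps)
qed auto

text \<open>
  Newton interpolation: the node products of \<open>poly_exact_prod_linear\<close> adjust one value at a time.
\<close>

lemma interpolation: "\<exists>p. poly_exact k p \<and> (\<forall>j<k. p (int j) = v j)"
proof (induction k)
  case 0 then show ?case by (intro exI[of _ "\<lambda>_. 0"]) auto
next
  case (Suc k)
  then obtain p where p: "poly_exact k p" "\<forall>j<k. p (int j) = v j" by blast
  define P where "P x = (\<Prod>j<k. (real_of_int x - real j))" for x
  have Pk: "P (int k) \<noteq> 0" unfolding P_def by auto
  have P0: "P (int j) = 0" if "j < k" for j
    unfolding P_def using that by (auto intro!: prod_zero)
  define c where "c = (v k - p (int k)) / P (int k)"
  have "poly_exact (Suc k) (\<lambda>x. p x + c * P x)"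
    using poly_exact_prod_linear[of k] poly_exact_Suc[OF p(1)] unfolding P_def[symmetric]
    by (intro poly_exact_add poly_exact_cmult)
  moreover have "\<forall>j<Suc k. p (int j) + c * P (int j) = v j"
    using p(2) P0 Pk by (auto simp: less_Suc_eq c_def)
  ultimately show ?case by blast
qed

text \<open>
  A polynomial modulo 1 is determined by as many consecutive values as it has coefficients.
\<close>

lemma poly_mod1_Ints:
  assumes "poly_mod1 k f" "\<And>j. j < k \<Longrightarrow> f (int j) \<in> \<int>"
  shows "f x \<in> \<int>"
  using assms
proof (induction k arbitrary: f x)
  case (Suc k)
  have d: "f (x + 1) - f x \<in> \<int>" for x
  proof (rule Suc.IH[of "\<lambda>x. f (x + 1) - f x"])
    show "poly_mod1 k (\<lambda>x. f (x + 1) - f x)" using Suc.prems(1) by auto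
    show "f (int j + 1) - f (int j) \<in> \<int>" if "j < k" for j
      using Suc.prems(2)[of "Suc j"] Suc.prems(2)[of j] that by (auto simp: add.commute)
  qed
  have 0: "f 0 \<in> \<int>" using Suc.prems(2)[of 0] by simp
  show ?case
  proof (induction x rule: int_induct[of _ 0])
    case base then show ?case by (rule 0)
  next
    case (step1 i)
    have "(f (i + 1) - f i) + f i \<in> \<int>"
      using d[of i] step1 by (intro Ints_add) auto
    then show ?case by simp
  next
    case (step2 i)
    have "f i - (f i - f (i - 1)) \<in> \<int>"
      using d[of "i - 1"] step2 by (intro Ints_diff) auto
    then show ?case by simp
  qed
qed auto

text \<open>
  By induction every difference of a bounded polynomial is constant, and a nonzero constant
  difference would make the polynomial unbounded. A bound on a half-line is enough for this.
\<close>

lemma poly_exact_bounded_const: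
  assumes "poly_exact k p" "\<And>j. j \<ge> 0 \<Longrightarrow> \<bar>p j\<bar> \<le> B"
  shows "p x = p y"
  using assms
proof (induction k arbitrary: p x y B)
  case (Suc k)
  have *: "p (x + h) = p x" if "h \<ge> 0" for x h
  proof -
    define c where "c = p (0 + h) - p 0"
    have c: "p (z + h) - p z = c" for z
      unfolding c_def
    proof (rule Suc.IH[of "\<lambda>x. p (x + h) - p x" "2 * B"])
      show "poly_exact k (\<lambda>x. p (x + h) - p x)" using Suc.prems by auto
      show "\<bar>p (j + h) - p j\<bar> \<le> 2 * B" if "j \<ge> 0" for j
        using Suc.prems(2)[of j] Suc.prems(2)[of "j + h"] that \<open>h \<ge> 0\<close> by auto
    qed
    have m: "p (int m * h) = p 0 + real m * c" for m
    proof (induction m)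
      case (Suc m)
      show ?case using c[of "int m * h"] Suc by (simp add: algebra_simps)
    qed auto
    have "c = 0"
    proof (rule ccontr)
      assume "c \<noteq> 0"
      then obtain m :: nat where "real m * \<bar>c\<bar> > 2 * B"
        using reals_Archimedean3[of "\<bar>c\<bar>"] by auto
      moreover have "\<bar>real m * c\<bar> \<le> 2 * B"
        using m[of m] Suc.prems(2)[of 0] Suc.prems(2)[of "int m * h"] that by auto
      ultimately show False by (simp add: abs_mult)
    qed
    then show ?thesis using c[of x] by simp
  qed
  show ?case using *[of "y - x" x] *[of "x - y" y] by (cases "x \<le> y") auto
qed auto

text \<open>
  A \<open>k\<close>-fold difference of a function bounded by \<open>c\<close> is bounded by \<open>2 ^ k * c\<close>, so when this is
  less than 1 the only integer available for it is 0.
\<close>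

lemma poly_exact_small:
  assumes "poly_mod1 k f" "\<And>x. \<bar>f x\<bar> * 2 ^ k < 1"
  shows "poly_exact k f"
  using assms
proof (induction k arbitrary: f)
  case 0
  have "f x = 0" for x using 0(1) 0(2)[of x] by (simp add: Ints_nonzero_abs_less1)
  then show ?case by simp
next
  case (Suc k)
  show ?case unfolding poly_exact.simps
  proof (intro allI Suc.IH)
    fix h x
    show "poly_mod1 k (\<lambda>x. f (x + h) - f x)" using Suc.prems by auto
    have "\<bar>f (x + h) - f x\<bar> * 2 ^ k \<le> \<bar>f (x + h)\<bar> * 2^k + \<bar>f x\<bar> * 2 ^ k"
      by (simp add: distrib_right[symmetric])
    also have "\<dots> < 1" using Suc.prems(2)[of "x + h"] Suc.prems(2)[of x] by simp
    finally show "\<bar>f (x + h) - f x\<bar> * 2 ^ k < 1" .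
  qed
qed

text \<open>
  A polynomial that stays bounded along an interval has a small last step. The total change over
  the last \<open>s\<close> steps is bounded, so these steps are of order \<open>1 / s\<close> on average; and by induction
  on the degree, applied to \<open>p (x + (J - j)) - p x\<close>, the step at \<open>J\<close> differs little from each step
  at \<open>j\<close>. This is a discrete substitute for Markov's inequality. The interval needs no more than
  \<open>k * s\<close> steps, as each induction step uses up \<open>s\<close> of them.
\<close>

lemma poly_exact_step:
  assumes "poly_exact (Suc k) p" "s > 0" "\<And>x. J - int k * s \<le> x \<Longrightarrow> x \<le> J \<Longrightarrow> \<bar>p x\<bar> \<le> B"
  shows "\<bar>p (J + 1) - p J\<bar> * s \<le> (2 ^ Suc k - 2) * B"
  using assms
proof (induction k arbitrary: p J B)
  case 0
  then show ?case by simp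
next
  case (Suc k)
  \<comment> \<open>The induction hypothesis compares the step at \<open>J\<close> with the one at \<open>j\<close>.\<close>
  have near_int: "\<bar>(p (J + 1) - p J) - (p (j + 1) - p j)\<bar> * s \<le> (2 ^ Suc k - 2) * (2 * B)"
    if "J - s \<le> j" "j < J" for j
  proof -
    define q where "q x = p (x + (J - j)) - p x" for x
    have "\<bar>q (j + 1) - q j\<bar> * s \<le> (2 ^ Suc k - 2) * (2 * B)"
    proof (rule Suc.IH)
      show "poly_exact (Suc k) q" using Suc.prems(1) unfolding q_def by simp
      fix x assume x: "j - int k * s \<le> x" "x \<le> j"
      have "\<bar>p x\<bar> \<le> B" "\<bar>p (x + (J - j))\<bar> \<le> B"
        using x that by (auto intro!: Suc.prems(3) simp: algebra_simps)
      then show "\<bar>q x\<bar> \<le> 2 * B" unfolding q_def by simp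
    qed (rule Suc.prems)
    then show ?thesis unfolding q_def by (simp add: algebra_simps)
  qed
  define S where "S = {J - s..<J}"
  have card: "real (card S) = s" unfolding S_def using \<open>s > 0\<close> by simp
  have tele: "(\<Sum>j\<in>{J - int t..<J}. p (j + 1) - p j) = p J - p (J - int t)" for t
  proof (induction t)
    case (Suc t)
    have "{J - int (Suc t)..<J} = insert (J - int (Suc t)) {J - int t..<J}" by auto
    then show ?case using Suc by (simp add: algebra_simps)
  qed auto
  have "s * (p (J + 1) - p J) = (\<Sum>j\<in>S. p (J + 1) - p J)"
    by (simp add: card)
  also have "\<dots> = (\<Sum>j\<in>S. p (j + 1) - p j) + (\<Sum>j\<in>S. (p (J + 1) - p J) - (p (j + 1) - p j))"
    by (simp add: sum.distrib[symmetric])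
  also have "(\<Sum>j\<in>S. p (j + 1) - p j) = p J - p (J - s)"
    using tele[of "nat s"] \<open>s > 0\<close> unfolding S_def by simp
  finally have "s * \<bar>p (J + 1) - p J\<bar> = \<bar>(p J - p (J - s)) +
      (\<Sum>j\<in>S. (p (J + 1) - p J) - (p (j + 1) - p j))\<bar>"
    using \<open>s > 0\<close> by (metis abs_mult abs_of_pos of_int_0_less_iff)
  also have "\<dots> \<le>
      \<bar>p J - p (J - s)\<bar> + \<bar>\<Sum>j\<in>S. (p (J + 1) - p J) - (p (j + 1) - p j)\<bar>" by linarith
  also have "\<bar>p J - p (J - s)\<bar> \<le> 2 * B"
  proof -
    have "0 \<le> int k * s" using \<open>s > 0\<close> by simp
    then have "\<bar>p J\<bar> \<le> B" "\<bar>p (J - s)\<bar> \<le> B"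
      using \<open>s > 0\<close> by (auto intro!: Suc.prems(3) simp: algebra_simps)
    then show ?thesis by linarith
  qed
  also have "\<bar>\<Sum>j\<in>S. (p (J + 1) - p J) - (p (j + 1) - p j)\<bar> \<le>
      (\<Sum>j\<in>S. (2 ^ Suc k - 2) * (2 * B) / s)"
  proof (rule order_trans[OF sum_abs sum_mono])
    fix j assume "j \<in> S"
    then show "\<bar>(p (J + 1) - p J) - (p (j + 1) - p j)\<bar> \<le> (2 ^ Suc k - 2) * (2 * B) / s"
      using near_int[of j] \<open>s > 0\<close> by (simp add: S_def pos_le_divide_eq)
  qed
  also have "\<dots> = (2 ^ Suc k - 2) * (2 * B)"
    using \<open>s > 0\<close> card by simp
  finally show ?case by (simp add: algebra_simps)
qed

section \<open>Polynomial recurrence\<close>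

definition near_int :: "real \<Rightarrow> real \<Rightarrow> bool" where
  "near_int \<delta> t \<longleftrightarrow> (\<exists>z::int. \<bar>t - of_int z\<bar> \<le> \<delta>)"

lemma near_int_add: "near_int a s \<Longrightarrow> near_int b t \<Longrightarrow> near_int (a + b) (s + t)"
proof -
  assume "near_int a s" "near_int b t"
  then obtain y z :: int where "\<bar>s - y\<bar> \<le> a" "\<bar>t - z\<bar> \<le> b" unfolding near_int_def by blast
  then have "\<bar>(s + t) - of_int (y + z)\<bar> \<le> a + b" by simp
  then show ?thesis unfolding near_int_def by blast
qed

lemma near_int_mono: "near_int a t \<Longrightarrow> a \<le> b \<Longrightarrow> near_int b t"
  unfolding near_int_def by (meson order_trans)

lemma near_int_frac:
  assumes "\<lfloor>c * frac a\<rfloor> = \<lfloor>c * frac b\<rfloor>" "c > 0"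
  shows "near_int (1 / c) (a - b)"
proof -
  have "\<bar>c * frac a - c * frac b\<bar> \<le> 1" using assms(1) by linarith
  then have "c * \<bar>frac a - frac b\<bar> \<le> 1"
    using assms(2) by (simp add: abs_mult right_diff_distrib[symmetric])
  then have "\<bar>frac a - frac b\<bar> \<le> 1 / c" using assms(2) by (simp add: field_simps)
  then have "\<bar>(a - b) - of_int (\<lfloor>a\<rfloor> - \<lfloor>b\<rfloor>)\<bar> \<le> 1 / c" by (simp add: frac_def algebra_simps)
  then show ?thesis unfolding near_int_def by blast
qed

text \<open>
  The recursion of the bounds in \<open>recurrence\<close>: there are \<open>(2 * r) ^ N\<close> classes in the pigeonhole
  argument, and the polynomials of lower degree that arise have to be controlled with a
  correspondingly higher accuracy.
\<close>

fun return_bound :: "nat \<Rightarrow> nat \<Rightarrow> nat \<Rightarrow> nat" where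
  "return_bound 0 N r = 1"
| "return_bound (Suc k) N r = (2 * r) ^ N * return_bound k (N * (2 * r) ^ N) (2 * r * (2 * r) ^ N)"

text \<open>
  Finitely many polynomials vanishing at 0 simultaneously return close to 0 modulo 1 after a
  bounded time. By induction on the degree: for fixed \<open>s\<close> the function \<open>p (s + y) - p y - p s\<close> has
  smaller degree and vanishes at 0. Hence increasing times \<open>S 0, S 1, \<dots>\<close> can be chosen one after
  the other such that, for every \<open>i \<le> j\<close>, replacing \<open>p (S (Suc j) - S i)\<close> by
  \<open>p (S j - S i) + p (S (Suc j) - S j)\<close> causes a tiny error only. Up to tiny errors
  \<open>p (S j - S i)\<close> is then a difference of two partial sums of a fixed series, and among
  \<open>(2 * r) ^ N + 1\<close> partial sums two are close to each other for all \<open>p\<close>.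
\<close>

lemma recurrence:
  assumes "finite P" "card P \<le> N" "r > 0" "\<And>p. p \<in> P \<Longrightarrow> poly_mod1 k p \<and> p 0 = 0"
  shows "\<exists>h::nat. 0 < h \<and> h \<le> return_bound k N r \<and> (\<forall>p\<in>P. near_int (1 / r) (p (int h)))"
  using assms
proof (induction k arbitrary: P N r)
  case 0
  have "near_int (1 / r) (p 1)" if "p \<in> P" for p
  proof -
    from 0(4)[OF that] obtain z where "p 1 = of_int z" by (auto elim: Ints_cases)
    then show ?thesis unfolding near_int_def by (intro exI[of _ z]) auto
  qed
  then show ?case by (intro exI[of _ 1]) auto
next
  case (Suc k)
  note IH = Suc.IH and fam = Suc.prems(4)
  define K where "K = (2 * r) ^ N"
  have K: "K > 0" using \<open>r > 0\<close> by (simp add: K_def)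
  define R where "R = 2 * r * K"
  have R: "R > 0" using K \<open>r > 0\<close> by (simp add: R_def)
  define H where "H = return_bound k (N * K) R"
  define good where "good S i j \<longleftrightarrow> (\<forall>p\<in>P. near_int (1 / R)
      (p (int (S (Suc j)) - int (S i)) - p (int (S j) - int (S i)) - p (int (S (Suc j)) - int (S j))))"
    for S :: "nat \<Rightarrow> nat" and i j
  have ex: "\<exists>S. \<forall>j<J. S j < S (Suc j) \<and> S (Suc j) \<le> S j + H \<and> (\<forall>i\<le>j. good S i j)"
    if "J \<le> K" for J
    using that
  proof (induction J)
    case (Suc J)
    then obtain S where S: "\<forall>j<J. S j < S (Suc j) \<and> S (Suc j) \<le> S j + H \<and> (\<forall>i\<le>j. good S i j)"
      by auto
    \<comment> \<open>Times \<open>S 0, \<dots>, S J\<close> have been found; the next increment \<open>h\<close> has to serve all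
        differences ending at \<open>S J\<close>.\<close>
    define F where "F = (\<lambda>(p :: int \<Rightarrow> real, i) y. p ((int (S J) - int (S i)) + y) - p y - p (int (S J) - int (S i)))"
    have "\<exists>h::nat. 0 < h \<and> h \<le> H \<and> (\<forall>p\<in>F ` (P \<times> {..J}). near_int (1 / R) (p (int h)))"
      unfolding H_def
    proof (rule IH)
      show "finite (F ` (P \<times> {..J}))" using \<open>finite P\<close> by simp
      have "card (F ` (P \<times> {..J})) \<le> card (P \<times> {..J})"
        using \<open>finite P\<close> by (intro card_image_le) auto
      also have "\<dots> \<le> N * K"
        using \<open>card P \<le> N\<close> \<open>Suc J \<le> K\<close> mult_le_mono[of "card P" N "Suc J" K]
        by (simp add: card_cartesian_product)
      finally show "card (F ` (P \<times> {..J})) \<le> N * K" .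
      fix f assume "f \<in> F ` (P \<times> {..J})"
      then obtain p i where pi: "p \<in> P" "i \<le> J" "f = F (p, i)" by auto
      define s where "s = int (S J) - int (S i)"
      have "poly_mod1 k (\<lambda>y. p (y + s) - p y)" using fam[OF pi(1)] by auto
      moreover have "poly_mod1 k (\<lambda>_. p s)"
      proof (cases k)
        case 0
        have "p (0 + s) - p 0 \<in> \<int>"
          using \<open>poly_mod1 k (\<lambda>y. p (y + s) - p y)\<close> unfolding 0 poly_mod1.simps by blast
        then show ?thesis using fam[OF pi(1)] 0 by simp
      next
        case (Suc l)
        then show ?thesis by (induction l arbitrary: k) auto
      qed
      ultimately have "poly_mod1 k (\<lambda>y. (p (y + s) - p y) - p s)" by (rule poly_mod1_diff)
      then show "poly_mod1 k f \<and> f 0 = 0"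
        using fam[OF pi(1)] unfolding pi(3) by (simp add: F_def s_def add.commute)
    qed (rule R)
    then obtain h where h: "0 < h" "h \<le> H" "\<forall>p\<in>F ` (P \<times> {..J}). near_int (1 / R) (p (int h))"
      by blast
    define S' where "S' = S(Suc J := S J + h)"
    have S': "S' j = S j" if "j \<le> J" for j using that by (simp add: S'_def)
    have S'J: "S' (Suc J) = S J + h" by (simp add: S'_def)
    have "good S' i J" if "i \<le> J" for i
      unfolding good_def
    proof
      fix p assume "p \<in> P"
      then have "near_int (1 / R) (F (p, i) (int h))" using h(3) that by auto
      then show "near_int (1 / R) (p (int (S' (Suc J)) - int (S' i)) - p (int (S' J) - int (S' i))
          - p (int (S' (Suc J)) - int (S' J)))"
        using that by (simp add: F_def S' S'J algebra_simps)
    qed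
    moreover have "good S' i j" if "i \<le> j" "j < J" for i j
      using S that unfolding good_def by (simp add: S')
    ultimately have "\<forall>j<Suc J. S' j < S' (Suc j) \<and> S' (Suc j) \<le> S' j + H \<and> (\<forall>i\<le>j. good S' i j)"
      using S h(1,2) by (auto simp: less_Suc_eq S' S'J)
    then show ?case by blast
  qed auto
  from ex[of K] obtain S where
    S: "\<And>j. j < K \<Longrightarrow> S j < S (Suc j)" "\<And>j. j < K \<Longrightarrow> S (Suc j) \<le> S j + H"
       "\<And>i j. j < K \<Longrightarrow> i \<le> j \<Longrightarrow> good S i j" by blast
  define Y where "Y p j = (\<Sum>l<j. p (int (S (Suc l)) - int (S l)))" for p :: "int \<Rightarrow> real" and j
  have chain: "i + m \<le> K \<Longrightarrow> S i + m \<le> S (i + m) \<and> S (i + m) \<le> S i + m * H \<and> (\<forall>p\<in>P. near_int (m / R)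
      (p (int (S (i + m)) - int (S i)) - (Y p (i + m) - Y p i)))" for i m
  proof (induction m)
    case 0
    have "near_int 0 0" unfolding near_int_def by (intro exI[of _ 0]) auto
    then have "near_int 0 (p 0)" if "p \<in> P" for p using fam[OF that] by simp
    then show ?case by simp
  next
    case (Suc m)
    have "near_int (Suc m / R) (p (int (S (i + Suc m)) - int (S i)) - (Y p (i + Suc m) - Y p i))"
      if "p \<in> P" for p
    proof -
      have "near_int (m / R) (p (int (S (i + m)) - int (S i)) - (Y p (i + m) - Y p i))"
        using Suc that by simp
      from near_int_add[OF this S(3)[of "i + m" i, unfolded good_def, rule_format, OF _ _ that]]
      show ?thesis using Suc.prems by (simp add: Y_def add_divide_distrib algebra_simps)
    qed
    then show ?case using Suc S(1)[of "i + m"] S(2)[of "i + m"] by auto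
  qed
  define c where "c j = restrict (\<lambda>p. nat \<lfloor>2 * r * frac (Y p j)\<rfloor>) P" for j
  have "c ` {..K} \<subseteq> PiE P (\<lambda>_. {..<2 * r})"
  proof -
    have "nat \<lfloor>2 * r * frac t\<rfloor> < 2 * r" for t
    proof -
      have "real (2 * r) * frac t < real (2 * r) * 1" using \<open>r > 0\<close> frac_lt_1[of t] by (intro mult_strict_left_mono) auto
      then show ?thesis using frac_ge_0[of t] by (simp add: nat_less_iff floor_less_iff)
    qed
    then show ?thesis by (auto simp: c_def)
  qed
  then have "card (c ` {..K}) \<le> card (PiE P (\<lambda>_. {..<2 * r}))"
    using \<open>finite P\<close> by (intro card_mono finite_PiE) auto
  also have "\<dots> = (2 * r) ^ card P" using \<open>finite P\<close> by (simp add: card_PiE)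
  also have "\<dots> \<le> K" unfolding K_def using \<open>r > 0\<close> \<open>card P \<le> N\<close> by (intro power_increasing) auto
  also have "K < card {..K}" by simp
  finally have "\<not> inj_on c {..K}" by (rule pigeonhole)
  then obtain i j where ij: "i < j" "j \<le> K" "c i = c j"
    unfolding inj_on_def by (metis atMost_iff linorder_neqE_nat)
  define m where "m = j - i"
  have m: "j = i + m" "m > 0" "m \<le> K" using ij by (auto simp: m_def)
  have "near_int (1 / r) (p (int (S j - S i)))" if "p \<in> P" for p
  proof -
    from fun_cong[OF ij(3), of p] that
    have "nat \<lfloor>2 * r * frac (Y p i)\<rfloor> = nat \<lfloor>2 * r * frac (Y p j)\<rfloor>" by (simp add: c_def)
    then have "\<lfloor>2 * r * frac (Y p j)\<rfloor> = \<lfloor>2 * r * frac (Y p i)\<rfloor>"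
      by (simp add: eq_nat_nat_iff)
    then have "near_int (1 / (2 * r)) (Y p j - Y p i)"
      using near_int_frac[of "2 * r" "Y p j" "Y p i"] \<open>r > 0\<close> by simp
    from near_int_add[OF _ this, of "m / R" "p (int (S (i + m)) - int (S i)) - (Y p (i + m) - Y p i)"]
    have "near_int (m / R + 1 / (2 * r)) (p (int (S j) - int (S i)))"
      using chain[of i m] m(1) ij(2) that by simp
    moreover have "m / R \<le> 1 / (2 * r)"
      using m(3) K \<open>r > 0\<close> unfolding R_def by (simp add: field_simps)
    ultimately have "near_int (1 / r) (p (int (S j) - int (S i)))"
      by (elim near_int_mono) (simp add: field_simps)
    then show ?thesis using chain[of i m] m ij by (simp add: of_nat_diff)
  qed
  moreover have "0 < S j - S i" "S j - S i \<le> K * H"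
    using chain[of i m] m ij by (auto intro: order_trans[OF _ mult_le_mono1[of m K H]])
  ultimately show ?case unfolding H_def R_def K_def
    by (intro exI[of _ "S j - S i"]) (auto simp: K_def)
qed


section \<open>Polynomials modulo 1 that avoid an interval\<close>

text \<open>
  Recurrence gives a step \<open>h\<close> such that \<open>f (h * j)\<close> is close to \<open>f 0\<close> modulo 1 for all \<open>j\<close> up to a
  large \<open>J\<close>. A real polynomial \<open>p\<close> that interpolates these values modulo 1 without leaving the
  vicinity of its first value agrees with \<open>f (h * j)\<close> modulo 1 everywhere. As long as \<open>p\<close> has
  stayed between 0 and 1, its steps are shorter than the gap (\<open>poly_exact_step\<close>), so it cannot
  jump over the gap into another unit interval. Being bounded, it is constant.
\<close>

lemma avoiding_polynomial_periodic:
  fixes f :: "int \<Rightarrow> real"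
  assumes f: "poly_mod1 n f" "\<And>x. 0 \<le> f x" "\<And>x. f x \<le> 1"
    and gap: "\<And>x. 1 - 1 / 2 ^ n < f x \<Longrightarrow> f x = 1"
  shows "\<exists>h::nat. 0 < h \<and> h \<le> return_bound n (n * 4 ^ n) (4 ^ n) \<and> (\<forall>j. f (int h * j) - f 0 \<in> \<int>)"
proof (cases n)
  case 0
  then show ?thesis using f(1) by (intro exI[of _ 1]) auto
next
  case (Suc d)
  define \<epsilon> :: real where "\<epsilon> = 1 / 2 ^ n"
  define s :: nat where "s = 4 ^ n"
  define \<delta> :: real where "\<delta> = 1 / s"
  have s: "s > 0" "real s = 2 ^ n * 2 ^ n" by (auto simp: s_def power_mult_distrib[symmetric])
  have \<epsilon>: "0 < \<epsilon>" "\<epsilon> \<le> 1" "\<epsilon> * s = 2 ^ n" by (auto simp: \<epsilon>_def s)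
  have \<delta>: "0 < \<delta>" "2 ^ n * \<delta> = \<epsilon>" by (auto simp: \<delta>_def \<epsilon>_def s)
  have \<delta>\<epsilon>: "\<delta> < \<epsilon>"
  proof -
    have "(1::real) < 2 ^ n" using Suc by (intro one_less_power) auto
    then have "1 * \<delta> < 2 ^ n * \<delta>" using \<delta>(1) by (intro mult_strict_right_mono)
    then show ?thesis using \<delta>(2) by simp
  qed
  \<comment> \<open>The value 1 lies above the gap and is represented by 0 instead.\<close>
  define v where "v = (if f 0 = 1 then 0 else f 0)"
  have v: "0 \<le> v" "v \<le> 1 - \<epsilon>" "f 0 - v \<in> \<int>"
    using f(2)[of 0] gap[of 0] \<epsilon>(2) by (auto simp: v_def \<epsilon>_def not_less[symmetric])
  have gap': "0 \<le> t \<and> t \<le> 1 - \<epsilon>" if t: "f x - t \<in> \<int>" "- \<epsilon> < t" "t < 1" for x t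
  proof -
    from t(1) obtain z :: int where z: "f x = t + of_int z" by (auto elim!: Ints_cases simp: algebra_simps)
    have "of_int z < (2::real)" "- 1 < real_of_int z" using z f(2,3)[of x] t(2,3) \<epsilon>(2) by linarith+
    then have "z = 0 \<or> z = 1" by auto
    then show ?thesis
      using z f(2,3)[of x] gap[of x] t \<epsilon>(2) unfolding \<epsilon>_def[symmetric] by (auto simp: not_less[symmetric])
  qed
  define J where "J = d * s"
  have "d \<le> J" using s by (simp add: J_def)
  define P where "P = (\<lambda>j y. f (int j * y) - f 0) ` {1..J}"
  have "\<exists>h::nat. 0 < h \<and> h \<le> return_bound n (n * 4 ^ n) (4 ^ n) \<and> (\<forall>p\<in>P. near_int (1 / (4 ^ n :: nat)) (p (int h)))"
  proof (rule recurrence)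
    show "finite P" by (simp add: P_def)
    have "card P \<le> J" unfolding P_def by (rule order_trans[OF card_image_le]) auto
    also have "\<dots> \<le> n * 4 ^ n" using Suc by (simp add: J_def s_def)
    finally show "card P \<le> n * 4 ^ n" .
    show "poly_mod1 n p \<and> p 0 = 0" if "p \<in> P" for p
      using that poly_mod1_diff_const[OF poly_mod1_scale[OF f(1), of 0]] Suc by (auto simp: P_def)
  qed auto
  then obtain h :: nat where h: "0 < h" "h \<le> return_bound n (n * 4 ^ n) (4 ^ n)"
      "\<And>p. p \<in> P \<Longrightarrow> near_int \<delta> (p (int h))"
    by (auto simp: \<delta>_def s_def)
  have "\<exists>w. \<bar>w - v\<bar> \<le> \<delta> \<and> f (int h * int j) - w \<in> \<int>" if "j \<le> J" for j
  proof (cases "j = 0")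
    case True
    then show ?thesis using v(3) \<delta>(1) by (intro exI[of _ v]) auto
  next
    case False
    then have "near_int \<delta> (f (int j * h) - f 0)" using that h(3)[of "\<lambda>y. f (int j * y) - f 0"]
      by (auto simp: P_def)
    then obtain z :: int where "\<bar>f (int j * h) - f 0 - z\<bar> \<le> \<delta>" unfolding near_int_def by blast
    moreover have "f (int h * int j) - (v + (f (int j * h) - f 0 - z)) \<in> \<int>"
      using Ints_add[OF v(3) Ints_of_int[of z]] by (simp add: mult.commute algebra_simps)
    ultimately show ?thesis by (intro exI[of _ "v + (f (int j * h) - f 0 - z)"]) auto
  qed
  then obtain w where w: "\<And>j. j \<le> J \<Longrightarrow> \<bar>w j - v\<bar> \<le> \<delta>" "\<And>j. j \<le> J \<Longrightarrow> f (int h * int j) - w j \<in> \<int>"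
    by metis
  obtain p where p: "poly_exact n p" "\<And>j. j < n \<Longrightarrow> p (int j) = w j"
    using interpolation by blast
  have fp: "f (int h * x) - p x \<in> \<int>" for x
  proof (rule poly_mod1_Ints[where f = "\<lambda>x. f (int h * x) - p x"])
    show "poly_mod1 n (\<lambda>x. f (int h * x) - p x)"
      using poly_mod1_diff[OF poly_mod1_scale[OF f(1), of 0 h] poly_exact_imp_poly_mod1[OF p(1)]] by simp
    show "f (int h * int j) - p (int j) \<in> \<int>" if "j < n" for j
      using w(2)[of j] p(2)[OF that] that Suc \<open>d \<le> J\<close> by simp
  qed
  \<comment> \<open>The interpolating polynomial follows the lifted values even beyond the nodes, up to
      \<open>J\<close>.\<close>
  have start: "p (int j) = w j" if "j \<le> J" for j
    using that
  proof (induction j rule: less_induct)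
    case (less j)
    show ?case
    proof (cases "j < n")
      case False
      then obtain i where i: "j = Suc i" "d \<le> i" using Suc by (cases j) auto
      have edge: "poly_exact (Suc d) (\<lambda>x. p x - v)" using p(1) Suc by simp
      have "\<bar>(p (int i + 1) - v) - (p (int i) - v)\<bar> * real_of_int 1 \<le> (2 ^ Suc d - 2) * \<delta>"
      proof (rule poly_exact_step[OF edge])
        fix x :: int assume x: "int i - int d * 1 \<le> x" "x \<le> int i"
        then obtain l where l: "x = int l" "l \<le> i" using i(2) by (metis nonneg_int_cases of_nat_le_iff
              diff_ge_0_iff_ge mult.right_neutral order_trans)
        then show "\<bar>p x - v\<bar> \<le> \<delta>" using less.IH[of l] w(1)[of l] i less.prems by simp
      qed simp
      moreover have "\<bar>p (int i) - v\<bar> \<le> \<delta>" using less.IH[of i] w(1)[of i] i less.prems by simp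
      moreover have "\<bar>w j - v\<bar> \<le> \<delta>" using w(1) less.prems by simp
      ultimately have "\<bar>p (int j) - w j\<bar> \<le> (2 ^ Suc d - 2) * \<delta> + \<delta> + \<delta>"
        using i by (simp add: add.commute)
      also have "\<dots> = \<epsilon>" using \<delta>(2) Suc by (simp add: algebra_simps)
      also have "\<epsilon> < 1" unfolding \<epsilon>_def using Suc one_less_power[of "2::real" n] by simp
      finally have "\<bar>p (int j) - w j\<bar> < 1" .
      moreover have "p (int j) - w j \<in> \<int>"
        using Ints_diff[OF w(2)[OF less.prems] fp[of "int j"]] by (simp add: algebra_simps)
      ultimately show ?thesis using Ints_nonzero_abs_less1 by force
    qed (use p(2) in auto)
  qed
  \<comment> \<open>From \<open>J\<close> on, steps of length less than \<open>\<epsilon>\<close> cannot cross the gap of length \<open>\<epsilon>\<close>.\<close>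
  have range: "0 \<le> p (int j) \<and> p (int j) \<le> 1 - \<epsilon>" for j
  proof (induction j rule: less_induct)
    case (less j)
    show ?case
    proof (cases "j \<le> J")
      case True
      then have "\<bar>p (int j) - v\<bar> \<le> \<delta>" using start w(1) by simp
      then show ?thesis using gap'[OF fp[of "int j"]] v \<delta>\<epsilon> by auto
    next
      case False
      then obtain i where i: "j = Suc i" "J \<le> i" by (cases j) auto
      have "\<bar>p (int i + 1) - p (int i)\<bar> * real_of_int (int s) \<le> (2 ^ Suc d - 2) * 1"
      proof (rule poly_exact_step)
        show "poly_exact (Suc d) p" using p(1) Suc by simp
        fix x :: int assume x: "int i - int d * int s \<le> x" "x \<le> int i"
        have "int J \<le> int i" using i(2) by simp
        then have "0 \<le> x" using x(1) by (simp add: J_def)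
        then obtain l where l: "x = int l" by (metis nonneg_int_cases)
        then show "\<bar>p x\<bar> \<le> 1" using less.IH[of l] x i \<epsilon>(1) by simp
      qed (use s in simp)
      also have "\<dots> < \<epsilon> * s" using Suc \<epsilon>(3) by simp
      finally have "\<bar>p (int i + 1) - p (int i)\<bar> < \<epsilon>" using s by simp
      then show ?thesis using less.IH[of i] i gap'[OF fp[of "int j"]] by (auto simp: add.commute)
    qed
  qed
  have const: "p x = p 0" for x
  proof (rule poly_exact_bounded_const[OF p(1), of 1])
    show "\<bar>p j\<bar> \<le> 1" if "j \<ge> 0" for j using range[of "nat j"] that \<epsilon>(1) by simp
  qed
  have "f (int h * j) - f 0 \<in> \<int>" for j
    using Ints_diff[OF fp[of j] fp[of 0]] const[of j] by simp
  then show ?thesis using h(1,2) by blast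
qed

section \<open>Dilations of tilings\<close>

declare split_paired_All [simp del] split_paired_Ex [simp del]

definition scale :: "int \<Rightarrow> int \<times> int \<Rightarrow> int \<times> int" where
  "scale r v = (r * fst v, r * snd v)"

lemma scale_simps [simp]:
  "scale r (x, y) = (r * x, r * y)" "fst (scale r v) = r * fst v" "snd (scale r v) = r * snd v"
  "scale 0 v = 0" "scale 1 v = v"
  by (auto simp: scale_def zero_prod_def)

lemma scale_scale: "scale r (scale s v) = scale (r * s) v"
  by (simp add: scale_def)

lemma scale_add: "scale r (v + w) = scale r v + scale r w"
  by (simp add: scale_def prod_eq_iff algebra_simps)

lemma scale_diff: "scale r (v - w) = scale r v - scale r w"
  by (simp add: scale_def prod_eq_iff algebra_simps)

lemma scale_add_left: "scale (r + s) v = scale r v + scale s v"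
  by (simp add: scale_def prod_eq_iff algebra_simps)

lemma inj_scale: "r \<noteq> 0 \<Longrightarrow> inj (scale r)"
  by (auto simp: inj_def scale_def prod_eq_iff)

definition shift_sum :: "(int \<times> int) set \<Rightarrow> (int \<times> int \<Rightarrow> int) \<Rightarrow> int \<times> int \<Rightarrow> int" where
  "shift_sum F g x = (\<Sum>f\<in>F. g (x - f))"

lemma binomial_sum_Suc:
  fixes t :: "nat \<Rightarrow> int"
  shows "(\<Sum>j\<le>Suc k. int (Suc k choose j) * t j) =
    (\<Sum>j\<le>k. int (k choose j) * t (Suc j)) + (\<Sum>j\<le>k. int (k choose j) * t j)"
proof -
  have 1: "(\<Sum>j\<le>Suc k. int (Suc k choose j) * t j) =
      int (Suc k choose 0) * t 0 + (\<Sum>j\<le>k. int (Suc k choose Suc j) * t (Suc j))"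
    by (rule sum.atMost_Suc_shift)
  have 2: "(\<Sum>j\<le>Suc k. int (k choose j) * t j) =
      int (k choose 0) * t 0 + (\<Sum>j\<le>k. int (k choose Suc j) * t (Suc j))"
    by (rule sum.atMost_Suc_shift)
  have 3: "(\<Sum>j\<le>k. int (Suc k choose Suc j) * t (Suc j)) =
      (\<Sum>j\<le>k. int (k choose j) * t (Suc j)) + (\<Sum>j\<le>k. int (k choose Suc j) * t (Suc j))"
    unfolding sum.distrib[symmetric] by (intro sum.cong) (auto simp: distrib_right)
  have 4: "(\<Sum>j\<le>Suc k. int (k choose j) * t j) = (\<Sum>j\<le>k. int (k choose j) * t j)"
    by (simp add: binomial_eq_0)
  show ?thesis unfolding 1 3 using 2 unfolding 4 by simp
qed

text \<open>
  The binomial theorem for the two commuting operators "translate by \<open>f\<close>" and \<open>shift_sum F\<close>.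
\<close>

lemma shift_sum_insert_power:
  assumes "finite F" "f \<notin> F"
  shows "(shift_sum (insert f F) ^^ k) g x =
    (\<Sum>j\<le>k. int (k choose j) * (shift_sum F ^^ (k - j)) g (x - scale (int j) f))"
proof (induction k arbitrary: x)
  case (Suc k)
  define t where "t j = (shift_sum F ^^ (Suc k - j)) g (x - scale (int j) f)" for j
  have "(shift_sum (insert f F) ^^ Suc k) g x =
      (shift_sum (insert f F) ^^ k) g (x - f) + (\<Sum>e\<in>F. (shift_sum (insert f F) ^^ k) g (x - e))"
    using assms by (simp add: shift_sum_def)
  also have "(shift_sum (insert f F) ^^ k) g (x - f) = (\<Sum>j\<le>k. int (k choose j) * t (Suc j))"
    unfolding Suc t_def by (intro sum.cong) (auto simp: scale_add_left diff_diff_eq)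
  also have "(\<Sum>e\<in>F. (shift_sum (insert f F) ^^ k) g (x - e)) =
      (\<Sum>j\<le>k. \<Sum>e\<in>F. int (k choose j) * (shift_sum F ^^ (k - j)) g (x - e - scale (int j) f))"
    unfolding Suc by (rule sum.swap)
  also have "\<dots> = (\<Sum>j\<le>k. int (k choose j) * t j)"
  proof (rule sum.cong[OF refl])
    fix j assume "j \<in> {..k}"
    then have "t j = (\<Sum>e\<in>F. (shift_sum F ^^ (k - j)) g (x - scale (int j) f - e))"
      unfolding t_def by (simp add: Suc_diff_le shift_sum_def)
    then show "(\<Sum>e\<in>F. int (k choose j) * (shift_sum F ^^ (k - j)) g (x - e - scale (int j) f)) =
        int (k choose j) * t j"
      by (simp add: sum_distrib_left diff_diff_eq add.commute)
  qed
  finally show ?case using binomial_sum_Suc[of k t] by (simp add: t_def del: binomial_Suc_Suc)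
qed simp

text \<open>
  The freshman's dream for sums of translations: modulo a prime only the extreme terms of the
  binomial expansion survive.
\<close>

lemma shift_sum_prime_power:
  assumes "finite F" "prime p"
  shows "int p dvd (shift_sum F ^^ p) g x - (\<Sum>f\<in>F. g (x - scale (int p) f))"
  using assms(1)
proof (induction F arbitrary: x)
  case empty
  have "(shift_sum {} ^^ p) g x = 0"
    using prime_gt_0_nat[OF assms(2)] by (cases p) (auto simp: shift_sum_def)
  then show ?case by simp
next
  case (insert f F)
  define t where "t j = int (p choose j) * (shift_sum F ^^ (p - j)) g (x - scale (int j) f)" for j
  have p: "p > 0" using assms(2) by (rule prime_gt_0_nat)
  have "{..p} = insert 0 (insert p {0<..<p})" using p by auto
  then have split: "(\<Sum>j\<le>p. t j) = t 0 + t p + (\<Sum>j\<in>{0<..<p}. t j)"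
    using p by simp
  moreover have "int p dvd (\<Sum>j\<in>{0<..<p}. t j)"
  proof (intro dvd_sum)
    fix j assume "j \<in> {0<..<p}"
    then have "p dvd (p choose j)" using assms(2) by (intro dvd_choose_prime) auto
    then show "int p dvd t j" unfolding t_def by simp
  qed
  moreover have t0p: "t 0 = (shift_sum F ^^ p) g x" "t p = g (x - scale (int p) f)"
    by (auto simp: t_def)
  moreover have pow: "(shift_sum (insert f F) ^^ p) g x = (\<Sum>j\<le>p. t j)"
    unfolding t_def by (rule shift_sum_insert_power) (use insert in auto)
  moreover note insert.IH[of x]
  ultimately have "int p dvd ((shift_sum F ^^ p) g x - (\<Sum>f\<in>F. g (x - scale (int p) f))) + (\<Sum>j\<in>{0<..<p}. t j)"
    by (intro dvd_add)
  then show ?case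
    using insert.hyps split unfolding pow t0p by (simp add: algebra_simps)
qed

lemma shift_sum_const_power: "(shift_sum F ^^ k) (\<lambda>_. c) x = c * int (card F) ^ k"
  by (induction k arbitrary: x) (auto simp: shift_sum_def)

text \<open>
  Let \<open>n = card F\<close>. Applying the \<open>p\<close>-th power of \<open>shift_sum F\<close> to \<open>a\<close> gives \<open>n ^ (p - 1)\<close>, and
  modulo \<open>p\<close> that power is the sum of the translations by \<open>p F\<close>. So the sum in question is
  congruent to 1 modulo \<open>p\<close>. As it lies between 0 and \<open>n < p\<close>, it equals 1. (That \<open>n ^ p\<close> is
  congruent to \<open>n\<close> is itself the same statement for the constant function.)
\<close>

lemma dilation_prime:
  assumes "finite F" "\<And>x. a x \<ge> (0::int)" "\<And>x. (\<Sum>f\<in>F. a (x - f)) = 1"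
    and p: "prime p" "card F < p"
  shows "(\<Sum>f\<in>F. a (x - scale (int p) f)) = 1"
proof -
  define V where "V = (\<Sum>f\<in>F. a (x - scale (int p) f))"
  define n where "n = int (card F)"
  have "F \<noteq> {}" using assms(3)[of 0] by auto
  then have n: "0 < n" "n < int p" using assms(1) p(2) by (auto simp: n_def card_gt_0_iff)
  obtain k where k: "p = Suc k" using prime_gt_0_nat[OF p(1)] by (cases p) auto
  have one: "shift_sum F a = (\<lambda>_. 1)" using assms(3) by (auto simp: shift_sum_def)
  have "(shift_sum F ^^ p) a x = (shift_sum F ^^ k) (\<lambda>_. 1) x"
    unfolding k funpow_Suc_right o_apply one by simp
  then have "(shift_sum F ^^ p) a x = n ^ k" by (simp add: shift_sum_const_power n_def)
  with shift_sum_prime_power[OF assms(1) p(1), of a x] have 1: "int p dvd n ^ k - V"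
    by (simp add: V_def)
  have 2: "int p dvd n ^ p - n"
    using shift_sum_prime_power[OF assms(1) p(1), of "\<lambda>_. 1" x]
    by (simp add: shift_sum_const_power n_def)
  have "int p dvd (n ^ p - n) - n * (n ^ k - V)"
    by (rule dvd_diff[OF 2 dvd_mult[OF 1]])
  then have "int p dvd n * (V - 1)" by (simp add: k algebra_simps)
  moreover have "\<not> int p dvd n" using n zdvd_imp_le by force
  ultimately have 3: "int p dvd V - 1" using p(1) by (simp add: prime_dvd_mult_iff)
  have a1: "a y \<le> 1" for y
  proof -
    obtain f where f: "f \<in> F" using \<open>F \<noteq> {}\<close> by blast
    have "a ((y + f) - f) \<le> (\<Sum>e\<in>F. a ((y + f) - e))"
      using assms(1,2) f by (intro member_le_sum) auto
    then show ?thesis using assms(3) by simp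
  qed
  have "0 \<le> V" unfolding V_def by (intro sum_nonneg assms(2))
  moreover have "V \<le> (\<Sum>f\<in>F. 1)" unfolding V_def by (intro sum_mono a1)
  ultimately have "\<bar>V - 1\<bar> < int p" using n by (auto simp: n_def)
  with 3 have "V - 1 = 0" using dvd_imp_le_int[of "V - 1" "int p"] by fastforce
  then show ?thesis by (simp add: V_def)
qed

text \<open>
  Dilating by one prime factor of \<open>r\<close> at a time; the dilated set again has \<open>card F\<close> elements.
\<close>

lemma dilation:
  assumes "finite F" "\<And>x. a x \<ge> (0::int)" "\<And>x. (\<Sum>f\<in>F. a (x - f)) = 1"
    and "r > 0" "\<And>p. prime p \<Longrightarrow> p dvd r \<Longrightarrow> card F < p"
  shows "(\<Sum>f\<in>F. a (x - scale (int r) f)) = 1"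
  using assms(4,5)
proof (induction r arbitrary: x rule: less_induct)
  case (less r)
  show ?case
  proof (cases "r = 1")
    case True
    then show ?thesis using assms(3) by simp
  next
    case False
    then obtain p where p: "prime p" "p dvd r" using prime_factor_nat by blast
    then obtain s where s: "r = p * s" by blast
    have sr: "s < r" "s > 0" using s less.prems(1) prime_gt_1_nat[OF p(1)] by auto
    have inj: "inj_on (scale (int s)) F" using inj_scale[of "int s"] sr by (auto intro: inj_on_subset)
    have "(\<Sum>f\<in>scale (int s) ` F. a (x - scale (int p) f)) = 1"
    proof (rule dilation_prime[OF _ assms(2) _ p(1)])
      show "finite (scale (int s) ` F)" using assms(1) by simp
      show "(\<Sum>f\<in>scale (int s) ` F. a (x - f)) = 1" for x
        using less.IH[OF sr, of x] less.prems(2) s sum.reindex[OF inj, of "\<lambda>f. a (x - f)"]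
        by (simp add: o_def)
      show "card (scale (int s) ` F) < p" using card_image[OF inj] less.prems(2)[OF p] by simp
    qed
    then show ?thesis using sum.reindex[OF inj, of "\<lambda>f. a (x - scale (int p) f)"]
      by (simp add: o_def scale_scale s)
  qed
qed

lemma prime_dvd_fact_progression:
  assumes "prime p" "p dvd 1 + fact n * k" shows "n < (p::nat)"
proof (rule ccontr)
  assume "\<not> n < p"
  then have "p dvd fact n" using assms(1) by (simp add: prime_dvd_fact_iff)
  then have "p dvd fact n * k" by simp
  then have "p dvd 1" using assms(2) by (metis dvd_add_left_iff)
  then show False using assms(1) by simp
qed

section \<open>Averages of bounded sequences\<close>

text \<open>
  A countable family of bounded sequences has Cesaro means that converge along a common
  subsequence. The limits \<open>\<mu>\<close> behave like a mean value: they respect linear relations and are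
  invariant under the shift.
\<close>

lemma common_means:
  fixes s :: "'i::countable \<Rightarrow> nat \<Rightarrow> real"
  assumes s: "\<And>i k. 0 \<le> s i k" "\<And>i k. s i k \<le> 1"
  obtains \<mu> where "\<forall>i. 0 \<le> \<mu> i \<and> \<mu> i \<le> 1"
    "\<forall>i j. (\<forall>k. s i (Suc k) = s j k) \<longrightarrow> \<mu> i = \<mu> j"
    "\<forall>i J c. finite J \<longrightarrow> (\<forall>k. s i k - (\<Sum>j\<in>J. s j k) = c) \<longrightarrow> \<mu> i - (\<Sum>j\<in>J. \<mu> j) = c"
proof -
  define A where "A K i = (\<Sum>k<K. s i k) / real K" for K i
  have A: "0 \<le> A K i" "A K i \<le> 1" for K i
  proof -
    show "0 \<le> A K i" unfolding A_def by (intro divide_nonneg_nonneg sum_nonneg s) auto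
    have "(\<Sum>k<K. s i k) \<le> (\<Sum>k<K. 1)" by (intro sum_mono s)
    then show "A K i \<le> 1" unfolding A_def by (simp add: divide_le_eq)
  qed
  have "norm (A K i) \<le> 1" for K i using A[of K i] by simp
  then obtain r where r: "strict_mono (r :: nat \<Rightarrow> nat)"
      "\<And>i. i \<in> UNIV \<Longrightarrow> \<exists>l. (\<lambda>n. A (r n) i) \<longlonglongrightarrow> l"
    using function_convergent_subsequence[of UNIV A 1] by (metis countableI_type)
  then obtain \<mu> where \<mu>: "\<And>i. (\<lambda>n. A (r n) i) \<longlonglongrightarrow> \<mu> i" by (metis UNIV_I)
  have lin: "\<mu> i - (\<Sum>j\<in>J. \<mu> j) = c" if J: "finite J" "\<And>k. s i k - (\<Sum>j\<in>J. s j k) = c" for i J c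
  proof (rule LIMSEQ_unique)
    show "(\<lambda>n. A (r n) i - (\<Sum>j\<in>J. A (r n) j)) \<longlonglongrightarrow> \<mu> i - (\<Sum>j\<in>J. \<mu> j)"
      by (intro tendsto_intros \<mu>)
    have "A K i - (\<Sum>j\<in>J. A K j) = c" if "K > 0" for K
    proof -
      have "A K i - (\<Sum>j\<in>J. A K j) = (\<Sum>k<K. s i k - (\<Sum>j\<in>J. s j k)) / K"
        unfolding A_def sum_subtractf diff_divide_distrib sum_divide_distrib[symmetric]
        by (subst sum.swap) simp
      then show ?thesis using that J(2) by simp
    qed
    moreover have "eventually (\<lambda>n. r n > 0) sequentially"
      using seq_suble[OF r(1)] by (intro eventually_sequentiallyI[of 1]) (meson less_le_trans zero_less_one)
    ultimately show "(\<lambda>n. A (r n) i - (\<Sum>j\<in>J. A (r n) j)) \<longlonglongrightarrow> c"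
      by (intro tendsto_eventually) (auto elim: eventually_mono)
  qed
  have shift: "\<mu> i = \<mu> j" if ij: "\<And>k. s i (Suc k) = s j k" for i j
  proof -
    have "\<bar>A K i - A K j\<bar> \<le> 1 / K" for K
    proof (cases "K = 0")
      case False
      have "(\<Sum>k<K. s j k) = (\<Sum>k<K. s i (Suc k))" using ij by simp
      also have "\<dots> = (\<Sum>k<Suc K. s i k) - s i 0" by (subst sum.lessThan_Suc_shift) simp
      finally have "A K i - A K j = (s i 0 - s i K) / K"
        unfolding A_def by (simp add: diff_divide_distrib add_divide_distrib)
      moreover have "\<bar>s i 0 - s i K\<bar> \<le> 1" using s(1)[of i 0] s(2)[of i 0] s(1)[of i K] s(2)[of i K] by linarith
      ultimately show ?thesis by (simp add: divide_right_mono)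
    qed (simp add: A_def)
    then have bd: "norm (A (r n) i - A (r n) j) \<le> 1 / real (r n)" for n by simp
    have "(\<lambda>n. 1 / real (r n)) \<longlonglongrightarrow> 0"
      using LIMSEQ_subseq_LIMSEQ[OF lim_1_over_n r(1)] by (simp add: o_def)
    then have null: "(\<lambda>n. A (r n) i - A (r n) j) \<longlonglongrightarrow> 0"
      by (rule Lim_null_comparison[OF always_eventually[OF allI[OF bd]]])
    have "\<mu> i - \<mu> j = 0"
      by (rule LIMSEQ_unique[OF tendsto_diff[OF \<mu> \<mu>] null])
    then show ?thesis by simp
  qed
  have "0 \<le> \<mu> i" for i by (rule LIMSEQ_le_const[OF \<mu>]) (simp add: A)
  moreover have "\<mu> i \<le> 1" for i by (rule LIMSEQ_le_const2[OF \<mu>]) (simp add: A)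
  ultimately show ?thesis using that[of \<mu>] shift lin by simp
qed

text \<open>
  The average over \<open>k\<close> of \<open>b (x - v - scale (q * int k) v)\<close> is invariant under translation by
  \<open>scale q v\<close>, because this translation only shifts the index \<open>k\<close>. Periods which \<open>b\<close> and the \<open>g k\<close>
  have from the beginning are inherited.
\<close>

lemma averaging:
  fixes b c :: "int \<times> int \<Rightarrow> real" and g :: "nat \<Rightarrow> int \<times> int \<Rightarrow> real"
  assumes "finite V" and b: "\<And>x. 0 \<le> b x" "\<And>x. b x \<le> 1"
    and g: "\<And>k x. 0 \<le> g k x" "\<And>k x. g k x \<le> 1"
    and rel: "\<And>k x. c x = g k x - (\<Sum>v\<in>V. b (x - v - scale (q * int k) v))"
  obtains \<gamma> \<phi> where "\<forall>x. c x = \<gamma> x - (\<Sum>v\<in>V. \<phi> v x)"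
    "\<forall>v x. 0 \<le> \<phi> v x \<and> \<phi> v x \<le> 1"
    "\<forall>v x. \<phi> v (x + scale q v) = \<phi> v x"
    "\<forall>w. (\<forall>x. b (x + w) = b x) \<longrightarrow> (\<forall>v x. \<phi> v (x + w) = \<phi> v x)"
    "\<forall>w. (\<forall>k x. g k (x + w) = g k x) \<longrightarrow> (\<forall>x. \<gamma> (x + w) = \<gamma> x)"
    "\<forall>x z. (\<forall>k. g k x = z) \<longrightarrow> \<gamma> x = z"
proof -
  define s :: "(int \<times> int) option \<times> (int \<times> int) \<Rightarrow> nat \<Rightarrow> real" where
    "s = (\<lambda>(i, x) k. case i of None \<Rightarrow> g k x | Some v \<Rightarrow> b (x - v - scale (q * int k) v))"
  have s01: "0 \<le> s i k" "s i k \<le> 1" for i k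
    using b g by (auto simp: s_def split: prod.splits option.splits)
  obtain \<mu> where "\<forall>i. 0 \<le> \<mu> i \<and> \<mu> i \<le> 1"
    "\<forall>i j. (\<forall>k. s i (Suc k) = s j k) \<longrightarrow> \<mu> i = \<mu> j"
    "\<forall>i J c. finite J \<longrightarrow> (\<forall>k. s i k - (\<Sum>j\<in>J. s j k) = c) \<longrightarrow> \<mu> i - (\<Sum>j\<in>J. \<mu> j) = c"
    by (rule common_means[of s, OF s01]) (rule that)
  note bounds = this(1) and shift = this(2)[rule_format] and lin = this(3)[rule_format]
  have eq: "\<mu> i = \<mu> j" if "\<And>k. s i k = s j k" for i j
    using lin[of "{j}" i 0] that by simp
  have const: "\<mu> i = c" if "\<And>k. s i k = c" for i c
    using lin[of "{}" i c] that by simp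
  have inj: "inj_on (\<lambda>v. (Some v, x)) V" for x :: "int \<times> int" by (auto simp: inj_on_def)
  have "c x = \<mu> (None, x) - (\<Sum>v\<in>V. \<mu> (Some v, x))" for x
  proof -
    have "\<mu> (None, x) - (\<Sum>j\<in>(\<lambda>v. (Some v, x)) ` V. \<mu> j) = c x"
    proof (rule lin)
      show "s (None, x) k - (\<Sum>j\<in>(\<lambda>v. (Some v, x)) ` V. s j k) = c x" for k
        using rel[of x k] by (simp add: sum.reindex[OF inj] s_def)
    qed (use assms(1) in simp)
    then show ?thesis by (simp add: sum.reindex[OF inj])
  qed
  moreover have "\<mu> (Some v, x + scale q v) = \<mu> (Some v, x)" for v x
  proof (rule shift)
    fix k
    have eq: "x + scale q v - v - scale (q * int (Suc k)) v = x - v - scale (q * int k) v"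
      by (simp add: prod_eq_iff algebra_simps)
    show "s (Some v, x + scale q v) (Suc k) = s (Some v, x) k"
      unfolding s_def prod.case option.case eq ..
  qed
  moreover have "\<mu> (Some v, x + w) = \<mu> (Some v, x)" if w: "\<forall>x. b (x + w) = b x" for w v x
  proof (rule eq)
    fix k
    have eq: "x + w - v - scale (q * int k) v = x - v - scale (q * int k) v + w" by simp
    show "s (Some v, x + w) k = s (Some v, x) k"
      unfolding s_def prod.case option.case eq by (rule w[rule_format])
  qed
  moreover have "\<mu> (None, x + w) = \<mu> (None, x)" if "\<forall>k x. g k (x + w) = g k x" for w x
    using that by (intro eq) (simp add: s_def)
  moreover have "\<mu> (None, x) = z" if "\<forall>k. g k x = z" for x z
    using that by (intro const) (simp add: s_def)
  ultimately show ?thesis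
    using bounds by (intro that[of "\<lambda>x. \<mu> (None, x)" "\<lambda>v x. \<mu> (Some v, x)"]) blast+
qed

section \<open>Lattices and periods in the plane\<close>

definition det2 :: "int \<times> int \<Rightarrow> int \<times> int \<Rightarrow> int" where
  "det2 v w = fst v * snd w - snd v * fst w"

definition dot2 :: "int \<times> int \<Rightarrow> int \<times> int \<Rightarrow> int" where
  "dot2 v w = fst v * fst w + snd v * snd w"

lemma cramer: "scale (det2 i j) z = scale (det2 z j) i + scale (det2 i z) j"
  by (simp add: prod_eq_iff det2_def algebra_simps)

text \<open>
  Cramer's rule: the lattice spanned by \<open>i\<close> and \<open>j\<close> contains all multiples of \<open>det2 i j\<close>.
\<close>

lemma cramer_dvd:
  assumes "det2 i j dvd e"
  shows "\<exists>\<alpha> \<beta>. scale e z = scale \<alpha> i + scale \<beta> j"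
proof -
  from assms obtain k where "e = det2 i j * k" by blast
  then have "scale e z = scale k (scale (det2 i j) z)" by (simp add: scale_scale mult.commute)
  also have "\<dots> = scale (k * det2 z j) i + scale (k * det2 i z) j"
    unfolding cramer[of i j z] by (simp add: scale_add scale_scale)
  finally show ?thesis by blast
qed

text \<open>
  Parallel vectors have an explicit common multiple. This is used to find common periods of
  functions that are periodic along parallel vectors.
\<close>

lemma parallel_scale: "det2 v w = 0 \<Longrightarrow> scale (dot2 w w) v = scale (dot2 v w) w"
  by (simp add: prod_eq_iff det2_def dot2_def algebra_simps)

lemma dot2_pos: "v \<noteq> 0 \<Longrightarrow> dot2 v v > 0"
proof -
  assume "v \<noteq> 0"
  then have "fst v \<noteq> 0 \<or> snd v \<noteq> 0" by (simp add: prod_eq_iff)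
  then show ?thesis unfolding dot2_def
    using sum_squares_gt_zero_iff by blast
qed

lemma parallel_trans:
  assumes "det2 u v = 0" "det2 v w = 0" "v \<noteq> 0"
  shows "det2 u w = 0"
proof -
  have "dot2 v v * det2 u w = 0"
    using assms(1,2) unfolding det2_def dot2_def by algebra
  then show ?thesis using dot2_pos[OF assms(3)] by simp
qed

lemma det2_commute_zero: "det2 v w = 0 \<longleftrightarrow> det2 w v = 0"
  by (auto simp: det2_def algebra_simps)

lemma det2_linear:
  "det2 i (x + y) = det2 i x + det2 i y" "det2 i (x - y) = det2 i x - det2 i y"
  "det2 i (scale r x) = r * det2 i x" "det2 i i = 0"
  by (auto simp: det2_def algebra_simps)

lemma period_multiple:
  assumes "\<And>x. f (x + h) = f (x :: int \<times> int)"
  shows "f (x + scale k h) = f x"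
proof (induction k rule: int_induct[of _ 0])
  case (step1 k)
  then show ?case using assms[of "x + scale k h"] by (simp add: scale_add_left add.assoc)
next
  case (step2 k)
  have "scale k h = scale (k - 1) h + h" by (simp add: prod_eq_iff algebra_simps)
  then show ?case using step2 assms[of "x + scale (k - 1) h"] by (simp add: add.assoc)
qed simp

lemma period_lattice:
  assumes "\<And>x. f (x + h) = f (x :: int \<times> int)" "\<And>x. f (x + h') = f x"
    "w = scale k h + scale l h'"
  shows "f (x + w) = f x"
  using period_multiple[of f h x k, OF assms(1)] period_multiple[of f h' "x + scale k h" l, OF assms(2)]
  by (simp add: assms(3) add.assoc)

section \<open>Stripe functions and weak periodicity\<close>

text \<open>
  Polynomials modulo 1 of degree less than \<open>k\<close> in the plane, where only differences along the
  lattice of multiples of \<open>E\<close> are considered.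
\<close>

fun poly_mod1_plane :: "int \<Rightarrow> nat \<Rightarrow> (int \<times> int \<Rightarrow> real) \<Rightarrow> bool" where
  "poly_mod1_plane E 0 \<phi> \<longleftrightarrow> (\<forall>x. \<phi> x \<in> \<int>)"
| "poly_mod1_plane E (Suc k) \<phi> \<longleftrightarrow> (\<forall>u. poly_mod1_plane E k (\<lambda>x. \<phi> (x + scale E u) - \<phi> x))"

lemma poly_mod1_plane_line: "poly_mod1_plane E k \<phi> \<Longrightarrow> poly_mod1 k (\<lambda>t. \<phi> (x + scale t (scale E u)))"
proof (induction k arbitrary: \<phi>)
  case (Suc k)
  have "poly_mod1 k (\<lambda>t. \<phi> (x + scale t (scale E u) + scale E (scale h u)) - \<phi> (x + scale t (scale E u)))" for h
    using Suc.IH[of "\<lambda>x. \<phi> (x + scale E (scale h u)) - \<phi> x"] Suc.prems by simp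
  moreover have "x + scale t (scale E u) + scale E (scale h u) = x + scale (t + h) (scale E u)" for t h
    by (simp add: prod_eq_iff algebra_simps)
  ultimately show ?case by simp
qed simp

text \<open>
  Each \<open>\<theta> j\<close> is killed by a difference along its period \<open>H j\<close>, so differencing once for every \<open>j\<close>
  leaves a difference of \<open>\<psi>\<close> alone, which is therefore an integer. The step along \<open>scale E u\<close> may
  be replaced by one along a multiple of \<open>H j\<close>, because the two differ by a period of \<open>\<psi>\<close>.
\<close>

lemma poly_mod1_plane_of_sum:
  assumes "finite S" "\<And>x. \<psi> (x + h) = \<psi> x" "\<And>j x. j \<in> S \<Longrightarrow> \<theta> j (x + H j) = \<theta> j x"
    and "\<And>j u. j \<in> S \<Longrightarrow> \<exists>\<alpha> \<beta>. scale E u = scale \<alpha> h + scale \<beta> (H j)"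
    and "\<And>x. \<psi> x + (\<Sum>j\<in>S. \<theta> j x) \<in> \<int>"
  shows "poly_mod1_plane E (card S) \<psi>"
  using assms
proof (induction S arbitrary: \<psi> \<theta> rule: finite_induct)
  case (insert j S)
  have "poly_mod1_plane E (card S) (\<lambda>x. \<psi> (x + scale E u) - \<psi> x)" for u
  proof -
    obtain \<alpha> \<beta> where u: "scale E u = scale \<alpha> h + scale \<beta> (H j)" using insert.prems(3)[of j u] by auto
    define w where "w = scale \<beta> (H j)"
    have \<psi>: "\<psi> (x + scale E u) = \<psi> (x + w)" for x
      using period_multiple[of \<psi> h "x + w" \<alpha>, OF insert.prems(1)] u by (simp add: w_def algebra_simps)
    have "poly_mod1_plane E (card S) (\<lambda>x. \<psi> (x + w) - \<psi> x)"
    proof (rule insert.IH[where \<theta> = "\<lambda>j x. \<theta> j (x + w) - \<theta> j x"])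
      show "\<psi> (x + h + w) - \<psi> (x + h) = \<psi> (x + w) - \<psi> x" for x
        using insert.prems(1)[of "x + w"] insert.prems(1)[of x] by (simp add: algebra_simps)
      show "\<theta> k (x + H k + w) - \<theta> k (x + H k) = \<theta> k (x + w) - \<theta> k x" if "k \<in> S" for k x
        using insert.prems(2)[of k "x + w"] insert.prems(2)[of k x] that by (simp add: algebra_simps)
      show "\<psi> (x + w) - \<psi> x + (\<Sum>k\<in>S. \<theta> k (x + w) - \<theta> k x) \<in> \<int>" for x
      proof -
        have "\<theta> j (x + w) = \<theta> j x"
          unfolding w_def by (rule period_multiple[of "\<theta> j"]) (use insert.prems(2) in simp)
        then have "\<psi> (x + w) - \<psi> x + (\<Sum>k\<in>S. \<theta> k (x + w) - \<theta> k x) =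
            (\<psi> (x + w) + (\<Sum>k\<in>insert j S. \<theta> k (x + w))) - (\<psi> x + (\<Sum>k\<in>insert j S. \<theta> k x))"
          using insert.hyps by (simp add: sum_subtractf)
        then show ?thesis
          using Ints_diff[OF insert.prems(4)[of "x + w"] insert.prems(4)[of x]] by (simp only:)
      qed
    qed (use insert.prems(3) in auto)
    then show ?thesis using \<psi> by simp
  qed
  then show ?case using insert.hyps by simp
qed simp

text \<open>
  The situation after averaging: \<open>a\<close> is an indicator function, and \<open>1 - a\<close> is a sum of nonnegative
  functions \<open>\<phi> i\<close>, one for each of finitely many directions \<open>i \<in> R\<close>, where \<open>\<phi> i\<close> has the period
  \<open>scale s i\<close>. The number \<open>e\<close> is a common multiple of the determinants of pairs of directions, so
  by \<open>cramer_dvd\<close> all multiples of \<open>s * e\<close> are spanned by the periods of any two of these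
  functions.
\<close>

locale stripes =
  fixes a :: "int \<times> int \<Rightarrow> real" and \<phi> :: "int \<times> int \<Rightarrow> int \<times> int \<Rightarrow> real"
    and R :: "(int \<times> int) set" and s e :: int and n :: nat
  assumes R: "finite R" "card R \<le> n"
    and pos: "s > 0" "e > 0"
    and a01: "\<And>x. a x = 0 \<or> a x = 1"
    and \<phi>0: "\<And>i x. i \<in> R \<Longrightarrow> 0 \<le> \<phi> i x"
    and decomposition: "\<And>x. a x = 1 - (\<Sum>i\<in>R. \<phi> i x)"
    and period: "\<And>i x. i \<in> R \<Longrightarrow> \<phi> i (x + scale s i) = \<phi> i x"
    and dets: "\<And>i j. i \<in> R \<Longrightarrow> j \<in> R \<Longrightarrow> i \<noteq> j \<Longrightarrow> det2 i j dvd e"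
begin

lemma sum_split: "i \<in> R \<Longrightarrow> (\<Sum>j\<in>R. \<phi> j x) = \<phi> i x + (\<Sum>j\<in>R - {i}. \<phi> j x)"
  using R(1) by (simp add: sum.remove)

lemma sum_le_1: "(\<Sum>i\<in>R. \<phi> i x) \<le> 1"
  using decomposition[of x] a01[of x] by auto

lemma \<phi>_pair:
  assumes "i \<in> R" "j \<in> R" "i \<noteq> j"
  shows "\<phi> i x + \<phi> j x \<le> 1"
proof -
  have "\<phi> j x \<le> (\<Sum>j\<in>R - {i}. \<phi> j x)"
    by (rule member_le_sum) (use assms \<phi>0 R(1) in simp_all)
  then show ?thesis using sum_le_1[of x] sum_split[OF assms(1), of x] by linarith
qed

lemma \<phi>1:
  assumes "i \<in> R"
  shows "\<phi> i x \<le> 1"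
proof -
  have "\<phi> i x \<le> (\<Sum>j\<in>R. \<phi> j x)"
    by (rule member_le_sum) (use assms \<phi>0 R(1) in simp_all)
  then show ?thesis using sum_le_1[of x] by linarith
qed

abbreviation E :: int where "E \<equiv> s * e"

lemma span:
  assumes "i \<in> R" "j \<in> R" "i \<noteq> j"
  shows "\<exists>\<alpha> \<beta>. scale E u = scale \<alpha> (scale s i) + scale \<beta> (scale s j)"
proof -
  obtain \<alpha> \<beta> where "scale e u = scale \<alpha> i + scale \<beta> j" using cramer_dvd[OF dets[OF assms]] by blast
  then have "scale E u = scale s (scale \<alpha> i + scale \<beta> j)" by (simp add: scale_scale[symmetric])
  then show ?thesis by (intro exI[of _ \<alpha>] exI[of _ \<beta>]) (simp add: scale_add scale_scale mult.commute)
qed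

lemma \<phi>_period_multiple: "i \<in> R \<Longrightarrow> \<phi> i (x + scale k (scale s i)) = \<phi> i x"
  using period_multiple[of "\<phi> i" "scale s i"] period by blast

lemma \<phi>_polynomial: "i \<in> R \<Longrightarrow> poly_mod1 n (\<lambda>t. \<phi> i (x + scale t (scale E u)))"
proof -
  assume i: "i \<in> R"
  have "poly_mod1_plane E (card (R - {i})) (\<phi> i)"
  proof (rule poly_mod1_plane_of_sum[where h = "scale s i" and \<theta> = \<phi> and H = "scale s"])
    show "\<phi> i x + (\<Sum>j\<in>R - {i}. \<phi> j x) \<in> \<int>" for x
    proof -
      have "\<phi> i x + (\<Sum>j\<in>R - {i}. \<phi> j x) = 1 - a x"
        using sum_split[OF i, of x] decomposition[of x] by linarith
      then show ?thesis using a01[of x] by auto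
    qed
    show "finite (R - {i})" using R(1) by simp
    show "\<phi> i (x + scale s i) = \<phi> i x" for x by (rule period[OF i])
    show "\<phi> j (x + scale s j) = \<phi> j x" if "j \<in> R - {i}" for j x using that by (intro period) simp
    show "\<exists>\<alpha> \<beta>. scale E u = scale \<alpha> (scale s i) + scale \<beta> (scale s j)" if "j \<in> R - {i}" for j u
      using that i by (intro span) auto
  qed
  moreover have "card (R - {i}) \<le> n" using R(2) card_Diff1_le[of R i] by linarith
  ultimately show ?thesis by (blast intro: poly_mod1_mono poly_mod1_plane_line)
qed

text \<open>
  On the line of direction \<open>i\<close> through \<open>y\<close> the function \<open>\<phi> i\<close> keeps a value in the open unit
  interval, so \<open>a\<close> vanishes there and the other stripe functions add up to less than \<open>1 / 2 ^ n\<close>.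
  So small a polynomial modulo 1 is a real polynomial (\<open>poly_exact_small\<close>), and a bounded one is
  constant. Together with the period of \<open>\<phi> j\<close> in direction \<open>j\<close> this covers a whole coset of the
  multiples of \<open>E * E\<close>.
\<close>

lemma rigid:
  assumes i: "i \<in> R" and y: "1 - 1 / 2 ^ n < \<phi> i y" "\<phi> i y < 1" and j: "j \<in> R" "j \<noteq> i"
  shows "\<phi> j (y + scale (E * E) z) = \<phi> j y"
proof -
  have line: "\<phi> j (y + scale k (scale s i)) < 1 / 2 ^ n" for k
    using \<phi>_pair[OF i j(1) j(2)[symmetric], of "y + scale k (scale s i)"] y(1)
      \<phi>_period_multiple[OF i, of y k] by linarith
  define f where "f t = \<phi> j (y + scale t (scale E (scale s i)))" for t
  have "poly_exact n f"
  proof (rule poly_exact_small)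
    show "poly_mod1 n f" unfolding f_def by (rule \<phi>_polynomial[OF j(1)])
    show "\<bar>f t\<bar> * 2 ^ n < 1" for t
      using line[of "t * E"] \<phi>0[OF j(1), of "y + scale t (scale E (scale s i))"]
      by (simp add: f_def scale_scale field_simps)
  qed
  then have const: "f t = f 0" for t
  proof (rule poly_exact_bounded_const[of n f 1])
    show "\<bar>f t\<bar> \<le> 1" for t
      using \<phi>0[OF j(1), of "y + scale t (scale E (scale s i))"] \<phi>1[OF j(1), of "y + scale t (scale E (scale s i))"]
      unfolding f_def by linarith
  qed
  obtain \<alpha> \<beta> where "scale E z = scale \<alpha> (scale s i) + scale \<beta> (scale s j)"
    using span[OF i j(1) j(2)[symmetric]] by blast
  then have "scale (E * E) z = scale E (scale \<alpha> (scale s i) + scale \<beta> (scale s j))"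
    by (simp only: scale_scale[symmetric])
  also have "\<dots> = scale \<alpha> (scale E (scale s i)) + scale (E * \<beta>) (scale s j)"
    by (simp add: scale_add scale_scale mult_ac)
  finally have "\<phi> j (y + scale (E * E) z) = f \<alpha>"
    using \<phi>_period_multiple[OF j(1), of "y + scale \<alpha> (scale E (scale s i))" "E * \<beta>"]
    by (simp add: f_def add.assoc)
  also have "\<dots> = \<phi> j y" using const[of \<alpha>] by (simp add: f_def)
  finally show ?thesis .
qed

text \<open>
  The remaining function \<open>\<phi> i\<close> is determined modulo 1 by the others.
\<close>

lemma rigid_mod_1:
  assumes i: "i \<in> R" and y: "1 - 1 / 2 ^ n < \<phi> i y" "\<phi> i y < 1" and j: "j \<in> R"
  shows "\<phi> j (y + scale (E * E) z) - \<phi> j y \<in> \<int>"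
proof (cases "j = i")
  case True
  define x where "x = y + scale (E * E) z"
  have "(\<Sum>j\<in>R - {i}. \<phi> j x) = (\<Sum>j\<in>R - {i}. \<phi> j y)"
    by (intro sum.cong) (use rigid[OF i y] in \<open>auto simp: x_def\<close>)
  then have "\<phi> i x - \<phi> i y = a y - a x"
    using sum_split[OF i, of x] sum_split[OF i, of y] decomposition[of x] decomposition[of y] by simp
  then show ?thesis using a01[of x] a01[of y] True by (auto simp: x_def)
next
  case False
  then show ?thesis using rigid[OF i y j] by simp
qed

definition Q :: int where
  "Q = E * E * fact (return_bound n (n * 4 ^ n) (4 ^ n))"

text \<open>
  The line through \<open>x\<close> is sampled with the step \<open>scale (E * E) u\<close>, so that a point at which
  \<open>rigid_mod_1\<close> applies lies in the same coset as \<open>x\<close>. The factorial in \<open>Q\<close> is a common multiple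
  of all the steps that \<open>avoiding_polynomial_periodic\<close> may produce.
\<close>

lemma mod_1_period:
  assumes i: "i \<in> R"
  shows "\<phi> i (x + scale Q u) - \<phi> i x \<in> \<int>"
proof -
  define W :: int where "W = fact (return_bound n (n * 4 ^ n) (4 ^ n))"
  have Qu: "scale Q u = scale (E * E) (scale W u)" by (simp add: Q_def W_def scale_scale)
  define f where "f t = \<phi> i (x + scale t (scale E (scale E u)))" for t
  show ?thesis
  proof (cases "\<exists>t. 1 - 1 / 2 ^ n < f t \<and> f t < 1")
    case True
    then obtain t where t: "1 - 1 / 2 ^ n < f t" "f t < 1" by blast
    define y where "y = x + scale t (scale E (scale E u))"
    have "\<phi> i (y + scale (E * E) (scale (- t) u)) - \<phi> i y \<in> \<int>"
      "\<phi> i (y + scale (E * E) (scale (W - t) u)) - \<phi> i y \<in> \<int>"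
      using rigid_mod_1[OF i _ _ i] t by (auto simp: f_def y_def)
    moreover have "y + scale (E * E) (scale (- t) u) = x" "y + scale (E * E) (scale (W - t) u) = x + scale Q u"
      by (simp_all add: y_def Qu scale_scale prod_eq_iff algebra_simps)
    ultimately show ?thesis
      by (metis (no_types, opaque_lifting) Ints_diff diff_diff_eq2 diff_add_cancel)
  next
    case False
    have "poly_mod1 n f" unfolding f_def by (rule \<phi>_polynomial[OF i])
    moreover have "0 \<le> f t" "f t \<le> 1" for t unfolding f_def using \<phi>0[OF i] \<phi>1[OF i] by auto
    moreover have "f t = 1" if "1 - 1 / 2 ^ n < f t" for t
      using that False \<open>f t \<le> 1\<close> by force
    ultimately obtain h :: nat where h: "0 < h" "h \<le> return_bound n (n * 4 ^ n) (4 ^ n)"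
        "\<forall>j. f (int h * j) - f 0 \<in> \<int>"
      using avoiding_polynomial_periodic[of n f] by blast
    have "h dvd fact (return_bound n (n * 4 ^ n) (4 ^ n))" using h by (intro dvd_fact) auto
    then have "int h dvd W" unfolding W_def by (metis of_nat_dvd_iff of_nat_fact)
    then obtain k where "W = int h * k" by blast
    then have "f W - f 0 \<in> \<int>" using h(3) by simp
    then show ?thesis by (simp add: f_def Qu scale_scale mult_ac)
  qed
qed

text \<open>
  Where \<open>\<phi> i\<close> is 1, all the other stripe functions vanish. As \<open>\<phi> i\<close> is 1 along a whole line, and
  every \<open>\<phi> j\<close> with \<open>j \<noteq> i\<close> is constant along the lines of direction \<open>j\<close>, which meet it, each \<open>\<phi> j\<close>
  vanishes on the whole coset and \<open>a = 1 - \<phi> i\<close> there. The summand \<open>\<alpha> i\<close> collects the cosets for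
  which \<open>i\<close> is chosen in this way.
\<close>

lemma weakly_periodic:
  assumes "R \<noteq> {}"
  obtains \<alpha> where "\<And>x. a x = (\<Sum>i\<in>R. \<alpha> i x)" "\<And>i x. \<alpha> i x = 0 \<or> \<alpha> i x = 1"
    "\<And>i x. i \<in> R \<Longrightarrow> \<alpha> i (x + scale (Q * E * s) i) = \<alpha> i x"
proof -
  define Q' where "Q' = Q * E"
  define P where "P i x \<longleftrightarrow> (\<exists>z. \<phi> i (x + scale Q' z) = 1)" for i x
  have P: "P i (x + scale Q' w) = P i x" for i x w
  proof -
    have 1: "P i (x + scale Q' w)" if "P i x" for x w
    proof -
      from that obtain z where "\<phi> i (x + scale Q' z) = 1" by (auto simp: P_def)
      moreover have "x + scale Q' z = x + scale Q' w + scale Q' (z - w)" by (simp add: scale_diff)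
      ultimately show ?thesis unfolding P_def by metis
    qed
    have "x + scale Q' w + scale Q' (- w) = x" by (simp add: prod_eq_iff)
    then show ?thesis using 1[of x w] 1[of "x + scale Q' w" "- w"] by metis
  qed
  obtain i0 where i0: "i0 \<in> R" using assms by blast
  \<comment> \<open>The direction of the coset of \<open>x\<close>: one whose stripe function takes the value 1
      there, if there is any.\<close>
  define ty where "ty x = (if \<exists>i\<in>R. P i x then SOME i. i \<in> R \<and> P i x else i0)" for x
  have ty_period: "ty (x + scale Q' w) = ty x" for x w
    by (simp add: ty_def P)
  have ty1: "ty x \<in> R \<and> P (ty x) x" if "\<exists>i\<in>R. P i x" for x
    using someI_ex[of "\<lambda>i. i \<in> R \<and> P i x"] that by (auto simp: ty_def)
  have tyR: "ty x \<in> R" for x using ty1[of x] i0 by (auto simp: ty_def)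
  have main: "a (x + scale Q' (scale s (ty x))) = a x" for x
  proof (cases "\<exists>i\<in>R. P i x")
    case True
    define i where "i = ty x"
    have i: "i \<in> R" "P i x" using ty1[OF True] by (auto simp: i_def)
    then obtain z where z: "\<phi> i (x + scale Q' z) = 1" by (auto simp: P_def)
    have zero: "\<phi> j (x + scale Q' w) = 0" if j: "j \<in> R" "j \<noteq> i" for j w
    proof -
      define y where "y = x + scale Q' z"
      obtain \<alpha> \<beta> where ab: "scale E (scale Q (w - z)) = scale \<alpha> (scale s i) + scale \<beta> (scale s j)"
        using span[OF i(1) j(1) j(2)[symmetric]] by blast
      have "x + scale Q' w = y + scale E (scale Q (w - z))"
        by (simp add: y_def Q'_def scale_scale scale_diff mult_ac)
      also have "\<dots> = y + scale \<alpha> (scale s i) + scale \<beta> (scale s j)" by (simp add: ab)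
      finally have "\<phi> j (x + scale Q' w) = \<phi> j (y + scale \<alpha> (scale s i))"
        using \<phi>_period_multiple[OF j(1)] by simp
      also have "\<dots> = 0"
        using \<phi>_pair[OF i(1) j(1) j(2)[symmetric], of "y + scale \<alpha> (scale s i)"]
          \<phi>0[OF j(1), of "y + scale \<alpha> (scale s i)"] \<phi>_period_multiple[OF i(1), of y \<alpha>] z
        by (simp add: y_def)
      finally show ?thesis .
    qed
    have "a (x + scale Q' w) = 1 - \<phi> i (x + scale Q' w)" for w
      using decomposition[of "x + scale Q' w"] sum_split[OF i(1), of "x + scale Q' w"] zero by simp
    from this[of "scale s i"] this[of 0] show ?thesis
      using \<phi>_period_multiple[OF i(1), of x Q'] by (simp add: i_def scale_def flip: zero_prod_def)
  next
    case False
    \<comment> \<open>No \<open>\<phi> i\<close> is 1 on the coset, so being constant modulo 1 they are constant.\<close>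
    define w where "w = scale s (ty x)"
    have "\<phi> i (x + scale Q' w) = \<phi> i x" if i: "i \<in> R" for i
    proof -
      have "\<phi> i (x + scale Q' w) \<noteq> 1" "\<phi> i (x + scale Q' 0) \<noteq> 1" using False i by (auto simp: P_def)
      moreover have "scale Q' 0 = 0" by (simp add: prod_eq_iff)
      ultimately have "\<bar>\<phi> i (x + scale Q' w) - \<phi> i x\<bar> < 1"
        using \<phi>0[OF i, of x] \<phi>0[OF i, of "x + scale Q' w"] \<phi>1[OF i, of x] \<phi>1[OF i, of "x + scale Q' w"]
        by auto
      moreover have "\<phi> i (x + scale Q' w) - \<phi> i x \<in> \<int>"
        using mod_1_period[OF i, of x "scale E w"] by (simp add: Q'_def scale_scale)
      ultimately show ?thesis using Ints_nonzero_abs_less1 by force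
    qed
    then show ?thesis using decomposition by (simp add: w_def)
  qed
  define \<alpha> where "\<alpha> i x = (if ty x = i then a x else 0)" for i x
  show ?thesis
  proof (rule that[of \<alpha>])
    show "a x = (\<Sum>i\<in>R. \<alpha> i x)" for x
      using tyR[of x] R(1) by (simp add: \<alpha>_def)
    show "\<alpha> i x = 0 \<or> \<alpha> i x = 1" for i x using a01[of x] by (simp add: \<alpha>_def)
    show "\<alpha> i (x + scale (Q * E * s) i) = \<alpha> i x" if "i \<in> R" for i x
      using main[of x] ty_period[of x "scale s i"] by (auto simp: \<alpha>_def Q'_def scale_scale)
  qed
qed

end

section \<open>From weak to double periodicity\<close>

lemma indicator_one:
  fixes h :: "'i \<Rightarrow> real"
  assumes "finite S" "\<And>j. j \<in> S \<Longrightarrow> h j \<in> \<int> \<and> 0 \<le> h j" "sum h S = 1"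
  obtains i where "i \<in> S" "h i = 1" "\<And>j. j \<in> S \<Longrightarrow> j \<noteq> i \<Longrightarrow> h j = 0"
proof -
  obtain i where i: "i \<in> S" "h i \<noteq> 0" using assms(3) by (metis sum.neutral zero_neq_one)
  then have "1 \<le> h i" using assms(2)[OF i(1)] by (auto elim!: Ints_cases)
  moreover have "sum h S = h i + sum h (S - {i})" using i assms(1) by (simp add: sum.remove)
  moreover have "0 \<le> sum h (S - {i})" using assms(2) by (intro sum_nonneg) auto
  ultimately have 1: "h i = 1" "sum h (S - {i}) = 0" using assms(3) by auto
  have "\<forall>j\<in>S - {i}. h j = 0"
    using 1(2) sum_nonneg_eq_0_iff[of "S - {i}" h] assms(1,2) by auto
  then show ?thesis using that[of i] i 1 by auto
qed

text \<open>
  The situation after \<open>weakly_periodic\<close>: the indicator function \<open>a\<close> of a tiling is a sum of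
  indicator functions \<open>\<alpha> i\<close> with period \<open>scale T i\<close>. The numbers \<open>e\<close> and \<open>L\<close> are common multiples
  of the determinants and squared lengths that occur. The dilates of \<open>F\<close> are tiles as well.
\<close>

locale split_tiling =
  fixes F :: "(int \<times> int) set" and a :: "int \<times> int \<Rightarrow> real"
    and \<alpha> :: "int \<times> int \<Rightarrow> int \<times> int \<Rightarrow> real" and R :: "(int \<times> int) set" and T q L e :: int
  assumes F: "finite F" and R: "finite R" "0 \<notin> R"
    and pos: "T > 0" "q > 0" "L > 0" "e > 0"
    and tiling: "\<And>k x. (\<Sum>f\<in>F. a (x - scale (1 + q * int k) f)) = 1"
    and split: "\<And>x. a x = (\<Sum>i\<in>R. \<alpha> i x)"
    and \<alpha>01: "\<And>i x. \<alpha> i x = 0 \<or> \<alpha> i x = 1"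
    and \<alpha>_period: "\<And>i x. i \<in> R \<Longrightarrow> \<alpha> i (x + scale T i) = \<alpha> i x"
    and dets: "\<And>i j. i \<in> R \<Longrightarrow> j \<in> R \<Longrightarrow> i \<noteq> j \<Longrightarrow> det2 i j dvd e"
      "\<And>i f g. i \<in> R \<Longrightarrow> f \<in> F \<Longrightarrow> g \<in> F \<Longrightarrow> det2 i (f - g) \<noteq> 0 \<Longrightarrow> det2 i (f - g) dvd e"
    and norms: "\<And>i. i \<in> R \<Longrightarrow> dot2 i i dvd L"
begin

lemma \<alpha>0: "0 \<le> \<alpha> i x" and \<alpha>1: "\<alpha> i x \<le> 1" and \<alpha>_Ints: "\<alpha> i x \<in> \<int>"
  using \<alpha>01[of i x] by auto

lemma \<alpha>_period_multiple: "i \<in> R \<Longrightarrow> \<alpha> i (x + scale k (scale T i)) = \<alpha> i x"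
  using period_multiple[of "\<alpha> i" "scale T i"] \<alpha>_period by blast

text \<open>
  The sum of the translates of \<open>\<alpha> i\<close> by a dilate of \<open>F\<close>, where the dilation fixes \<open>g\<close>.
\<close>

definition cover :: "int \<times> int \<Rightarrow> nat \<Rightarrow> int \<times> int \<Rightarrow> int \<times> int \<Rightarrow> real" where
  "cover g k i x = (\<Sum>f\<in>F. \<alpha> i (x - scale (1 + q * int k) (f - g)))"

lemma sum_cover: "(\<Sum>i\<in>R. cover g k i x) = 1"
proof -
  define r where "r = 1 + q * int k"
  have "(\<Sum>i\<in>R. cover g k i x) = (\<Sum>f\<in>F. \<Sum>i\<in>R. \<alpha> i (x - scale r (f - g)))"
    unfolding cover_def r_def by (rule sum.swap)
  also have "\<dots> = (\<Sum>f\<in>F. a (x + scale r g - scale r f))"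
    by (simp add: split[symmetric] scale_diff algebra_simps)
  also have "\<dots> = 1" unfolding r_def by (rule tiling)
  finally show ?thesis .
qed

lemma cover_Ints: "cover g k i x \<in> \<int> \<and> 0 \<le> cover g k i x"
  unfolding cover_def by (intro conjI Ints_sum sum_nonneg \<alpha>_Ints \<alpha>0)

lemma cover_le_1:
  assumes "i \<in> R"
  shows "cover g k i x \<le> 1"
proof -
  have "cover g k i x \<le> (\<Sum>i\<in>R. cover g k i x)"
    by (rule member_le_sum) (use assms cover_Ints R(1) in simp_all)
  then show ?thesis by (simp add: sum_cover)
qed

lemma cover_period_multiple:
  assumes "i \<in> R"
  shows "cover g k i (x + scale l (scale T i)) = cover g k i x"
proof -
  have "x + scale l (scale T i) - v = x - v + scale l (scale T i)" for v by simp
  then show ?thesis unfolding cover_def by (simp only: \<alpha>_period_multiple[OF assms])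
qed

text \<open>
  The sums for the various \<open>i\<close> are nonnegative integers with total 1. A sum with the value 1 keeps
  it along a line, so the others vanish on this line and, by their own periods, on a whole coset.
\<close>

lemma cover_zero:
  assumes i: "i \<in> R" "cover g k i x = 1" and j: "j \<in> R" "j \<noteq> i"
  shows "cover g k j (x + scale (T * e) z) = 0"
proof -
  obtain \<beta> \<gamma> where "scale e z = scale \<beta> i + scale \<gamma> j"
    using cramer_dvd[OF dets(1)[OF i(1) j(1) j(2)[symmetric]]] by blast
  then have "scale (T * e) z = scale T (scale \<beta> i + scale \<gamma> j)" by (simp only: scale_scale[symmetric])
  also have "\<dots> = scale \<beta> (scale T i) + scale \<gamma> (scale T j)" by (simp add: scale_add scale_scale mult.commute)
  finally have z: "x + scale (T * e) z = x + scale \<beta> (scale T i) + scale \<gamma> (scale T j)" by simp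
  define y where "y = x + scale \<beta> (scale T i)"
  have y1: "cover g k i y = 1" using cover_period_multiple[OF i(1)] i(2) by (simp add: y_def)
  obtain l where l: "l \<in> R" "\<And>m. m \<in> R \<Longrightarrow> m \<noteq> l \<Longrightarrow> cover g k m y = 0"
    using indicator_one[OF R(1), of "\<lambda>i. cover g k i y"] cover_Ints sum_cover by metis
  then have "l = i" using i(1) y1 by (metis zero_neq_one)
  then have "cover g k j y = 0" using l(2) j by simp
  then show ?thesis unfolding z y_def[symmetric] using cover_period_multiple[OF j(1)] by simp
qed

lemma cover_period:
  assumes i: "i \<in> R"
  shows "cover g k i (x + scale (T * e) z) = cover g k i x"
proof -
  define w where "w = x + scale (T * e) z"
  obtain l where l: "l \<in> R" "cover g k l x = 1" "\<And>m. m \<in> R \<Longrightarrow> m \<noteq> l \<Longrightarrow> cover g k m x = 0"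
    using indicator_one[OF R(1), of "\<lambda>i. cover g k i x"] cover_Ints sum_cover by metis
  have zero: "cover g k m w = 0" if "m \<in> R" "m \<noteq> l" for m
    unfolding w_def by (rule cover_zero[OF l(1,2) that])
  have "(\<Sum>i\<in>R. cover g k i w) = cover g k l w"
    using zero l(1) R(1) by (simp add: sum.remove[of R l])
  then have "cover g k l w = 1" by (simp add: sum_cover)
  then show ?thesis unfolding w_def[symmetric] using zero l i by (cases "i = l") auto
qed

definition N :: int where "N = T * q * L * e"

text \<open>
  Those elements of \<open>F\<close> that lie on the line of direction \<open>i\<close> through \<open>g\<close> are moved by suitable
  dilations by multiples of the period of \<open>\<alpha> i\<close>, so their contribution to \<open>cover\<close> does not depend
  on the dilation. The average of the contribution of any other element \<open>f\<close> acquires a period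
  parallel to \<open>f - g\<close>. Since the average of \<open>cover\<close> is doubly periodic, so is the contribution of
  the line.
\<close>

lemma slice_period:
  assumes i: "i \<in> R" and g: "g \<in> F"
  defines "b \<equiv> \<lambda>x. \<Sum>f | f \<in> F \<and> det2 i (f - g) = 0. \<alpha> i (x - (f - g))"
  shows "b (x + scale N u) = b x"
proof -
  \<comment> \<open>Dilations congruent to 1 modulo \<open>\<kappa>\<close> move the elements on the line of direction \<open>i\<close>
      through \<open>g\<close> by periods of \<open>\<alpha> i\<close> only.\<close>
  define \<kappa> where "\<kappa> = T * L"
  define V where "V = (\<lambda>f. f - g) ` {f \<in> F. det2 i (f - g) \<noteq> 0}"
  have inj: "inj_on (\<lambda>f. f - g) S" for S by (auto simp: inj_on_def)
  have "finite V" using F by (simp add: V_def)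
  have split_F: "(\<Sum>f\<in>F. h f) = (\<Sum>f | f \<in> F \<and> det2 i (f - g) = 0. h f) +
      (\<Sum>f | f \<in> F \<and> det2 i (f - g) \<noteq> 0. h f)" for h :: "int \<times> int \<Rightarrow> real"
  proof -
    have "F = {f \<in> F. det2 i (f - g) = 0} \<union> {f \<in> F. det2 i (f - g) \<noteq> 0}" by blast
    then show ?thesis using F sum.union_disjoint[of "{f \<in> F. det2 i (f - g) = 0}" "{f \<in> F. det2 i (f - g) \<noteq> 0}" h]
      by auto
  qed
  have \<kappa>: "\<kappa> > 0" using pos by (simp add: \<kappa>_def)
  have rel: "b x = cover g (nat \<kappa> * k) i x - (\<Sum>v\<in>V. \<alpha> i (x - v - scale (q * \<kappa> * int k) v))" for k x
  proof -
    have r: "scale (1 + q * int (nat \<kappa> * k)) v = v + scale (q * \<kappa> * int k) v" for v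
      using \<kappa> by (simp add: scale_add_left mult.assoc)
    have "cover g (nat \<kappa> * k) i x = (\<Sum>f\<in>F. \<alpha> i (x - (f - g) - scale (q * \<kappa> * int k) (f - g)))"
      unfolding cover_def r by (simp add: diff_diff_eq)
    also have "\<dots> =
        (\<Sum>f | f \<in> F \<and> det2 i (f - g) = 0. \<alpha> i (x - (f - g) - scale (q * \<kappa> * int k) (f - g))) +
        (\<Sum>f | f \<in> F \<and> det2 i (f - g) \<noteq> 0. \<alpha> i (x - (f - g) - scale (q * \<kappa> * int k) (f - g)))"
      by (rule split_F)
    also have "(\<Sum>f | f \<in> F \<and> det2 i (f - g) \<noteq> 0. \<alpha> i (x - (f - g) - scale (q * \<kappa> * int k) (f - g))) =
        (\<Sum>v\<in>V. \<alpha> i (x - v - scale (q * \<kappa> * int k) v))"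
      unfolding V_def by (simp add: sum.reindex[OF inj])
    also have "(\<Sum>f | f \<in> F \<and> det2 i (f - g) = 0. \<alpha> i (x - (f - g) - scale (q * \<kappa> * int k) (f - g))) = b x"
      unfolding b_def
    proof (intro sum.cong refl)
      fix f assume "f \<in> {f \<in> F. det2 i (f - g) = 0}"
      then have par: "scale (dot2 i i) (f - g) = scale (dot2 (f - g) i) i"
        by (intro parallel_scale) (simp add: det2_commute_zero)
      obtain L' where L': "L = dot2 i i * L'" using norms[OF i] by blast
      have "scale (q * \<kappa> * int k) (f - g) = scale (q * int k * T * L') (scale (dot2 i i) (f - g))"
        by (simp add: \<kappa>_def L' scale_scale mult_ac)
      also have "\<dots> = scale (q * int k * L' * dot2 (f - g) i) (scale T i)"
        unfolding par by (simp add: scale_scale mult_ac)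
      finally have "\<alpha> i (x - (f - g) - scale (q * \<kappa> * int k) (f - g)) =
          \<alpha> i (x - (f - g) - scale (q * int k * L' * dot2 (f - g) i) (scale T i)
            + scale (q * int k * L' * dot2 (f - g) i) (scale T i))"
        by (simp only: \<alpha>_period_multiple[OF i])
      then show "\<alpha> i (x - (f - g) - scale (q * \<kappa> * int k) (f - g)) = \<alpha> i (x - (f - g))" by simp
    qed
    finally show ?thesis by simp
  qed
  obtain \<gamma> \<phi> where av: "\<forall>x. b x = \<gamma> x - (\<Sum>v\<in>V. \<phi> v x)"
    "\<forall>v x. 0 \<le> \<phi> v x \<and> \<phi> v x \<le> 1"
    "\<forall>v x. \<phi> v (x + scale (q * \<kappa>) v) = \<phi> v x"
    "\<forall>w. (\<forall>x. \<alpha> i (x + w) = \<alpha> i x) \<longrightarrow> (\<forall>v x. \<phi> v (x + w) = \<phi> v x)"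
    "\<forall>w. (\<forall>k x. cover g (nat \<kappa> * k) i (x + w) = cover g (nat \<kappa> * k) i x) \<longrightarrow> (\<forall>x. \<gamma> (x + w) = \<gamma> x)"
    "\<forall>x z. (\<forall>k. cover g (nat \<kappa> * k) i x = z) \<longrightarrow> \<gamma> x = z"
    by (rule averaging[OF \<open>finite V\<close> \<alpha>0[of i] \<alpha>1[of i] _ _ rel])
      (use cover_Ints cover_le_1[OF i] in blast)+
  have "scale N u = scale (T * e) (scale (q * L) u)" by (simp add: N_def scale_scale mult_ac)
  then have \<gamma>: "\<gamma> (x + scale N u) = \<gamma> x" for x using av(5) cover_period[OF i] by simp
  have \<phi>: "\<phi> v (x + scale N u) = \<phi> v x" if v: "v \<in> V" for v x
  proof -
    from v have "det2 i v dvd e" using dets(2)[OF i _ g] by (auto simp: V_def)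
    then obtain \<beta> \<delta> where "scale e u = scale \<beta> i + scale \<delta> v" using cramer_dvd by blast
    then have "scale (T * q * L) (scale e u) = scale (q * L * \<beta>) (scale T i) + scale \<delta> (scale (q * \<kappa>) v)"
      by (simp add: scale_add scale_scale \<kappa>_def mult_ac)
    then have N: "scale N u = scale (q * L * \<beta>) (scale T i) + scale \<delta> (scale (q * \<kappa>) v)"
      by (simp add: N_def scale_scale)
    show ?thesis
      by (rule period_lattice[of "\<phi> v", OF _ _ N]) (use av(3,4) \<alpha>_period[OF i] in blast)+
  qed
  show ?thesis using av(1) \<gamma> \<phi> by simp
qed

definition rot :: "int \<times> int \<Rightarrow> int \<times> int" where "rot i = (- snd i, fst i)"

text \<open>
  The value of \<open>det2 i\<close> numbers the lines of direction \<open>i\<close>, and translation by \<open>scale N (rot i)\<close>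
  increases it by \<open>N * dot2 i i\<close>.
\<close>

definition strip :: "int \<times> int \<Rightarrow> int \<times> int \<Rightarrow> int" where
  "strip i x = det2 i x div (N * dot2 i i)"

text \<open>
  Every line of direction \<open>i\<close> gets the values of \<open>\<alpha> i\<close> on the corresponding line of strip 0.
\<close>

definition copy :: "int \<times> int \<Rightarrow> int \<times> int \<Rightarrow> real" where
  "copy i x = \<alpha> i (x - scale N (scale (strip i x) (rot i)))"

lemma N_pos: "N > 0" using pos by (simp add: N_def)

lemma det2_rot: "det2 i (rot i) = dot2 i i"
  by (simp add: rot_def det2_def dot2_def)

text \<open>
  The translates of a point by the elements of \<open>F\<close> on one line of direction \<open>i\<close> lie on one line as
  well. There \<open>copy i\<close> is a translate of \<open>\<alpha> i\<close> by a multiple of \<open>N\<close>, which does not matter by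
  \<open>slice_period\<close>. So the sums agree on each of these lines separately.
\<close>

lemma sum_copy:
  assumes i: "i \<in> R"
  shows "(\<Sum>f\<in>F. copy i (x - f)) = (\<Sum>f\<in>F. \<alpha> i (x - f))"
proof -
  have "(\<Sum>f | f \<in> F \<and> det2 i f = l. copy i (x - f)) = (\<Sum>f | f \<in> F \<and> det2 i f = l. \<alpha> i (x - f))"
    if l: "l \<in> det2 i ` F" for l
  proof -
    from l obtain g where g: "g \<in> F" "l = det2 i g" by blast
    have cls: "{f. f \<in> F \<and> det2 i f = l} = {f. f \<in> F \<and> det2 i (f - g) = 0}"
      by (auto simp: g(2) det2_linear)
    define t where "t = strip i (x - g)"
    have "strip i (x - f) = t" if "det2 i (f - g) = 0" for f
      using that by (simp add: t_def strip_def det2_linear)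
    then have "copy i (x - f) = \<alpha> i (x - g + scale N (scale (- t) (rot i)) - (f - g))"
      if "det2 i (f - g) = 0" for f
    proof -
      have "x - f - scale N (scale t (rot i)) = x - g + scale N (scale (- t) (rot i)) - (f - g)"
        by (simp add: prod_eq_iff)
      then show ?thesis using \<open>\<And>f. det2 i (f - g) = 0 \<Longrightarrow> strip i (x - f) = t\<close>[OF that]
        by (simp only: copy_def)
    qed
    then have "(\<Sum>f | f \<in> F \<and> det2 i f = l. copy i (x - f)) =
        (\<Sum>f | f \<in> F \<and> det2 i (f - g) = 0. \<alpha> i (x - g + scale N (scale (- t) (rot i)) - (f - g)))"
      unfolding cls by (intro sum.cong) auto
    also have "\<dots> = (\<Sum>f | f \<in> F \<and> det2 i (f - g) = 0. \<alpha> i (x - g - (f - g)))"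
      by (rule slice_period[OF i g(1)])
    finally show ?thesis unfolding cls by simp
  qed
  note classes = this
  have "(\<Sum>f\<in>F. copy i (x - f)) = (\<Sum>l\<in>det2 i ` F. \<Sum>f | f \<in> F \<and> det2 i f = l. copy i (x - f))"
    by (rule sum.image_gen[OF F])
  also have "\<dots> = (\<Sum>l\<in>det2 i ` F. \<Sum>f | f \<in> F \<and> det2 i f = l. \<alpha> i (x - f))"
    by (rule sum.cong[OF refl classes])
  also have "\<dots> = (\<Sum>f\<in>F. \<alpha> i (x - f))" by (rule sum.image_gen[OF F, symmetric])
  finally show ?thesis .
qed

lemma copy_period:
  assumes i: "i \<in> R"
  shows "copy i (x + scale (T * N * L) z) = copy i x"
proof -
  have \<nu>: "dot2 i i > 0" using i R(2) by (intro dot2_pos) auto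
  obtain L' where L': "L = dot2 i i * L'" using norms[OF i] by blast
  obtain \<beta> \<gamma> where "scale (dot2 i i) z = scale \<beta> i + scale \<gamma> (rot i)"
    using cramer_dvd[of i "rot i" "dot2 i i" z, unfolded det2_rot, OF dvd_refl] by blast
  then have "scale (T * N * L') (scale (dot2 i i) z) =
      scale (N * L' * \<beta>) (scale T i) + scale (T * L' * \<gamma>) (scale N (rot i))"
    by (simp add: scale_add scale_scale mult_ac)
  then have z: "scale (T * N * L) z = scale (N * L' * \<beta>) (scale T i) + scale (T * L' * \<gamma>) (scale N (rot i))"
    by (simp add: L' scale_scale mult_ac)
  have 1: "copy i (x + scale T i) = copy i x" for x
  proof -
    have s: "strip i (x + scale T i) = strip i x" by (simp add: strip_def det2_linear)
    have "x + scale T i - v = x - v + scale T i" for v by simp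
    then show ?thesis unfolding copy_def s by (simp only: \<alpha>_period[OF i])
  qed
  have 2: "copy i (x + scale N (rot i)) = copy i x" for x
  proof -
    have "strip i (x + scale N (rot i)) = strip i x + 1"
      unfolding strip_def det2_linear det2_rot using N_pos \<nu> by simp
    moreover have "x + scale N (rot i) - scale N (scale (strip i x + 1) (rot i)) =
        x - scale N (scale (strip i x) (rot i))"
      by (simp add: prod_eq_iff algebra_simps)
    ultimately show ?thesis unfolding copy_def by (simp only:)
  qed
  show ?thesis by (rule period_lattice[of "copy i", OF 1 2 z])
qed

text \<open>
  The sum of the copies is a nonnegative integer function whose translates by \<open>F\<close> add up to 1, so
  it is an indicator function.
\<close>

lemma biperiodic_tiling:
  assumes "F \<noteq> {}"
  shows "\<exists>A. (\<forall>x. (\<Sum>f\<in>F. indicator A (x - f)) = (1::real)) \<and>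
    (\<forall>x z. x + scale (T * N * L) z \<in> A \<longleftrightarrow> x \<in> A)"
proof -
  define a' where "a' x = (\<Sum>i\<in>R. copy i x)" for x
  have tile: "(\<Sum>f\<in>F. a' (x - f)) = 1" for x
  proof -
    have "(\<Sum>f\<in>F. a' (x - f)) = (\<Sum>i\<in>R. \<Sum>f\<in>F. copy i (x - f))"
      unfolding a'_def by (rule sum.swap)
    also have "\<dots> = (\<Sum>i\<in>R. \<Sum>f\<in>F. \<alpha> i (x - f))" by (intro sum.cong refl sum_copy)
    also have "\<dots> = (\<Sum>f\<in>F. a (x - f))" unfolding split by (rule sum.swap)
    also have "\<dots> = 1" using tiling[of x 0] by simp
    finally show ?thesis .
  qed
  have int: "a' x \<in> \<int> \<and> 0 \<le> a' x" for x
    unfolding a'_def copy_def by (intro conjI Ints_sum sum_nonneg \<alpha>_Ints \<alpha>0)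
  have a'01: "a' x = 0 \<or> a' x = 1" for x
  proof -
    obtain f where f: "f \<in> F" using assms by blast
    have "a' (x + f - f) \<le> (\<Sum>g\<in>F. a' (x + f - g))"
      by (rule member_le_sum) (use f F int in simp_all)
    then have "a' x \<le> 1" by (simp add: tile)
    then show ?thesis using int[of x] by (auto elim!: Ints_cases)
  qed
  have ind: "indicator {x. a' x = 1} x = a' x" for x using a'01[of x] by (cases "a' x = 1") simp_all
  have "a' (x + scale (T * N * L) z) = a' x" for x z
    unfolding a'_def using copy_period by simp
  then show ?thesis using tile by (intro exI[of _ "{x. a' x = 1}"]) (simp add: ind)
qed

end

section \<open>A bound for the period\<close>

lemma convolution_indicator:
  assumes "finite F"
  shows "convolution (indicator F) (indicator A) x = (\<Sum>f\<in>F. indicator A (x - f))"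
proof -
  have "convolution (indicator F) (indicator A) x = (\<Sum>\<^sub>\<infinity>y\<in>F. indicator F y * indicator A (x - y))"
    unfolding convolution_def by (rule infsum_cong_neutral) auto
  also have "\<dots> = (\<Sum>f\<in>F. indicator A (x - f))" using assms by simp
  finally show ?thesis .
qed

lemma tiles_plane_iff:
  "finite F \<Longrightarrow> tiles_plane F \<longleftrightarrow> (\<exists>A. \<forall>x. (\<Sum>f\<in>F. indicator A (x - f)) = (1::real))"
  by (simp add: tiles_plane_def convolution_indicator)

text \<open>
  One round of this function absorbs one round of the recursion for \<open>return_bound\<close>; it replaces
  the two parameters \<open>N\<close> and \<open>r\<close> there by a single number that a program can easily iterate.
\<close>

definition grow :: "nat \<Rightarrow> nat" where "grow x = (2 * x) ^ (x + 1)"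

lemma le_grow: "x \<le> grow x"
proof -
  have "x * 1 \<le> (2 * x) * (2 * x) ^ x" by (cases "x = 0") (auto intro!: mult_mono)
  then show ?thesis by (simp add: grow_def)
qed

lemma le_grow_iter: "x \<le> (grow ^^ k) x"
  by (induction k) (auto intro: le_trans le_grow)

lemma return_bound_le_grow:
  assumes "1 \<le> x" "y \<le> x" "N \<le> x" "r \<le> x"
  shows "y * return_bound k N r \<le> (grow ^^ k) x"
  using assms
proof (induction k arbitrary: x y N r)
  case (Suc k)
  define K where "K = (2 * r) ^ N"
  have "K \<le> (2 * x) ^ N" unfolding K_def using Suc.prems by (intro power_mono) auto
  also have "\<dots> \<le> (2 * x) ^ x" using Suc.prems by (intro power_increasing) auto
  finally have K: "K \<le> (2 * x) ^ x" .
  have le: "2 * w * K \<le> grow x" if "w \<le> x" for w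
    using mult_mono[OF mult_le_mono2[OF that, of 2] K] by (simp add: grow_def)
  have "(y * K) * return_bound k (N * K) (2 * r * K) \<le> (grow ^^ k) (grow x)"
    using le[OF Suc.prems(2)] le[OF Suc.prems(3)] le[OF Suc.prems(4)] Suc.prems(1) le_grow[of x]
    by (intro Suc.IH) auto
  then show ?case by (simp add: K_def funpow_swap1 mult_ac)
qed auto

text \<open>
  A bound, depending on the size of the tile only, for all the factors of the period that do not
  come from its geometry. The first round of \<open>grow\<close> covers the initial parameters of
  \<open>return_bound\<close>, the last one a factorial.
\<close>

definition size_bound :: "nat \<Rightarrow> nat" where "size_bound n = (grow ^^ (n + 2)) (n + 1)"

lemma size_bound_bounds:
  assumes "n \<ge> 1"
  shows "fact (return_bound n (n * 4 ^ n) (4 ^ n)) \<le> size_bound n" "fact n \<le> size_bound n" "1 \<le> size_bound n"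
proof -
  define h where "h = (grow ^^ n) (grow (n + 1))"
  have Xh: "size_bound n = grow h" by (simp add: size_bound_def h_def funpow_swap1)
  have "(4::nat) ^ n \<le> (2 * (n + 1)) ^ n" using assms by (intro power_mono) auto
  moreover have "n \<le> (2 * (n + 1)) ^ 2" by (simp add: power2_eq_square)
  ultimately have "n * 4 ^ n \<le> (2 * (n + 1)) ^ 2 * (2 * (n + 1)) ^ n" by (rule mult_le_mono[rotated])
  moreover have "b ^ 2 * b ^ n = b ^ (n + 1 + 1)" for b :: nat by (simp add: power2_eq_square)
  ultimately have 1: "n * 4 ^ n \<le> grow (n + 1)" by (simp only: grow_def)
  have 2: "4 ^ n \<le> n * 4 ^ n" using assms by simp
  have "1 * return_bound n (n * 4 ^ n) (4 ^ n) \<le> h"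
    unfolding h_def by (rule return_bound_le_grow) (use 1 2 le_grow[of "n + 1"] in linarith)+
  moreover have "n \<le> h" "1 \<le> h"
    using le_grow_iter[of "grow (n + 1)" n] le_grow[of "n + 1"] unfolding h_def by linarith+
  moreover have "fact h \<le> grow h"
  proof -
    have "fact h \<le> h ^ h" using fact_le_power[of h, where 'a = nat] by simp
    also have "\<dots> \<le> (2 * h) ^ h" by (intro power_mono) auto
    also have "\<dots> \<le> (2 * h) ^ (h + 1)" using \<open>1 \<le> h\<close> by (intro power_increasing) auto
    finally show ?thesis by (simp add: grow_def)
  qed
  ultimately show "fact (return_bound n (n * 4 ^ n) (4 ^ n)) \<le> size_bound n" "fact n \<le> size_bound n" "1 \<le> size_bound n"
    unfolding Xh using fact_mono_nat le_grow[of h] by (metis le_trans mult_1)+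
qed

lemma prod_le_power_int:
  fixes h :: "'i \<Rightarrow> int"
  assumes "finite S" "card S \<le> k" "\<And>i. i \<in> S \<Longrightarrow> 1 \<le> h i \<and> h i \<le> c" "1 \<le> c"
  shows "1 \<le> prod h S" "prod h S \<le> c ^ k"
proof -
  show "1 \<le> prod h S" by (rule prod_ge_1) (use assms in auto)
  have "prod h S \<le> (\<Prod>i\<in>S. c)" by (rule prod_mono) (use assms in force)
  also have "\<dots> = c ^ card S" by simp
  also have "\<dots> \<le> c ^ k" using assms by (intro power_increasing) auto
  finally show "prod h S \<le> c ^ k" .
qed

lemma one_le_mult_int: "1 \<le> x \<Longrightarrow> 1 \<le> y \<Longrightarrow> 1 \<le> x * (y :: int)"
  using mult_mono[of 1 x 1 y] by simp

text \<open>
  Here the pieces are put together and the constants are collected. With \<open>c = 2 D\<^sup>2\<close>, both the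
  product \<open>L\<close> of the squared lengths and the product \<open>e\<close> of the determinants of the differences of
  elements of \<open>F\<close> are at most \<open>c ^ (n ^ 4)\<close>, since there are at most \<open>n\<^sup>2\<close> differences and \<open>n ^ 4\<close>
  pairs of them. The period is a product of boundedly many of these numbers and of numbers
  depending on \<open>n\<close> only.
\<close>

theorem periodic_tiling:
  assumes F: "finite F" "card F = n" "n \<ge> 1" and tile: "tiles_plane F"
    and D: "1 \<le> D" "\<And>f g. f \<in> F \<Longrightarrow> g \<in> F \<Longrightarrow> \<bar>fst f - fst g\<bar> \<le> D \<and> \<bar>snd f - snd g\<bar> \<le> D"
  shows "\<exists>M A. 1 \<le> M \<and> M \<le> (2 * int (size_bound n) * D) ^ (34 * n ^ 4) \<and>
    (\<forall>x. (\<Sum>f\<in>F. indicator A (x - f)) = (1::real)) \<and> (\<forall>x z. x + scale M z \<in> A \<longleftrightarrow> x \<in> A)"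
proof (cases "n = 1")
  case True
  then obtain f where "F = {f}" using F(2) card_1_singletonE by metis
  moreover have "1 \<le> (2 * int (size_bound n) * D) ^ (34 * n ^ 4)"
    using D(1) size_bound_bounds(3)[OF F(3)] by (intro one_le_power one_le_mult_int) auto
  ultimately show ?thesis by (intro exI[of _ 1] exI[of _ UNIV]) auto
next
  case False
  obtain A where A: "\<And>x. (\<Sum>f\<in>F. indicator A (x - f)) = (1::real)"
    using tile tiles_plane_iff[OF F(1)] by blast
  define ai :: "int \<times> int \<Rightarrow> int" where "ai = indicator A"
  define a :: "int \<times> int \<Rightarrow> real" where "a = indicator A"
  have a_ai: "a x = real_of_int (ai x)" for x by (simp add: a_def ai_def indicator_def)
  define q :: int where "q = fact n"
  have dil: "(\<Sum>f\<in>F. a (x - scale (1 + q * int k) f)) = 1" for k x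
  proof -
    have "(\<Sum>f\<in>F. ai (x - scale (int (1 + fact n * k)) f)) = 1"
    proof (rule dilation[OF F(1)])
      show "0 \<le> ai x" for x by (simp add: ai_def indicator_def)
      show "(\<Sum>f\<in>F. ai (x - f)) = 1" for x
        using A[of x] unfolding a_def[symmetric] a_ai of_int_sum[symmetric] by (simp only: of_int_eq_1_iff)
      show "card F < p" if "prime p" "p dvd 1 + fact n * k" for p
        using prime_dvd_fact_progression[OF that] F(2) by simp
    qed simp
    then show ?thesis unfolding a_ai of_int_sum[symmetric] q_def by (simp only: of_nat_add of_nat_mult of_nat_fact of_nat_1 of_int_1)
  qed
  obtain g where g: "g \<in> F" using F by fastforce
  define V where "V = (\<lambda>f. f - g) ` (F - {g})"
  have inj: "inj_on (\<lambda>f. f - g) S" for S by (auto simp: inj_on_def)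
  have V: "finite V" "0 \<notin> V" "V \<noteq> {}" "card V \<le> n"
  proof -
    show "finite V" "0 \<notin> V" using F(1) by (auto simp: V_def)
    have "card V = n - 1" unfolding V_def using F(1,2) g by (simp add: card_image[OF inj])
    then show "card V \<le> n" "V \<noteq> {}" using False F(3) by auto
  qed
  have rel: "a x = 1 - (\<Sum>v\<in>V. a (x - v - scale (q * int k) v))" for k x
  proof -
    have "1 = (\<Sum>f\<in>F. a ((x + scale (1 + q * int k) g) - scale (1 + q * int k) f))" by (simp add: dil)
    also have "\<dots> = (\<Sum>f\<in>F. a (x - scale (1 + q * int k) (f - g)))"
      by (simp add: scale_diff algebra_simps)
    also have "\<dots> = a x + (\<Sum>f\<in>F - {g}. a (x - scale (1 + q * int k) (f - g)))"
      using F(1) g by (simp add: sum.remove scale_def zero_prod_def[symmetric])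
    also have "(\<Sum>f\<in>F - {g}. a (x - scale (1 + q * int k) (f - g))) = (\<Sum>v\<in>V. a (x - v - scale (q * int k) v))"
      unfolding V_def by (simp add: sum.reindex[OF inj] scale_add_left diff_diff_eq)
    finally show ?thesis by simp
  qed
  have a01: "a x = 0 \<or> a x = 1" for x by (simp add: a_def indicator_def)
  have a0: "0 \<le> a x" and a1: "a x \<le> 1" for x by (simp_all add: a_def indicator_def)
  have "\<exists>\<phi>. (\<forall>x. a x = 1 - (\<Sum>v\<in>V. \<phi> v x)) \<and> (\<forall>v x. 0 \<le> \<phi> v x) \<and>
    (\<forall>v x. \<phi> v (x + scale q v) = \<phi> v x)"
  proof (rule averaging[where g = "\<lambda>_ _. 1", OF V(1) a0 a1 _ _ rel])
    fix \<gamma> \<phi>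
    assume 1: "\<forall>x. a x = \<gamma> x - (\<Sum>v\<in>V. \<phi> v x)" and 2: "\<forall>v x. 0 \<le> \<phi> v x \<and> \<phi> v x \<le> 1"
      and 3: "\<forall>v x. \<phi> v (x + scale q v) = \<phi> v x"
      and 4: "\<forall>x z. (\<forall>k::nat. (1::real) = z) \<longrightarrow> \<gamma> x = z"
    have "\<gamma> x = 1" for x using 4 by blast
    then have "a x = 1 - (\<Sum>v\<in>V. \<phi> v x)" for x using 1[rule_format, of x] by (simp only:)
    then show ?thesis using 2 3 by (intro exI[of _ \<phi>]) blast
  qed (rule zero_le_one order_refl)+
  then obtain \<phi> where \<phi>_dec: "\<And>x. a x = 1 - (\<Sum>v\<in>V. \<phi> v x)" and \<phi>0: "\<And>v x. 0 \<le> \<phi> v x"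
    and \<phi>_period: "\<And>v x. \<phi> v (x + scale q v) = \<phi> v x" by blast
  \<comment> \<open>One representative for each direction.\<close>
  define rep where "rep v = (SOME w. w \<in> V \<and> det2 v w = 0)" for v
  have rep: "rep v \<in> V" "det2 v (rep v) = 0" if "v \<in> V" for v
    using someI_ex[of "\<lambda>w. w \<in> V \<and> det2 v w = 0"] that det2_linear(4)[of v] by (auto simp: rep_def)
  have rep_eq: "rep v = rep w" if vw: "v \<in> V" "w \<in> V" "det2 v w = 0" for v w
  proof -
    have "u \<in> V \<and> det2 v u = 0 \<longleftrightarrow> u \<in> V \<and> det2 w u = 0" for u
      using vw parallel_trans[of w v u] parallel_trans[of v w u] V(2) det2_commute_zero[of v w] by metis
    then show ?thesis by (simp add: rep_def)
  qed
  define R where "R = rep ` V"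
  have R: "finite R" "card R \<le> n" "R \<noteq> {}" "R \<subseteq> V"
    using V card_image_le[OF V(1), of rep] rep by (auto simp: R_def)
  have Rdet: "det2 i j \<noteq> 0" if ij: "i \<in> R" "j \<in> R" "i \<noteq> j" for i j
  proof
    assume 0: "det2 i j = 0"
    obtain v w where vw: "v \<in> V" "i = rep v" "w \<in> V" "j = rep w" using ij by (auto simp: R_def)
    have iV: "i \<in> V" "j \<in> V" using ij R(4) by auto
    have "rep v = rep i" using rep_eq[OF vw(1) iV(1)] rep(2)[OF vw(1)] vw(2) by simp
    also have "\<dots> = rep j" by (rule rep_eq[OF iV 0])
    also have "\<dots> = rep w" using rep_eq[OF vw(3) iV(2)] rep(2)[OF vw(3)] vw(4) by simp
    finally show False using ij(3) vw by simp
  qed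
  define \<psi> where "\<psi> i x = (\<Sum>v | v \<in> V \<and> rep v = i. \<phi> v x)" for i x
  have \<psi>_dec: "a x = 1 - (\<Sum>i\<in>R. \<psi> i x)" for x
    using \<phi>_dec[of x] sum.image_gen[OF V(1), of "\<lambda>v. \<phi> v x" rep]
    unfolding \<psi>_def R_def by (simp only:)
  define \<Delta> where "\<Delta> = (\<lambda>(f, g). f - g) ` (F \<times> F)"
  have \<Delta>: "finite \<Delta>" "card \<Delta> \<le> n ^ 2"
  proof -
    show "finite \<Delta>" using F(1) by (simp add: \<Delta>_def)
    have "card \<Delta> \<le> card (F \<times> F)" unfolding \<Delta>_def using F(1) by (intro card_image_le) simp
    then show "card \<Delta> \<le> n ^ 2" by (simp add: card_cartesian_product F(2) power2_eq_square)
  qed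
  have V\<Delta>: "V \<subseteq> \<Delta>" using g by (auto simp: V_def \<Delta>_def)
  have \<Delta>D: "\<bar>fst v\<bar> \<le> D" "\<bar>snd v\<bar> \<le> D" if "v \<in> \<Delta>" for v
    using that D(2) by (auto simp: \<Delta>_def)
  define c where "c = 2 * D\<^sup>2"
  have c: "1 \<le> c" using one_le_mult_int[OF D(1) D(1)] by (simp add: c_def power2_eq_square)
  have prod_le: "\<bar>x * y\<bar> \<le> D\<^sup>2" if "\<bar>x\<bar> \<le> D" "\<bar>y\<bar> \<le> D" for x y :: int
    using mult_mono[OF that] D(1) by (simp add: abs_mult power2_eq_square)
  define L where "L = (\<Prod>v\<in>\<Delta> - {0}. dot2 v v)"
  have L: "1 \<le> L" "L \<le> c ^ (n ^ 4)"
  proof -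
    have "card (\<Delta> - {0}) \<le> n ^ 4"
    proof -
      have "card (\<Delta> - {0}) \<le> card \<Delta>" by (rule card_Diff1_le)
      also note \<Delta>(2)
      also have "n ^ 2 \<le> n ^ 4" using F(3) by (intro power_increasing) auto
      finally show ?thesis .
    qed
    moreover have "1 \<le> dot2 v v \<and> dot2 v v \<le> c" if "v \<in> \<Delta> - {0}" for v
    proof -
      have v: "v \<in> \<Delta>" using that by simp
      have "\<bar>fst v * fst v\<bar> \<le> D\<^sup>2" "\<bar>snd v * snd v\<bar> \<le> D\<^sup>2"
        by (rule prod_le; rule \<Delta>D[OF v])+
      then have "dot2 v v \<le> c" by (simp add: dot2_def c_def)
      then show ?thesis using dot2_pos[of v] that by auto
    qed
    ultimately show "1 \<le> L" "L \<le> c ^ (n ^ 4)"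
      unfolding L_def using prod_le_power_int[of "\<Delta> - {0}" "n ^ 4" "\<lambda>v. dot2 v v" c] \<Delta>(1) c by auto
  qed
  define S where "S = {p \<in> \<Delta> \<times> \<Delta>. det2 (fst p) (snd p) \<noteq> 0}"
  define e where "e = (\<Prod>p\<in>S. \<bar>det2 (fst p) (snd p)\<bar>)"
  have S: "finite S" using \<Delta>(1) by (simp add: S_def)
  have e: "1 \<le> e" "e \<le> c ^ (n ^ 4)"
  proof -
    have "card S \<le> n ^ 4"
    proof -
      have "card S \<le> card (\<Delta> \<times> \<Delta>)" unfolding S_def using \<Delta>(1) by (intro card_mono) auto
      also have "\<dots> \<le> n ^ 2 * n ^ 2" unfolding card_cartesian_product by (rule mult_le_mono[OF \<Delta>(2) \<Delta>(2)])
      finally show ?thesis by (simp add: power_add[symmetric])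
    qed
    moreover have "1 \<le> \<bar>det2 (fst p) (snd p)\<bar> \<and> \<bar>det2 (fst p) (snd p)\<bar> \<le> c" if p: "p \<in> S" for p
    proof -
      have p': "fst p \<in> \<Delta>" "snd p \<in> \<Delta>" using p by (auto simp: S_def)
      have "\<bar>fst (fst p) * snd (snd p)\<bar> \<le> D\<^sup>2" "\<bar>snd (fst p) * fst (snd p)\<bar> \<le> D\<^sup>2"
        by (rule prod_le; rule \<Delta>D[OF p'(1)] \<Delta>D[OF p'(2)])+
      then have "\<bar>det2 (fst p) (snd p)\<bar> \<le> c" unfolding det2_def c_def by linarith
      then show ?thesis using p by (auto simp: S_def)
    qed
    ultimately show "1 \<le> e" "e \<le> c ^ (n ^ 4)"
      unfolding e_def using prod_le_power_int[OF S, of "n ^ 4" "\<lambda>p. \<bar>det2 (fst p) (snd p)\<bar>" c] c by auto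
  qed
  have det_dvd: "det2 v w dvd e" if "v \<in> \<Delta>" "w \<in> \<Delta>" "det2 v w \<noteq> 0" for v w
  proof -
    have "\<bar>det2 (fst (v, w)) (snd (v, w))\<bar> dvd e"
      unfolding e_def by (rule dvd_prodI[OF S]) (use that in \<open>simp add: S_def\<close>)
    then show ?thesis by simp
  qed
  have dot_dvd: "dot2 v v dvd L" if "v \<in> \<Delta>" "v \<noteq> 0" for v
    unfolding L_def using dvd_prodI[of "\<Delta> - {0}" v "\<lambda>v. dot2 v v"] \<Delta>(1) that by simp
  define s where "s = q * L"
  have q: "1 \<le> q" "q \<le> int (size_bound n)"
    using size_bound_bounds(2)[OF F(3)] by (simp_all add: q_def fact_ge_1) (metis of_nat_fact of_nat_le_iff)
  interpret st: stripes a \<psi> R s e n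
  proof
    show "0 < s" "0 < e" using q(1) L(1) e(1) by (simp_all add: s_def)
    show "a x = 0 \<or> a x = 1" for x by (rule a01)
    show "0 \<le> \<psi> i x" for i x unfolding \<psi>_def by (rule sum_nonneg) (rule \<phi>0)
    show "\<psi> i (x + scale s i) = \<psi> i x" if i: "i \<in> R" for i x
      unfolding \<psi>_def
    proof (intro sum.cong refl)
      fix v assume v: "v \<in> {v \<in> V. rep v = i}"
      then have v': "v \<in> V" "v \<in> \<Delta>" "v \<noteq> 0" "det2 i v = 0"
        using V\<Delta> V(2) rep(2)[of v] det2_commute_zero[of v i] by auto
      obtain L' where L': "L = dot2 v v * L'" using dot_dvd[OF v'(2,3)] by blast
      have "scale s i = scale (q * L') (scale (dot2 v v) i)" by (simp add: s_def L' scale_scale mult_ac)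
      also have "\<dots> = scale (L' * dot2 i v) (scale q v)"
        unfolding parallel_scale[OF v'(4)] by (simp add: scale_scale mult_ac)
      finally show "\<phi> v (x + scale s i) = \<phi> v x"
        using period_multiple[of "\<phi> v" "scale q v"] \<phi>_period by simp
    qed
    show "det2 i j dvd e" if "i \<in> R" "j \<in> R" "i \<noteq> j" for i j
      using det_dvd Rdet[OF that] that R(4) V\<Delta> by blast
  qed (use R \<psi>_dec in auto)
  obtain \<alpha> where \<alpha>: "\<And>x. a x = (\<Sum>i\<in>R. \<alpha> i x)" "\<And>i x. \<alpha> i x = 0 \<or> \<alpha> i x = 1"
    "\<And>i x. i \<in> R \<Longrightarrow> \<alpha> i (x + scale (st.Q * (s * e) * s) i) = \<alpha> i x"
    using st.weakly_periodic[OF R(3)] by blast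
  define T where "T = st.Q * (s * e) * s"
  define W :: int where "W = fact (return_bound n (n * 4 ^ n) (4 ^ n))"
  have W: "1 \<le> W" "W \<le> int (size_bound n)"
    using size_bound_bounds(1)[OF F(3)] by (simp_all add: W_def fact_ge_1) (metis of_nat_fact of_nat_le_iff)
  have Q: "st.Q = (s * e) * (s * e) * W" by (simp add: st.Q_def W_def)
  have s1: "1 \<le> s" using q L by (simp add: s_def one_le_mult_int)
  have T1: "1 \<le> T" unfolding T_def Q using s1 e(1) W(1) by (simp add: one_le_mult_int)
  interpret sp: split_tiling F a \<alpha> R T q L e
  proof
    show "(\<Sum>f\<in>F. a (x - scale (1 + q * int k) f)) = 1" for k x by (rule dil)
    show "a x = (\<Sum>i\<in>R. \<alpha> i x)" for x by (rule \<alpha>(1))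
    show "\<alpha> i x = 0 \<or> \<alpha> i x = 1" for i x by (rule \<alpha>(2))
    show "\<alpha> i (x + scale T i) = \<alpha> i x" if "i \<in> R" for i x unfolding T_def by (rule \<alpha>(3)[OF that])
    show "det2 i j dvd e" if "i \<in> R" "j \<in> R" "i \<noteq> j" for i j by (rule st.dets[OF that])
    show "det2 i (f - g) dvd e" if "i \<in> R" "f \<in> F" "g \<in> F" "det2 i (f - g) \<noteq> 0" for i f g
      using that R(4) V\<Delta> by (intro det_dvd) (auto simp: \<Delta>_def)
    show "dot2 i i dvd L" if "i \<in> R" for i
      using that R(4) V(2) V\<Delta> by (intro dot_dvd) auto
  qed (use F(1) R V(2) T1 q(1) L(1) e(1) in auto)
  define M where "M = T * sp.N * L"
  define x where "x = int (size_bound n)"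
  define Z where "Z = c ^ (n ^ 4)"
  have M: "M = W ^ 2 * q ^ 9 * L ^ 10 * e ^ 7"
  proof -
    have "T = W * s ^ 4 * e ^ 3" unfolding T_def Q by algebra
    moreover have "M = T * (T * q * L * e) * L" unfolding M_def sp.N_def ..
    moreover note s_def
    ultimately show ?thesis by algebra
  qed
  have "1 \<le> M" unfolding M using W(1) q(1) L(1) e(1) by (simp add: one_le_mult_int)
  moreover have "M \<le> (2 * x * D) ^ (34 * n ^ 4)"
  proof -
    have x: "1 \<le> x" using size_bound_bounds(3)[OF F(3)] by (simp add: x_def)
    have "M \<le> x ^ 2 * x ^ 9 * Z ^ 10 * Z ^ 7"
      unfolding M x_def Z_def using W q L e by (intro mult_mono power_mono) auto
    also have "\<dots> = x ^ 11 * Z ^ 17" by (simp add: power_add[symmetric] mult.assoc)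
    also have "Z ^ 17 \<le> ((2 * D) ^ 2) ^ (17 * n ^ 4)"
    proof -
      have "c \<le> (2 * D)\<^sup>2" by (simp add: c_def power_mult_distrib)
      then have "c ^ (n ^ 4 * 17) \<le> ((2 * D)\<^sup>2) ^ (n ^ 4 * 17)" using c by (intro power_mono) auto
      moreover have "Z ^ 17 = c ^ (n ^ 4 * 17)" unfolding Z_def by (simp only: power_mult)
      ultimately show ?thesis by (simp only: mult.commute)
    qed
    also have "x ^ 11 \<le> x ^ (34 * n ^ 4)"
    proof -
      have "1 \<le> n ^ 4" using F(3) by simp
      then show ?thesis using x by (intro power_increasing) auto
    qed
    also have "x ^ (34 * n ^ 4) * ((2 * D) ^ 2) ^ (17 * n ^ 4) = (2 * x * D) ^ (34 * n ^ 4)"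
    proof -
      have "2 * (17 * n ^ 4) = 34 * n ^ 4" by simp
      then have "((2 * D) ^ 2) ^ (17 * n ^ 4) = (2 * D) ^ (34 * n ^ 4)"
        by (simp only: power_mult[symmetric])
      then show ?thesis by (simp only: power_mult_distrib[symmetric] mult_ac)
    qed
    finally show ?thesis using x D(1) by simp
  qed
  ultimately show ?thesis using sp.biperiodic_tiling g unfolding M_def x_def by blast
qed

section \<open>Reasoning about running times\<close>

text \<open>
  Total correctness with an upper bound for the time. Upper bounds compose more easily than exact
  running times.
\<close>

definition runs :: "com \<Rightarrow> memory \<Rightarrow> nat \<Rightarrow> (memory \<Rightarrow> bool) \<Rightarrow> bool" where
  "runs P m T Post \<longleftrightarrow> (\<exists>t m'. exec P m t m' \<and> t \<le> T \<and> Post m')"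

lemma runsI: "exec P m t m' \<Longrightarrow> t \<le> T \<Longrightarrow> Post m' \<Longrightarrow> runs P m T Post"
  unfolding runs_def by blast

lemma runsE:
  assumes "runs P m T Post"
  obtains t m' where "exec P m t m'" "t \<le> T" "Post m'"
  using assms unfolding runs_def by blast

lemma runs_mono:
  assumes "runs P m T Mid" "T \<le> T'" "\<And>m'. Mid m' \<Longrightarrow> Post m'"
  shows "runs P m T' Post"
proof -
  from assms(1) obtain t m' where "exec P m t m'" "t \<le> T" "Mid m'" by (rule runsE)
  then show ?thesis using assms(2,3) by (intro runsI[of P m t m']) simp_all
qed

lemma runs_Skip: "Post m \<Longrightarrow> 1 \<le> T \<Longrightarrow> runs Skip m T Post"
  unfolding runs_def by (blast intro: exec.Skip)

lemma runs_Assign: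
  "Post (m(aval a m := aval b m)) \<Longrightarrow> 1 + acost a + acost b \<le> T \<Longrightarrow> runs (Assign a b) m T Post"
  unfolding runs_def by (blast intro: exec.Assign)

lemma runs_Seq:
  assumes "runs P m S Mid" "\<And>m'. Mid m' \<Longrightarrow> runs Q m' U Post" "S + U \<le> T"
  shows "runs (Seq P Q) m T Post"
proof -
  from assms(1) obtain t m1 where 1: "exec P m t m1" "t \<le> S" "Mid m1" by (rule runsE)
  from assms(2)[OF 1(3)] obtain u m2 where 2: "exec Q m1 u m2" "u \<le> U" "Post m2" by (rule runsE)
  show ?thesis using exec.Seq[OF 1(1) 2(1)] by (rule runsI) (use 1 2 assms(3) in simp_all)
qed

text \<open>
  The time left is passed on to the rest of the program, so that a block of assignments can be
  executed symbolically.
\<close>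

lemma runs_Assign_Seq:
  "1 + acost a + acost b \<le> T \<Longrightarrow> runs Q (m(aval a m := aval b m)) (T - (1 + acost a + acost b)) Post \<Longrightarrow>
    runs (Seq (Assign a b) Q) m T Post"
proof (rule runs_Seq[OF runs_Assign[where Post = "\<lambda>m'. m' = m(aval a m := aval b m)", OF refl order_refl]])
  assume le: "1 + acost a + acost b \<le> T"
    and run: "runs Q (m(aval a m := aval b m)) (T - (1 + acost a + acost b)) Post"
  show "runs Q m' (T - (1 + acost a + acost b)) Post" if "m' = m(aval a m := aval b m)" for m'
    using run that by simp
  show "1 + acost a + acost b + (T - (1 + acost a + acost b)) \<le> T" using le by linarith
qed

lemma runs_cong:
  "runs P m1 S Mid \<Longrightarrow> m = m1 \<Longrightarrow> S \<le> T \<Longrightarrow> (\<And>m'. Mid m' \<Longrightarrow> Post m') \<Longrightarrow> runs P m T Post"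
  by (simp only:) (rule runs_mono)

lemma runs_Cond:
  assumes "bval b m \<Longrightarrow> runs P m S Post" "\<not> bval b m \<Longrightarrow> runs Q m S Post" "1 + bcost b + S \<le> T"
  shows "runs (Cond b P Q) m T Post"
proof (cases "bval b m")
  case True
  from assms(1)[OF True] obtain t m1 where 1: "exec P m t m1" "t \<le> S" "Post m1" by (rule runsE)
  show ?thesis using exec.CondTrue[OF True 1(1)] by (rule runsI) (use 1 assms(3) in simp_all)
next
  case False
  from assms(2)[OF False] obtain t m1 where 1: "exec Q m t m1" "t \<le> S" "Post m1" by (rule runsE)
  show ?thesis using exec.CondFalse[OF False 1(1)] by (rule runsI) (use 1 assms(3) in simp_all)
qed

text \<open>
  As all loops of the program count down, their invariants can be indexed by the number of the
  remaining rounds.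
\<close>

definition countdown :: "int \<Rightarrow> com \<Rightarrow> com" where
  "countdown v P = While (Less (Const 0) (Cell (Const v)))
    (Seq P (Assign (Const v) (Minus (Cell (Const v)) (Const 1))))"

text \<open>
  The invariant \<open>I k\<close> holds when the counter is \<open>k\<close>. The constants 11 and 5 are the cost of
  testing and decrementing the counter and of the final test.
\<close>

lemma runs_countdown:
  assumes "m v = int N" "I N m"
    and "\<And>k m. k < N \<Longrightarrow> m v = int (Suc k) \<Longrightarrow> I (Suc k) m \<Longrightarrow>
      runs P m T (\<lambda>m'. m' v = int (Suc k) \<and> I k (m'(v := int k)))"
  shows "runs (countdown v P) m (N * (T + 11) + 5) (\<lambda>m'. m' v = 0 \<and> I 0 m')"
  using assms
proof (induction N arbitrary: m)
  case 0
  have "exec (countdown v P) m (1 + bcost (Less (Const 0) (Cell (Const v)))) m"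
    unfolding countdown_def by (rule exec.WhileFalse) (simp add: 0)
  then show ?case using 0 unfolding runs_def by (intro exI[of _ 5] exI[of _ m]) (simp add: numeral_eq_Suc)
next
  case (Suc N)
  define dec where "dec = Assign (Const v) (Minus (Cell (Const v)) (Const 1))"
  obtain t m1 where 1: "exec P m t m1" "t \<le> T" "m1 v = int (Suc N)" "I N (m1(v := int N))"
    using Suc.prems(3)[OF _ Suc.prems(1,2)] unfolding runs_def by blast
  have "exec dec m1 6 (m1(v := int N))"
    using exec.Assign[of "Const v" "Minus (Cell (Const v)) (Const 1)" m1] 1(3) by (simp add: dec_def numeral_eq_Suc)
  with 1(1) have body: "exec (Seq P dec) m (t + 6) (m1(v := int N))" by (rule exec.Seq)
  have "runs (countdown v P) (m1(v := int N)) (N * (T + 11) + 5) (\<lambda>m'. m' v = 0 \<and> I 0 m')"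
  proof (rule Suc.IH)
    show "runs P m' T (\<lambda>m''. m'' v = int (Suc k) \<and> I k (m''(v := int k)))"
      if "k < N" "m' v = int (Suc k)" "I (Suc k) m'" for k m'
      by (rule Suc.prems(3)[OF less_SucI[OF that(1)] that(2,3)])
    show "(m1(v := int N)) v = int N" by simp
    show "I N (m1(v := int N))" by (rule 1(4))
  qed
  then obtain t' m' where 2: "exec (countdown v P) (m1(v := int N)) t' m'" "t' \<le> N * (T + 11) + 5"
    "m' v = 0" "I 0 m'" unfolding runs_def by blast
  have "exec (countdown v P) m (1 + bcost (Less (Const 0) (Cell (Const v))) + (t + 6) + t') m'"
    using exec.WhileTrue[OF _ body 2(1)[unfolded countdown_def dec_def[symmetric]]] Suc.prems(1)
    unfolding countdown_def dec_def[symmetric] by simp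
  moreover have "1 + bcost (Less (Const 0) (Cell (Const v))) + (t + 6) + t' \<le> Suc N * (T + 11) + 5"
    using 1(2) 2(2) by simp
  ultimately show ?case using 2(3,4) unfolding runs_def by blast
qed

definition agree :: "int set \<Rightarrow> memory \<Rightarrow> memory \<Rightarrow> bool" where
  "agree S m m' \<longleftrightarrow> (\<forall>i. i \<notin> S \<longrightarrow> m' i = m i)"

text \<open>
  Since the input occupies cells with nonnegative addresses, variable number \<open>i\<close> of the program
  lives at address \<open>- i\<close>, and the input is intact until the answer is stored in cell 0. The
  variables are: 1 the number \<open>size_bound n\<close>; 2, 4, 9, 15 loop counters; 3 a power; 5 the number
  \<open>spread\<close>; 6 the bound for the period; 7 the period \<open>M\<close> under consideration; 8 the number
  \<open>2 ^ (M * M)\<close>; 10 a subset of the torus, encoded as an integer; 11 whether all points tested so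
  far are covered once; 12 the current point of the torus; 13 how often it is covered; 14 the
  current element of the tile; 16 the code, shifted to the right; 17 whether a tiling has been
  found.
\<close>

abbreviation var :: "int \<Rightarrow> aexp" where "var i \<equiv> Cell (Const (- i))"
abbreviation set_var :: "int \<Rightarrow> aexp \<Rightarrow> com" where "set_var i \<equiv> Assign (Const (- i))"

section \<open>The program\<close>

definition halve :: com where
  "halve = countdown (-15) (set_var 16 (Div (var 16) (Const 2)))"

lemma runs_halve:
  assumes "m (-15) = int k"
  shows "runs halve m (k * 17 + 5) (\<lambda>m'. m' (-16) = m (-16) div 2 ^ k \<and> agree {-15, -16} m m')"
proof -
  have "runs halve m (k * (6 + 11) + 5) (\<lambda>m'. m' (-15) = 0 \<and>
      m' (-16) = m (-16) div 2 ^ (k - 0) \<and> agree {-15, -16} m m')"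
    unfolding halve_def
  proof (rule runs_countdown[where I = "\<lambda>j m'. m' (-16) = m (-16) div 2 ^ (k - j) \<and> agree {-15, -16} m m'"])
    fix j m'
    assume j: "j < k" "m' (-15) = int (Suc j)"
      and I: "m' (-16) = m (-16) div 2 ^ (k - Suc j) \<and> agree {-15, -16} m m'"
    have "k - j = Suc (k - Suc j)" using j(1) by simp
    then have "m (-16) div 2 ^ (k - Suc j) div 2 = m (-16) div 2 ^ (k - j)"
      by (simp add: zdiv_zmult2_eq[symmetric] mult.commute)
    then show "runs (set_var 16 (Div (var 16) (Const 2))) m' 6 (\<lambda>m'. m' (-15) = int (Suc j) \<and>
        (m'(-15 := int j)) (-16) = m (-16) div 2 ^ (k - j) \<and> agree {-15, -16} m (m'(-15 := int j)))"
      using I j(2) by (intro runs_Assign) (auto simp: agree_def)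
  qed (use assms in \<open>auto simp: agree_def\<close>)
  then show ?thesis by (rule runs_mono) auto
qed

text \<open>
  The integer \<open>c\<close> encodes a subset of the torus of side \<open>M\<close>: its bit number \<open>u + M * v\<close>, where \<open>u\<close>
  and \<open>v\<close> are reduced modulo \<open>M\<close>, tells whether \<open>(u, v)\<close> belongs to it.
\<close>

definition cell_bit :: "int \<Rightarrow> int \<Rightarrow> int \<Rightarrow> int \<Rightarrow> int" where
  "cell_bit c M x y = c div 2 ^ nat (x mod M + M * (y mod M)) mod 2"

lemma index_bounds:
  assumes "M > (0::int)"
  shows "0 \<le> x mod M + M * (y mod M)" "x mod M + M * (y mod M) < M * M"
proof -
  show "0 \<le> x mod M + M * (y mod M)" using assms by simp
  have "y mod M + 1 \<le> M" using assms by (simp add: add1_zle_eq)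
  then have "M * (y mod M + 1) \<le> M * M" using assms by (intro mult_left_mono) auto
  moreover have "x mod M < M" using assms by simp
  ultimately show "x mod M + M * (y mod M) < M * M" by (simp add: algebra_simps)
qed

definition add_bit :: com where
  "add_bit = Seq (set_var 15 (Plus
      (Mod (Minus (var 12) (Cell (Minus (Times (Const 2) (var 14)) (Const 1)))) (var 7))
      (Times (var 7) (Mod (Minus (Div (var 12) (var 7)) (Cell (Times (Const 2) (var 14)))) (var 7)))))
    (Seq (set_var 16 (var 10)) (Seq halve (set_var 13 (Plus (var 13) (Mod (var 16) (Const 2))))))"

lemma runs_add_bit:
  assumes M: "m (-7) = int M" "M > 0"
  shows "runs add_bit m (M * M * 17 + 60) (\<lambda>m'. agree {-13, -15, -16} m m' \<and>
    m' (-13) = m (-13) + cell_bit (m (-10)) (int M)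
      (m (-12) - m (2 * m (-14) - 1)) (m (-12) div int M - m (2 * m (-14))))"
proof -
  define x where "x = m (-12) - m (2 * m (-14) - 1)"
  define y where "y = m (-12) div int M - m (2 * m (-14))"
  define k where "k = nat (x mod int M + int M * (y mod int M))"
  have k: "int k = x mod int M + int M * (y mod int M)" "k \<le> M * M"
    using index_bounds[of "int M" x y] M(2) by (simp_all add: k_def nat_le_iff)
  define m2 where "m2 = m(-15 := int k, -16 := m (-10))"
  have "runs (Seq halve (set_var 13 (Plus (var 13) (Mod (var 16) (Const 2))))) m2 (k * 17 + 5 + 9)
      (\<lambda>m'. agree {-13, -15, -16} m m' \<and> m' (-13) = m (-13) + cell_bit (m (-10)) (int M) x y)"
  proof (rule runs_Seq[OF runs_halve[of m2 k]])
    show "m2 (-15) = int k" by (simp add: m2_def)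
    fix m' assume "m' (-16) = m2 (-16) div 2 ^ k \<and> agree {-15, -16} m2 m'"
    then show "runs (set_var 13 (Plus (var 13) (Mod (var 16) (Const 2)))) m' 9
        (\<lambda>m'. agree {-13, -15, -16} m m' \<and> m' (-13) = m (-13) + cell_bit (m (-10)) (int M) x y)"
      by (intro runs_Assign) (auto simp: agree_def m2_def cell_bit_def k_def)
  qed simp
  note main = this
  show ?thesis
    unfolding add_bit_def x_def[symmetric] y_def[symmetric]
  proof (rule runs_Assign_Seq, simp, rule runs_Assign_Seq, simp, rule runs_cong[OF main])
    show "k * 17 + 5 + 9 \<le> M * M * 17 + 60 -
        (1 + acost (Const (-15)) + acost (Plus
      (Mod (Minus (var 12) (Cell (Minus (Times (Const 2) (var 14)) (Const 1)))) (var 7))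
      (Times (var 7) (Mod (Minus (Div (var 12) (var 7)) (Cell (Times (Const 2) (var 14)))) (var 7))))) -
        (1 + acost (Const (-16)) + acost (var 10))"
      using k(2) by simp
  qed (simp_all add: m2_def k(1) x_def y_def M(1))
qed

definition count_point :: com where
  "count_point = Seq (set_var 13 (Const 0)) (Seq (set_var 14 (Cell (Const 0)))
    (Seq (countdown (-14) add_bit)
      (Cond (Equal (var 13) (Const 1)) Skip (set_var 11 (Const 0)))))"

text \<open>
  How often the point with number \<open>p\<close> of the torus is covered by the translates of the tile, which
  is read off from the input cells. The first coordinate of the point is \<open>p\<close> rather than
  \<open>p mod M\<close>; this makes no difference modulo \<open>M\<close>.
\<close>

definition cover_count :: "memory \<Rightarrow> nat \<Rightarrow> int \<Rightarrow> int \<Rightarrow> int \<Rightarrow> int" where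
  "cover_count m n c M p = (\<Sum>f\<in>{1..n}. cell_bit c M (p - m (2 * int f - 1)) (p div M - m (2 * int f)))"

lemma cover_count_cong:
  "(\<And>i. 0 \<le> i \<Longrightarrow> m' i = m i) \<Longrightarrow> cover_count m' n c M p = cover_count m n c M p"
  unfolding cover_count_def by (intro sum.cong) auto

lemma runs_count_point:
  assumes M: "m (-7) = int M" "M > 0" and n: "m 0 = int n"
  shows "runs count_point m (n * (M * M * 17 + 71) + 30) (\<lambda>m'. agree {-11, -13, -14, -15, -16} m m' \<and>
    m' (-11) = (if cover_count m n (m (-10)) (int M) (m (-12)) = 1 then m (-11) else 0))" (is "runs _ _ _ ?Post")
proof -
  define h where "h f = cell_bit (m (-10)) (int M) (m (-12) - m (2 * int f - 1)) (m (-12) div int M - m (2 * int f))" for f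
  define m2 where "m2 = m(-13 := 0, -14 := int n)"
  define I where "I j m' \<longleftrightarrow> m' (-13) = (\<Sum>f\<in>{j<..n}. h f) \<and> agree {-13, -14, -15, -16} m m'" for j m'
  have loop: "runs (countdown (-14) add_bit) m2 (n * ((M * M * 17 + 60) + 11) + 5) (\<lambda>m'. m' (-14) = 0 \<and> I 0 m')"
  proof (rule runs_countdown[where I = I and N = n])
    show "m2 (-14) = int n" "I n m2" by (auto simp: m2_def I_def agree_def)
    fix j m' assume j: "j < n" "m' (-14) = int (Suc j)" and I: "I (Suc j) m'"
    have ag: "m' i = m i" if "i \<notin> {-13, -14, -15, -16}" for i
      using I that by (auto simp: I_def agree_def)
    have "{j<..n} = insert (Suc j) {Suc j<..n}" using j(1) by auto
    then have s: "(\<Sum>f\<in>{j<..n}. h f) = h (Suc j) + (\<Sum>f\<in>{Suc j<..n}. h f)" by simp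
    have M': "m' (-7) = int M" using ag M by simp
    show "runs add_bit m' (M * M * 17 + 60) (\<lambda>m'. m' (-14) = int (Suc j) \<and> I j (m'(-14 := int j)))"
    proof (rule runs_mono[OF runs_add_bit[where m = m' and M = M, OF M' M(2)]])
      fix m'' assume "agree {-13, -15, -16} m' m'' \<and>
        m'' (-13) = m' (-13) + cell_bit (m' (-10)) (int M)
          (m' (-12) - m' (2 * m' (-14) - 1)) (m' (-12) div int M - m' (2 * m' (-14)))"
      then show "m'' (-14) = int (Suc j) \<and> I j (m''(-14 := int j))"
        using I j(2) ag unfolding I_def s by (auto simp: agree_def h_def)
    qed simp
  qed
  have "runs (Seq (countdown (-14) add_bit) (Cond (Equal (var 13) (Const 1)) Skip (set_var 11 (Const 0))))
      m2 (n * (M * M * 17 + 71) + 5 + 8) ?Post"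
  proof (rule runs_Seq[OF loop])
    fix m' assume m': "m' (-14) = 0 \<and> I 0 m'"
    have "{0<..n} = {1..n}" by auto
    then have c: "m' (-13) = cover_count m n (m (-10)) (int M) (m (-12))"
      using m' by (simp add: I_def cover_count_def h_def)
    show "runs (Cond (Equal (var 13) (Const 1)) Skip (set_var 11 (Const 0))) m' 8
        ?Post"
      by (rule runs_Cond[where S = 3]; (intro runs_Skip runs_Assign)?)
        (use m' c in \<open>auto simp: I_def agree_def\<close>)
  qed simp
  note main = this
  show ?thesis
    unfolding count_point_def
    by (rule runs_Assign_Seq, simp, rule runs_Assign_Seq, simp, rule runs_cong[OF main])
      (use n in \<open>simp_all add: m2_def\<close>)
qed

definition try_code :: com where
  "try_code = Seq (set_var 11 (Const 1)) (Seq (set_var 12 (Times (var 7) (var 7)))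
    (Seq (countdown (-12) count_point)
      (Cond (Equal (var 11) (Const 1)) (set_var 17 (Const 1)) Skip)))"

text \<open>
  Numbering the points of the torus from 1 instead of 0 suits the loops, which count down to 1:
  the point \<open>M * M\<close> plays the role of 0.
\<close>

definition good_code :: "memory \<Rightarrow> nat \<Rightarrow> nat \<Rightarrow> int \<Rightarrow> bool" where
  "good_code m n M c \<longleftrightarrow> (\<forall>p\<in>{1..M * M}. cover_count m n c (int M) (int p) = 1)"

definition code_time :: "nat \<Rightarrow> nat \<Rightarrow> nat" where
  "code_time n M = M * M * (n * (M * M * 17 + 71) + 41) + 40"

lemma runs_try_code:
  assumes M: "m (-7) = int M" "M > 0" and n: "m 0 = int n"
  shows "runs try_code m (code_time n M) (\<lambda>m'. agree {-11, -12, -13, -14, -15, -16, -17} m m' \<and>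
    m' (-17) = (if good_code m n M (m (-10)) then 1 else m (-17)))" (is "runs _ _ _ ?Post")
proof -
  define ok where "ok p \<longleftrightarrow> cover_count m n (m (-10)) (int M) (int p) = 1" for p
  define m2 where "m2 = m(-11 := 1, -12 := int (M * M))"
  define I where "I j m' \<longleftrightarrow> m' (-11) = (if \<forall>p\<in>{j<..M * M}. ok p then 1 else 0) \<and>
    agree {-11, -12, -13, -14, -15, -16} m m'" for j m'
  have loop: "runs (countdown (-12) count_point) m2 (M * M * ((n * (M * M * 17 + 71) + 30) + 11) + 5)
      (\<lambda>m'. m' (-12) = 0 \<and> I 0 m')"
  proof (rule runs_countdown[where I = I and N = "M * M"])
    show "m2 (-12) = int (M * M)" "I (M * M) m2" by (auto simp: m2_def I_def agree_def)
    fix j m' assume j: "j < M * M" "m' (-12) = int (Suc j)" and I: "I (Suc j) m'"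
    have ag: "m' i = m i" if "i \<notin> {-11, -12, -13, -14, -15, -16}" for i
      using I that by (auto simp: I_def agree_def)
    have "{j<..M * M} = insert (Suc j) {Suc j<..M * M}" using j(1) by auto
    then have s: "(\<forall>p\<in>{j<..M * M}. ok p) \<longleftrightarrow> ok (Suc j) \<and> (\<forall>p\<in>{Suc j<..M * M}. ok p)" by simp
    have M': "m' (-7) = int M" and n': "m' 0 = int n" using ag M n by simp_all
    have cc: "cover_count m' n c M p = cover_count m n c M p" for c M p
      by (rule cover_count_cong) (simp add: ag)
    show "runs count_point m' (n * (M * M * 17 + 71) + 30) (\<lambda>m'. m' (-12) = int (Suc j) \<and> I j (m'(-12 := int j)))"
    proof (rule runs_mono[OF runs_count_point[where m = m' and M = M and n = n, OF M' M(2) n']])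
      fix m'' assume "agree {-11, -13, -14, -15, -16} m' m'' \<and>
        m'' (-11) = (if cover_count m' n (m' (-10)) (int M) (m' (-12)) = 1 then m' (-11) else 0)"
      then show "m'' (-12) = int (Suc j) \<and> I j (m''(-12 := int j))"
        using I j(2) ag unfolding I_def s cc by (auto simp: agree_def ok_def)
    qed simp
  qed
  have "runs (Seq (countdown (-12) count_point) (Cond (Equal (var 11) (Const 1)) (set_var 17 (Const 1)) Skip))
      m2 (M * M * (n * (M * M * 17 + 71) + 41) + 5 + 8)
      ?Post"
  proof (rule runs_Seq[OF loop])
    fix m' assume m': "m' (-12) = 0 \<and> I 0 m'"
    have "{0<..M * M} = {1..M * M}" by auto
    then have c: "m' (-11) = (if good_code m n M (m (-10)) then 1 else 0)"
      using m' by (simp add: I_def good_code_def ok_def)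
    show "runs (Cond (Equal (var 11) (Const 1)) (set_var 17 (Const 1)) Skip) m' 8
        ?Post"
      by (rule runs_Cond[where S = 3]; (intro runs_Skip runs_Assign)?)
        (use m' c in \<open>auto simp: I_def agree_def\<close>)
  qed simp
  note main = this
  show ?thesis
    unfolding try_code_def code_time_def
    by (rule runs_Assign_Seq, simp, rule runs_Assign_Seq, simp, rule runs_cong[OF main])
      (use M in \<open>simp_all add: m2_def\<close>)
qed

definition try_period :: com where
  "try_period = Seq (set_var 8 (Const 1)) (Seq (set_var 9 (Times (var 7) (var 7)))
    (Seq (countdown (-9) (set_var 8 (Plus (var 8) (var 8))))
      (Seq (set_var 10 (var 8)) (countdown (-10) try_code))))"

text \<open>
  For the same reason the codes run from 1 to \<open>2 ^ (M * M)\<close>, where the last one encodes the empty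
  set in place of 0.
\<close>

definition good_period :: "memory \<Rightarrow> nat \<Rightarrow> nat \<Rightarrow> bool" where
  "good_period m n M \<longleftrightarrow> (\<exists>c\<in>{1..2 ^ (M * M)}. good_code m n M (int c))"

definition period_time :: "nat \<Rightarrow> nat \<Rightarrow> nat" where
  "period_time n M = M * M * 18 + 2 ^ (M * M) * (code_time n M + 11) + 30"

lemma good_code_cong:
  "(\<And>i. 0 \<le> i \<Longrightarrow> m' i = m i) \<Longrightarrow> good_code m' n M c = good_code m n M c"
  unfolding good_code_def using cover_count_cong[of m' m] by simp

lemma good_period_cong:
  "(\<And>i. 0 \<le> i \<Longrightarrow> m' i = m i) \<Longrightarrow> good_period m' n M = good_period m n M"
  unfolding good_period_def using good_code_cong[of m' m] by simp

lemma runs_doubling: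
  assumes "m (-9) = int k" "m (-8) = 1"
  shows "runs (countdown (-9) (set_var 8 (Plus (var 8) (var 8)))) m (k * 18 + 5)
    (\<lambda>m'. m' (-8) = 2 ^ k \<and> agree {-8, -9} m m')"
proof -
  define I where "I j m' \<longleftrightarrow> m' (-8) = 2 ^ (k - j) \<and> agree {-8, -9} m m'" for j m'
  have "runs (countdown (-9) (set_var 8 (Plus (var 8) (var 8)))) m (k * (7 + 11) + 5)
      (\<lambda>m'. m' (-9) = 0 \<and> I 0 m')"
  proof (rule runs_countdown[where I = I and N = k])
    show "m (-9) = int k" "I k m" using assms by (simp_all add: I_def agree_def)
    fix j m' assume j: "j < k" "m' (-9) = int (Suc j)" and I: "I (Suc j) m'"
    have "k - j = Suc (k - Suc j)" using j(1) by simp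
    then have p: "(2::int) ^ (k - j) = 2 ^ (k - Suc j) + 2 ^ (k - Suc j)" by simp
    show "runs (set_var 8 (Plus (var 8) (var 8))) m' 7 (\<lambda>m'. m' (-9) = int (Suc j) \<and> I j (m'(-9 := int j)))"
      by (rule runs_Assign) (use I j(2) p in \<open>auto simp: I_def agree_def\<close>)
  qed
  then show ?thesis by (rule runs_mono) (auto simp: I_def)
qed

lemma runs_try_period:
  assumes M: "m (-7) = int M" "M > 0" and n: "m 0 = int n"
  shows "runs try_period m (period_time n M) (\<lambda>m'.
    agree {-8, -9, -10, -11, -12, -13, -14, -15, -16, -17} m m' \<and>
    m' (-17) = (if good_period m n M then 1 else m (-17)))"
proof -
  define K :: nat where "K = 2 ^ (M * M)"
  let ?S = "{-8, -9, -10, -11, -12, -13, -14, -15, -16, -17}"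
  define Post where "Post m' \<longleftrightarrow> agree ?S m m' \<and> m' (-17) = (if good_period m n M then 1 else m (-17))" for m'
  define I where "I j m' \<longleftrightarrow> m' (-17) = (if \<exists>c\<in>{j<..K}. good_code m n M (int c) then 1 else m (-17)) \<and>
    agree ?S m m'" for j m'
  have loop: "runs (countdown (-10) try_code) m3 (K * (code_time n M + 11) + 5) (\<lambda>m'. m' (-10) = 0 \<and> I 0 m')"
    if m3: "m3 (-10) = int K" "agree {-8, -9, -10} m m3" for m3
  proof (rule runs_countdown[where I = I and N = K])
    show "m3 (-10) = int K" by (rule m3(1))
    show "I K m3" using m3(2) by (auto simp: I_def agree_def)
    fix j m' assume j: "j < K" "m' (-10) = int (Suc j)" and I: "I (Suc j) m'"
    have ag: "m' i = m i" if "i \<notin> ?S" for i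
      using I that by (auto simp: I_def agree_def)
    have "{j<..K} = insert (Suc j) {Suc j<..K}" using j(1) by auto
    then have s: "(\<exists>c\<in>{j<..K}. good_code m n M (int c)) \<longleftrightarrow>
        good_code m n M (int (Suc j)) \<or> (\<exists>c\<in>{Suc j<..K}. good_code m n M (int c))" by simp
    have M': "m' (-7) = int M" and n': "m' 0 = int n" using ag M n by simp_all
    have gc: "good_code m' n M c = good_code m n M c" for c
      by (rule good_code_cong) (simp add: ag)
    show "runs try_code m' (code_time n M) (\<lambda>m'. m' (-10) = int (Suc j) \<and> I j (m'(-10 := int j)))"
    proof (rule runs_mono[OF runs_try_code[where m = m' and M = M and n = n, OF M' M(2) n']])
      fix m'' assume m'': "agree {-11, -12, -13, -14, -15, -16, -17} m' m'' \<and>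
        m'' (-17) = (if good_code m' n M (m' (-10)) then 1 else m' (-17))"
      have "m'' (-10) = int (Suc j)" using m'' j(2) by (simp add: agree_def)
      moreover have "(m''(-10 := int j)) (-17) = (if \<exists>c\<in>{j<..K}. good_code m n M (int c) then 1 else m (-17))"
        using m'' I j(2) unfolding s gc I_def by simp
      moreover have "agree ?S m (m''(-10 := int j))" using m'' ag by (simp add: agree_def)
      ultimately show "m'' (-10) = int (Suc j) \<and> I j (m''(-10 := int j))"
        unfolding I_def by blast
    qed simp
  qed
  have "{0<..K} = {1..K}" by auto
  then have I0: "I 0 m' \<Longrightarrow> Post m'" for m' by (simp add: I_def Post_def good_period_def K_def)
  define m2 where "m2 = m(-8 := 1, -9 := int (M * M))"
  have "runs (Seq (countdown (-9) (set_var 8 (Plus (var 8) (var 8))))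
      (Seq (set_var 10 (var 8)) (countdown (-10) try_code))) m2
      ((M * M * 18 + 5) + (4 + (K * (code_time n M + 11) + 5))) Post"
  proof (rule runs_Seq[OF runs_doubling])
    show "m2 (-9) = int (M * M)" "m2 (-8) = 1" by (simp_all add: m2_def)
    fix m' assume m': "m' (-8) = 2 ^ (M * M) \<and> agree {-8, -9} m2 m'"
    have "runs (countdown (-10) try_code) (m'(-10 := m' (-8))) (K * (code_time n M + 11) + 5) Post"
    proof (rule runs_mono[OF loop])
      show "(m'(-10 := m' (-8))) (-10) = int K" using m' by (simp add: K_def)
      show "agree {-8, -9, -10} m (m'(-10 := m' (-8)))" using m' by (auto simp: agree_def m2_def)
    qed (use I0 in auto)
    then show "runs (Seq (set_var 10 (var 8)) (countdown (-10) try_code)) m'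
        (4 + (K * (code_time n M + 11) + 5)) Post"
      by (intro runs_Assign_Seq) (simp_all add: add.commute)
  qed simp
  note main = this
  show ?thesis
    unfolding try_period_def period_time_def Post_def[symmetric]
    by (rule runs_Assign_Seq, simp, rule runs_Assign_Seq, simp, rule runs_cong[OF main])
      (use M in \<open>simp_all add: m2_def K_def\<close>)
qed

lemma code_time_mono: "M \<le> N \<Longrightarrow> code_time n M \<le> code_time n N"
  unfolding code_time_def by (intro add_mono mult_le_mono order_refl) auto

lemma period_time_mono: "M \<le> N \<Longrightarrow> period_time n M \<le> period_time n N"
  unfolding period_time_def
  by (intro add_mono mult_le_mono order_refl code_time_mono power_increasing) auto

definition search :: com where
  "search = Seq (set_var 7 (var 6)) (Seq (set_var 17 (Const 0))
    (Seq (countdown (-7) try_period) (Assign (Const 0) (var 17))))"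

lemma runs_search:
  assumes B: "m (-6) = int B" and n: "m 0 = int n"
  shows "runs search m (B * (period_time n B + 11) + 20) (\<lambda>m'.
    m' 0 = (if \<exists>M\<in>{1..B}. good_period m n M then 1 else 0))"
proof -
  let ?S = "{-7, -8, -9, -10, -11, -12, -13, -14, -15, -16, -17}"
  define I where "I j m' \<longleftrightarrow> m' (-17) = (if \<exists>M\<in>{j<..B}. good_period m n M then 1 else 0) \<and>
    agree ?S m m'" for j m'
  define m2 where "m2 = m(-7 := int B, -17 := 0)"
  have loop: "runs (countdown (-7) try_period) m2 (B * (period_time n B + 11) + 5) (\<lambda>m'. m' (-7) = 0 \<and> I 0 m')"
  proof (rule runs_countdown[where I = I and N = B])
    show "m2 (-7) = int B" "I B m2" by (auto simp: m2_def I_def agree_def)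
    fix j m' assume j: "j < B" "m' (-7) = int (Suc j)" and I: "I (Suc j) m'"
    have ag: "m' i = m i" if "i \<notin> ?S" for i
      using I that by (auto simp: I_def agree_def)
    have "{j<..B} = insert (Suc j) {Suc j<..B}" using j(1) by auto
    then have s: "(\<exists>M\<in>{j<..B}. good_period m n M) \<longleftrightarrow>
        good_period m n (Suc j) \<or> (\<exists>M\<in>{Suc j<..B}. good_period m n M)" by simp
    have n': "m' 0 = int n" using ag n by simp
    have gp: "good_period m' n M = good_period m n M" for M
      by (rule good_period_cong) (simp add: ag)
    show "runs try_period m' (period_time n B) (\<lambda>m'. m' (-7) = int (Suc j) \<and> I j (m'(-7 := int j)))"
    proof (rule runs_mono[OF runs_try_period[where m = m' and M = "Suc j" and n = n, OF j(2) zero_less_Suc n']])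
      show "period_time n (Suc j) \<le> period_time n B" using j(1) by (intro period_time_mono) simp
      fix m'' assume m'': "agree {-8, -9, -10, -11, -12, -13, -14, -15, -16, -17} m' m'' \<and>
        m'' (-17) = (if good_period m' n (Suc j) then 1 else m' (-17))"
      have "m'' (-7) = int (Suc j)" using m'' j(2) by (simp add: agree_def)
      moreover have "(m''(-7 := int j)) (-17) = (if \<exists>M\<in>{j<..B}. good_period m n M then 1 else 0)"
        using m'' I unfolding s gp I_def by simp
      moreover have "agree ?S m (m''(-7 := int j))" using m'' ag by (simp add: agree_def)
      ultimately show "m'' (-7) = int (Suc j) \<and> I j (m''(-7 := int j))"
        unfolding I_def by blast
    qed
  qed
  have "runs (Seq (countdown (-7) try_period) (Assign (Const 0) (var 17))) m2
      (B * (period_time n B + 11) + 5 + 4)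
      (\<lambda>m'. m' 0 = (if \<exists>M\<in>{1..B}. good_period m n M then 1 else 0))"
  proof (rule runs_Seq[OF loop])
    fix m' assume m': "m' (-7) = 0 \<and> I 0 m'"
    have "{0<..B} = {1..B}" by auto
    then show "runs (Assign (Const 0) (var 17)) m' 4
        (\<lambda>m'. m' 0 = (if \<exists>M\<in>{1..B}. good_period m n M then 1 else 0))"
      using m' by (intro runs_Assign) (simp_all add: I_def)
  qed simp
  note main = this
  show ?thesis
    unfolding search_def
    by (rule runs_Assign_Seq, simp, rule runs_Assign_Seq, simp, rule runs_cong[OF main])
      (use B in \<open>simp_all add: m2_def\<close>)
qed

definition grow_step :: com where
  "grow_step = Seq (set_var 3 (Const 1)) (Seq (set_var 4 (Plus (var 1) (Const 1)))
    (Seq (countdown (-4) (set_var 3 (Times (var 3) (Times (Const 2) (var 1))))) (set_var 1 (var 3))))"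

lemma runs_grow_step:
  assumes x: "m (-1) = int x"
  shows "runs grow_step m (x * 20 + 40) (\<lambda>m'. m' (-1) = int (grow x) \<and> agree {-1, -3, -4} m m')"
proof -
  define I where "I j m' \<longleftrightarrow> m' (-3) = (2 * int x) ^ (x + 1 - j) \<and> agree {-3, -4} m m'" for j m'
  define m2 where "m2 = m(-3 := 1, -4 := int (x + 1))"
  have loop: "runs (countdown (-4) (set_var 3 (Times (var 3) (Times (Const 2) (var 1))))) m2
      ((x + 1) * (9 + 11) + 5) (\<lambda>m'. m' (-4) = 0 \<and> I 0 m')"
  proof (rule runs_countdown[where I = I and N = "x + 1"])
    show "m2 (-4) = int (x + 1)" "I (x + 1) m2" by (auto simp: m2_def I_def agree_def)
    fix j m' assume j: "j < x + 1" "m' (-4) = int (Suc j)" and I: "I (Suc j) m'"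
    have "x + 1 - j = Suc (x + 1 - Suc j)" using j(1) by simp
    then have p: "(2 * int x) ^ (x + 1 - j) = (2 * int x) ^ (x + 1 - Suc j) * (2 * int x)"
      by (simp only: power_Suc mult.commute)
    have m1: "m' (-1) = int x" using I x by (simp add: I_def agree_def)
    show "runs (set_var 3 (Times (var 3) (Times (Const 2) (var 1)))) m' 9
        (\<lambda>m'. m' (-4) = int (Suc j) \<and> I j (m'(-4 := int j)))"
    proof (rule runs_Assign)
      show "(m'(aval (Const (-3)) m' := aval (Times (var 3) (Times (Const 2) (var 1))) m')) (-4) = int (Suc j) \<and>
          I j (m'(aval (Const (-3)) m' := aval (Times (var 3) (Times (Const 2) (var 1))) m', -4 := int j))"
        unfolding I_def p using I j(2) m1 by (simp add: I_def agree_def)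
    qed simp
  qed
  have "runs (Seq (countdown (-4) (set_var 3 (Times (var 3) (Times (Const 2) (var 1))))) (set_var 1 (var 3))) m2
      ((x + 1) * (9 + 11) + 5 + 4) (\<lambda>m'. m' (-1) = int (grow x) \<and> agree {-1, -3, -4} m m')"
  proof (rule runs_Seq[OF loop])
    fix m' assume m': "m' (-4) = 0 \<and> I 0 m'"
    then show "runs (set_var 1 (var 3)) m' 4 (\<lambda>m'. m' (-1) = int (grow x) \<and> agree {-1, -3, -4} m m')"
      by (intro runs_Assign) (simp_all add: I_def agree_def grow_def)
  qed simp
  note main = this
  show ?thesis
    unfolding grow_step_def
    by (rule runs_Assign_Seq, simp, rule runs_Assign_Seq, simp, rule runs_cong[OF main])
      (use x in \<open>simp_all add: m2_def add.commute\<close>)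
qed

definition compute_size_bound :: com where
  "compute_size_bound = Seq (set_var 1 (Plus (Cell (Const 0)) (Const 1)))
    (Seq (set_var 2 (Plus (Cell (Const 0)) (Const 2))) (countdown (-2) grow_step))"

lemma grow_iter_mono: "i \<le> j \<Longrightarrow> (grow ^^ i) x \<le> (grow ^^ j) x"
  by (induction j) (auto simp: le_Suc_eq intro: le_trans le_grow)

lemma runs_compute_size_bound:
  assumes n: "m 0 = int n"
  shows "runs compute_size_bound m ((n + 2) * (size_bound n * 20 + 51) + 20)
    (\<lambda>m'. m' (-1) = int (size_bound n) \<and> agree {-1, -2, -3, -4} m m')"
proof -
  define x where "x j = (grow ^^ (n + 2 - j)) (n + 1)" for j
  define I where "I j m' \<longleftrightarrow> m' (-1) = int (x j) \<and> agree {-1, -2, -3, -4} m m'" for j m'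
  define m2 where "m2 = m(-1 := int (n + 1), -2 := int (n + 2))"
  have loop: "runs (countdown (-2) grow_step) m2 ((n + 2) * ((size_bound n * 20 + 40) + 11) + 5)
      (\<lambda>m'. m' (-2) = 0 \<and> I 0 m')"
  proof (rule runs_countdown[where I = I and N = "n + 2"])
    show "m2 (-2) = int (n + 2)" "I (n + 2) m2" by (auto simp: m2_def I_def agree_def x_def)
    fix j m' assume j: "j < n + 2" "m' (-2) = int (Suc j)" and I: "I (Suc j) m'"
    have "n + 2 - j = Suc (n + 2 - Suc j)" using j(1) by simp
    then have xj: "x j = grow (x (Suc j))" unfolding x_def by simp
    have m1: "m' (-1) = int (x (Suc j))" using I by (simp add: I_def)
    show "runs grow_step m' (size_bound n * 20 + 40) (\<lambda>m'. m' (-2) = int (Suc j) \<and> I j (m'(-2 := int j)))"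
    proof (rule runs_mono[OF runs_grow_step[where m = m' and x = "x (Suc j)", OF m1]])
      show "x (Suc j) * 20 + 40 \<le> size_bound n * 20 + 40"
        unfolding x_def size_bound_def using grow_iter_mono[of "n + 2 - Suc j" "n + 2" "n + 1"] by simp
      fix m'' assume "m'' (-1) = int (grow (x (Suc j))) \<and> agree {-1, -3, -4} m' m''"
      then show "m'' (-2) = int (Suc j) \<and> I j (m''(-2 := int j))"
        using I j(2) by (simp add: I_def agree_def xj)
    qed
  qed
  have x0: "x 0 = size_bound n" by (simp add: x_def size_bound_def)
  show ?thesis
    unfolding compute_size_bound_def
    by (rule runs_Assign_Seq, simp, rule runs_Assign_Seq, simp, rule runs_cong[OF loop])
      (use n in \<open>simp_all add: m2_def I_def x0 algebra_simps\<close>)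
qed

definition spread_step :: com where
  "spread_step = set_var 5 (Plus (var 5) (Plus
    (Times (Minus (Cell (Minus (Times (Const 2) (var 2)) (Const 1))) (Cell (Const 1)))
      (Minus (Cell (Minus (Times (Const 2) (var 2)) (Const 1))) (Cell (Const 1))))
    (Times (Minus (Cell (Times (Const 2) (var 2))) (Cell (Const 2)))
      (Minus (Cell (Times (Const 2) (var 2))) (Cell (Const 2))))))"

definition compute_spread :: com where
  "compute_spread = Seq (set_var 5 (Const 1)) (Seq (set_var 2 (Cell (Const 0)))
    (countdown (-2) spread_step))"

text \<open>
  One plus the sum of the squared distances to the first point. It bounds all coordinate
  differences and needs neither absolute values nor comparisons.
\<close>

definition spread :: "memory \<Rightarrow> nat \<Rightarrow> int" where
  "spread m n = 1 + (\<Sum>f\<in>{1..n}. (m (2 * int f - 1) - m 1) * (m (2 * int f - 1) - m 1) +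
    (m (2 * int f) - m 2) * (m (2 * int f) - m 2))"

lemma runs_compute_spread:
  assumes n: "m 0 = int n"
  shows "runs compute_spread m (n * 71 + 20)
    (\<lambda>m'. m' (-5) = spread m n \<and> agree {-2, -5} m m')"
proof -
  define h where "h f = (m (2 * int f - 1) - m 1) * (m (2 * int f - 1) - m 1) +
    (m (2 * int f) - m 2) * (m (2 * int f) - m 2)" for f
  define I where "I j m' \<longleftrightarrow> m' (-5) = 1 + (\<Sum>f\<in>{j<..n}. h f) \<and> agree {-2, -5} m m'" for j m'
  define m2 where "m2 = m(-5 := 1, -2 := int n)"
  have loop: "runs (countdown (-2) spread_step) m2 (n * (60 + 11) + 5) (\<lambda>m'. m' (-2) = 0 \<and> I 0 m')"
  proof (rule runs_countdown[where I = I and N = n])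
    show "m2 (-2) = int n" "I n m2" by (auto simp: m2_def I_def agree_def)
    fix j m' assume j: "j < n" "m' (-2) = int (Suc j)" and I: "I (Suc j) m'"
    have ag: "m' i = m i" if "i \<notin> {-2, -5}" for i
      using I that by (auto simp: I_def agree_def)
    have "{j<..n} = insert (Suc j) {Suc j<..n}" using j(1) by auto
    then have s: "(\<Sum>f\<in>{j<..n}. h f) = h (Suc j) + (\<Sum>f\<in>{Suc j<..n}. h f)" by simp
    show "runs spread_step m' 60 (\<lambda>m'. m' (-2) = int (Suc j) \<and> I j (m'(-2 := int j)))"
      unfolding spread_step_def I_def s
      by (rule runs_Assign) (use I j(2) ag in \<open>simp_all add: I_def agree_def h_def\<close>)
  qed
  have "{0<..n} = {1..n}" by auto
  then have "I 0 m' \<Longrightarrow> m' (-5) = spread m n \<and> agree {-2, -5} m m'" for m'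
    by (simp add: I_def spread_def h_def)
  then show ?thesis
    unfolding compute_spread_def
    by - (rule runs_Assign_Seq, simp, rule runs_Assign_Seq, simp, rule runs_cong[OF loop],
      use n in \<open>simp_all add: m2_def\<close>)
qed

definition compute_bound :: com where
  "compute_bound = Seq (set_var 6 (Const 1))
    (Seq (set_var 2 (Times (Const 34) (Times (Times (Cell (Const 0)) (Cell (Const 0)))
        (Times (Cell (Const 0)) (Cell (Const 0))))))
      (countdown (-2) (set_var 6 (Times (var 6) (Times (Times (Const 2) (var 1)) (var 5))))))"

lemma runs_compute_bound:
  assumes n: "m 0 = int n"
  shows "runs compute_bound m (34 * n ^ 4 * 23 + 40)
    (\<lambda>m'. m' (-6) = (2 * m (-1) * m (-5)) ^ (34 * n ^ 4) \<and> agree {-2, -6} m m')"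
proof -
  define N where "N = 34 * n ^ 4"
  define b where "b = 2 * m (-1) * m (-5)"
  define I where "I j m' \<longleftrightarrow> m' (-6) = b ^ (N - j) \<and> agree {-2, -6} m m'" for j m'
  define m2 where "m2 = m(-6 := 1, -2 := int N)"
  have loop: "runs (countdown (-2) (set_var 6 (Times (var 6) (Times (Times (Const 2) (var 1)) (var 5))))) m2
      (N * (12 + 11) + 5) (\<lambda>m'. m' (-2) = 0 \<and> I 0 m')"
  proof (rule runs_countdown[where I = I and N = N])
    show "m2 (-2) = int N" "I N m2" by (auto simp: m2_def I_def agree_def)
    fix j m' assume j: "j < N" "m' (-2) = int (Suc j)" and I: "I (Suc j) m'"
    have "N - j = Suc (N - Suc j)" using j(1) by simp
    then have p: "b ^ (N - j) = b ^ (N - Suc j) * b" by (simp only: power_Suc mult.commute)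
    have ag: "m' (-1) = m (-1)" "m' (-5) = m (-5)" using I by (simp_all add: I_def agree_def)
    show "runs (set_var 6 (Times (var 6) (Times (Times (Const 2) (var 1)) (var 5)))) m' 12
        (\<lambda>m'. m' (-2) = int (Suc j) \<and> I j (m'(-2 := int j)))"
      unfolding I_def p
      by (rule runs_Assign) (use I j(2) ag in \<open>simp_all add: I_def agree_def b_def\<close>)
  qed
  have "int N = 34 * (int n * int n * (int n * int n))" by (simp add: N_def power4_eq_xxxx mult_ac)
  then show ?thesis
    unfolding compute_bound_def
    by - (rule runs_Assign_Seq, simp, rule runs_Assign_Seq, simp, rule runs_cong[OF loop],
      use n in \<open>simp_all add: m2_def I_def N_def b_def\<close>)
qed

definition tiling_program :: com where
  "tiling_program = Seq compute_size_bound (Seq compute_spread (Seq compute_bound search))"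

definition bound :: "memory \<Rightarrow> nat \<Rightarrow> nat" where
  "bound m n = (2 * size_bound n * nat (spread m n)) ^ (34 * n ^ 4)"

lemma spread_ge_1: "1 \<le> spread m n"
  unfolding spread_def by (simp add: sum_nonneg)

lemma runs_tiling_program:
  assumes n: "m 0 = int n"
  shows "runs tiling_program m ((n + 2) * (size_bound n * 20 + 51) + n * 71 + 34 * n ^ 4 * 23 + 100 +
      bound m n * (period_time n (bound m n) + 11))
    (\<lambda>m'. m' 0 = (if \<exists>M\<in>{1..bound m n}. good_period m n M then 1 else 0))"
proof -
  define Post where "Post m' \<longleftrightarrow> m' 0 = (if \<exists>M\<in>{1..bound m n}. good_period m n M then 1 else 0)" for m' :: memory
  define Ts where "Ts = bound m n * (period_time n (bound m n) + 11) + 20"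
  have search: "runs search m3 Ts Post" if m3: "m3 (-6) = int (bound m n)" "\<And>i. 0 \<le> i \<Longrightarrow> m3 i = m i" for m3
  proof -
    have "good_period m3 n M = good_period m n M" for M by (rule good_period_cong) (rule m3(2))
    then show ?thesis using runs_search[where m = m3 and B = "bound m n" and n = n, OF m3(1)] m3(2)[of 0] n by (simp add: Ts_def Post_def[abs_def])
  qed
  have b: "runs (Seq compute_bound search) m2 ((34 * n ^ 4 * 23 + 40) + Ts) Post"
    if m2: "m2 (-1) = int (size_bound n)" "m2 (-5) = spread m n" "\<And>i. 0 \<le> i \<Longrightarrow> m2 i = m i" for m2
  proof (rule runs_Seq[OF runs_compute_bound[of m2 n]])
    show "m2 0 = int n" using m2(3) n by simp
    fix m3 assume "m3 (-6) = (2 * m2 (-1) * m2 (-5)) ^ (34 * n ^ 4) \<and> agree {-2, -6} m2 m3"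
    then show "runs search m3 Ts Post"
      using m2 spread_ge_1[of m n] by (intro search) (auto simp: agree_def bound_def)
  qed simp
  have s: "runs (Seq compute_spread (Seq compute_bound search)) m1
      ((n * 71 + 20) + ((34 * n ^ 4 * 23 + 40) + Ts)) Post"
    if m1: "m1 (-1) = int (size_bound n)" "\<And>i. 0 \<le> i \<Longrightarrow> m1 i = m i" for m1
  proof (rule runs_Seq[OF runs_compute_spread[of m1 n]])
    show "m1 0 = int n" using m1(2) n by simp
    have sp: "spread m1 n = spread m n" unfolding spread_def by (auto intro!: sum.cong simp: m1(2))
    fix m2 assume "m2 (-5) = spread m1 n \<and> agree {-2, -5} m1 m2"
    then show "runs (Seq compute_bound search) m2 ((34 * n ^ 4 * 23 + 40) + Ts) Post"
      using m1 by (intro b) (auto simp: agree_def sp)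
  qed simp
  have "runs tiling_program m (((n + 2) * (size_bound n * 20 + 51) + 20) + ((n * 71 + 20) + ((34 * n ^ 4 * 23 + 40) + Ts))) Post"
    unfolding tiling_program_def
  proof (rule runs_Seq[OF runs_compute_size_bound[where m = m and n = n, OF n]])
    fix m1 assume "m1 (-1) = int (size_bound n) \<and> agree {-1, -2, -3, -4} m m1"
    then show "runs (Seq compute_spread (Seq compute_bound search)) m1
      ((n * 71 + 20) + ((34 * n ^ 4 * 23 + 40) + Ts)) Post"
      by (intro s) (auto simp: agree_def)
  qed simp
  then show ?thesis by (rule runs_mono) (simp_all add: Ts_def Post_def)
qed

section \<open>Correctness of the search\<close>

lemma nth_flatten_pairs:
  fixes xs :: "(int \<times> int) list"
  shows "length (concat (map (\<lambda>(x, y). [x, y]) xs)) = 2 * length xs"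
    "i < length xs \<Longrightarrow> concat (map (\<lambda>(x, y). [x, y]) xs) ! (2 * i) = fst (xs ! i)"
    "i < length xs \<Longrightarrow> concat (map (\<lambda>(x, y). [x, y]) xs) ! Suc (2 * i) = snd (xs ! i)"
proof (induction xs arbitrary: i)
  case (Cons p xs)
  { case 1 then show ?case using Cons.IH(1) by (cases p) simp }
  { case 2 then show ?case using Cons.IH(2)[of "i - 1"] by (cases p; cases i) auto }
  { case 3 then show ?case using Cons.IH(3)[of "i - 1"] by (cases p; cases i) auto }
qed simp_all

lemma input_memory_0: "input_memory xs 0 = int (length xs)"
  by (simp add: input_memory_def)

lemma input_memory_point:
  assumes "f \<in> {1..length xs}"
  shows "input_memory xs (2 * int f - 1) = fst (xs ! (f - 1))"
    "input_memory xs (2 * int f) = snd (xs ! (f - 1))"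
proof -
  define i where "i = f - 1"
  have f: "f = Suc i" "i < length xs" using assms by (auto simp: i_def)
  have n: "nat (2 * int f - 1) = Suc (2 * i)" "nat (2 * int f) = Suc (Suc (2 * i))"
    using f(1) by (simp_all add: nat_eq_iff)
  show "input_memory xs (2 * int f - 1) = fst (xs ! (f - 1))"
    unfolding input_memory_def Let_def n using f nth_flatten_pairs(1)[of xs] nth_flatten_pairs(2)[OF f(2)]
    by simp
  show "input_memory xs (2 * int f) = snd (xs ! (f - 1))"
    unfolding input_memory_def Let_def n using f nth_flatten_pairs(1)[of xs] nth_flatten_pairs(3)[OF f(2)]
    by simp
qed

lemma sum_input_points:
  assumes "distinct xs"
  shows "(\<Sum>f\<in>{1..length xs}. h (input_memory xs (2 * int f - 1)) (input_memory xs (2 * int f))) =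
    (\<Sum>z\<in>set xs. (h (fst z) (snd z) :: 'a :: comm_monoid_add))"
proof -
  have "bij_betw (\<lambda>f. xs ! (f - 1)) {1..length xs} (set xs)"
    unfolding bij_betw_def
  proof
    show "inj_on (\<lambda>f. xs ! (f - 1)) {1..length xs}"
      using assms by (auto simp: inj_on_def nth_eq_iff_index_eq)
    show "(\<lambda>f. xs ! (f - 1)) ` {1..length xs} = set xs"
    proof (intro equalityI subsetI)
      fix z assume "z \<in> set xs"
      then obtain i where "i < length xs" "z = xs ! i" by (metis in_set_conv_nth)
      then show "z \<in> (\<lambda>f. xs ! (f - 1)) ` {1..length xs}" by (intro image_eqI[of _ _ "Suc i"]) auto
    qed auto
  qed
  from sum.reindex_bij_betw[OF this, of "\<lambda>z. h (fst z) (snd z)"]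
  have "(\<Sum>z\<in>set xs. h (fst z) (snd z)) = (\<Sum>f\<in>{1..length xs}. h (fst (xs ! (f - 1))) (snd (xs ! (f - 1))))"
    by simp
  also have "\<dots> = (\<Sum>f\<in>{1..length xs}. h (input_memory xs (2 * int f - 1)) (input_memory xs (2 * int f)))"
    by (intro sum.cong refl) (simp only: input_memory_point)
  finally show ?thesis by simp
qed

lemma code_exists:
  "\<exists>c::nat. c < 2 ^ k \<and> (\<forall>i<k. c div 2 ^ i mod 2 = of_bool (b i))"
proof (induction k arbitrary: b)
  case (Suc k)
  from Suc.IH[of "\<lambda>i. b (Suc i)"] obtain c :: nat where
    c: "c < 2 ^ k" "\<And>i. i < k \<Longrightarrow> c div 2 ^ i mod 2 = of_bool (b (Suc i))" by blast
  define d where "d = of_bool (b 0) + 2 * c"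
  have "d < 2 ^ Suc k" using c(1) by (simp add: d_def of_bool_def)
  moreover have "d div 2 ^ i mod 2 = of_bool (b i)" if "i < Suc k" for i
  proof (cases i)
    case 0
    then show ?thesis by (simp add: d_def of_bool_def)
  next
    case (Suc j)
    have "d div 2 = c" by (simp add: d_def of_bool_def)
    then have "d div 2 ^ Suc j = c div 2 ^ j" by (simp add: div_mult2_eq)
    then show ?thesis using c(2)[of j] that Suc by simp
  qed
  ultimately show ?case by blast
qed simp

text \<open>
  The bits below \<open>k\<close> of \<open>2 ^ k\<close> are those of 0, so the code can be chosen positive.
\<close>

lemma code_exists_positive:
  "\<exists>c\<in>{1..2 ^ k::nat}. \<forall>i<k. c div 2 ^ i mod 2 = of_bool (b i)"
proof -
  obtain c :: nat where c: "c < 2 ^ k" "\<And>i. i < k \<Longrightarrow> c div 2 ^ i mod 2 = of_bool (b i)"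
    using code_exists by blast
  show ?thesis
  proof (cases "c = 0")
    case True
    have "(2::nat) ^ k div 2 ^ i mod 2 = of_bool (b i)" if "i < k" for i
    proof -
      have "(2::nat) ^ k = 2 ^ i * (2 * 2 ^ (k - Suc i))"
        using that by (simp flip: power_Suc power_add)
      then show ?thesis using c(2)[OF that] True by simp
    qed
    then show ?thesis by (intro bexI[of _ "2 ^ k"]) auto
  next
    case False
    then show ?thesis using c by (intro bexI[of _ c]) auto
  qed
qed

lemma cover_count_input:
  assumes "distinct xs"
  shows "cover_count (input_memory xs) (length xs) c M p =
    (\<Sum>z\<in>set xs. cell_bit c M (p - fst z) (p div M - snd z))"
  unfolding cover_count_def
  by (rule sum_input_points[OF assms, of "\<lambda>u v. cell_bit c M (p - u) (p div M - v)"])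

lemma cell_bit_01: "cell_bit c M x y = 0 \<or> cell_bit c M x y = 1"
proof -
  have "k mod 2 = 0 \<or> k mod 2 = 1" for k :: int by presburger
  then show ?thesis unfolding cell_bit_def by blast
qed

text \<open>
  Every lattice point is congruent modulo \<open>M\<close> to a point of the torus that is tested by the
  program.
\<close>

lemma good_period_tiles:
  assumes xs: "distinct xs" and M: "M \<ge> 1" and good: "good_period (input_memory xs) (length xs) M"
  shows "tiles_plane (set xs)"
proof -
  obtain c where c: "\<And>p. p \<in> {1..M * M} \<Longrightarrow>
      (\<Sum>z\<in>set xs. cell_bit c (int M) (int p - fst z) (int p div int M - snd z)) = 1"
    using good unfolding good_period_def good_code_def cover_count_input[OF xs] by blast
  define A where "A = {z. cell_bit c (int M) (fst z) (snd z) = 1}"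
  have ind: "indicator A z = real_of_int (cell_bit c (int M) (fst z) (snd z))" for z
    using cell_bit_01[of c "int M" "fst z" "snd z"] by (auto simp: A_def indicator_def)
  have "(\<Sum>f\<in>set xs. indicator A (x - f)) = (1::real)" for x
  proof -
    define p0 where "p0 = nat (fst x mod int M + int M * (snd x mod int M))"
    have p0: "int p0 = fst x mod int M + int M * (snd x mod int M)" "p0 < M * M"
      using index_bounds[of "int M" "fst x" "snd x"] M
      by (simp_all add: p0_def nat_less_iff)
    define p where "p = (if p0 = 0 then M * M else p0)"
    have p: "p \<in> {1..M * M}" using p0(2) M by (auto simp: p_def)
    have m1: "int p mod int M = fst x mod int M"
    proof (cases "p0 = 0")
      case True
      then have "fst x mod int M = 0" using p0(1) M
        by (metis add_nonneg_eq_0_iff mult_nonneg_nonneg of_nat_0 of_nat_0_le_iff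
            pos_mod_sign of_nat_0_less_iff less_le_trans zero_less_one)
      then show ?thesis using True by (simp add: p_def)
    qed (simp add: p_def p0(1))
    have m2: "(int p div int M) mod int M = snd x mod int M"
    proof (cases "p0 = 0")
      case True
      have "0 \<le> fst x mod int M" "0 \<le> int M * (snd x mod int M)" using M by simp_all
      then have "int M * (snd x mod int M) = 0" using True p0(1) by linarith
      then show ?thesis using True M by (simp add: p_def)
    next
      case False
      then show ?thesis using M by (simp add: p_def p0(1))
    qed
    have "cell_bit c (int M) (int p - fst z) (int p div int M - snd z) =
        cell_bit c (int M) (fst (x - z)) (snd (x - z))" for z
      unfolding cell_bit_def fst_diff snd_diff
      using mod_diff_cong[OF m1 refl, of "fst z"] mod_diff_cong[OF m2 refl, of "snd z"] by simp
    then have "(\<Sum>z\<in>set xs. cell_bit c (int M) (fst (x - z)) (snd (x - z))) = 1"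
      using c[OF p] by simp
    then show ?thesis unfolding ind of_int_sum[symmetric] by (simp only: of_int_1)
  qed
  then show ?thesis using tiles_plane_iff[of "set xs"] by blast
qed

lemma periodic_tiling_good_period:
  assumes xs: "distinct xs" and M: "M \<ge> 1"
    and tile: "\<And>x. (\<Sum>f\<in>set xs. indicator A (x - f)) = (1::real)"
    and period: "\<And>x z. x + scale (int M) z \<in> A \<longleftrightarrow> x \<in> A"
  shows "good_period (input_memory xs) (length xs) M"
proof -
  define b where "b i \<longleftrightarrow> (int (i mod M), int (i div M)) \<in> A" for i
  obtain c :: nat where c: "c \<in> {1..2 ^ (M * M)}" "\<And>i. i < M * M \<Longrightarrow> c div 2 ^ i mod 2 = of_bool (b i)"
    using code_exists_positive[of "M * M" b] by blast
  have bit: "cell_bit (int c) (int M) x y = indicator A (x, y)" for x y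
  proof -
    define i where "i = nat (x mod int M + int M * (y mod int M))"
    have i: "int i = x mod int M + int M * (y mod int M)" "i < M * M"
      using index_bounds[of "int M" x y] M by (simp_all add: i_def nat_less_iff)
    have "cell_bit (int c) (int M) x y = int (c div 2 ^ i mod 2)"
      unfolding cell_bit_def i_def[symmetric] by (simp add: zdiv_int zmod_int)
    also have "\<dots> = of_bool (b i)" using c(2)[OF i(2)] by simp
    also have "b i \<longleftrightarrow> (x, y) \<in> A"
    proof -
      have "int (i mod M) = x mod int M" using M by (simp add: zmod_int i(1))
      moreover have "int (i div M) = y mod int M" using M by (simp add: zdiv_int i(1))
      moreover have "(x, y) = (x mod int M, y mod int M) + scale (int M) (x div int M, y div int M)" by simp
      ultimately show ?thesis unfolding b_def using period by metis
    qed
    finally show ?thesis by (simp add: indicator_def)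
  qed
  have "cover_count (input_memory xs) (length xs) (int c) (int M) p = 1" for p
  proof -
    have "real_of_int (cover_count (input_memory xs) (length xs) (int c) (int M) p) =
        (\<Sum>f\<in>set xs. indicator A ((p, p div int M) - f))"
      unfolding cover_count_input[OF xs] bit of_int_sum
      by (intro sum.cong refl) (simp add: indicator_def minus_prod_def)
    then show ?thesis using tile by simp
  qed
  then show ?thesis unfolding good_period_def good_code_def using c(1) by blast
qed

lemma spread_bounds_differences:
  assumes xs: "distinct xs" and f: "f \<in> set xs" and g: "g \<in> set xs"
  shows "\<bar>fst f - fst g\<bar> \<le> spread (input_memory xs) (length xs) \<and>
    \<bar>snd f - snd g\<bar> \<le> spread (input_memory xs) (length xs)"
proof (cases "f = g")
  case True
  then show ?thesis using spread_ge_1[of "input_memory xs" "length xs"] by simp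
next
  case False
  define u v where "u = input_memory xs 1" and "v = input_memory xs 2"
  define h where "h z = (fst z - u) * (fst z - u) + (snd z - v) * (snd z - v)" for z
  have h0: "0 \<le> h z" for z by (simp add: h_def)
  have sp: "spread (input_memory xs) (length xs) = 1 + (\<Sum>z\<in>set xs. h z)"
    unfolding spread_def h_def u_def[symmetric] v_def[symmetric]
    using sum_input_points[OF xs, of "\<lambda>a b. (a - u) * (a - u) + (b - v) * (b - v)"] by simp
  have "h f + h g = (\<Sum>z\<in>{f, g}. h z)" using False by simp
  also have "\<dots> \<le> (\<Sum>z\<in>set xs. h z)" using f g h0 by (intro sum_mono2) auto
  finally have *: "h f + h g \<le> spread (input_memory xs) (length xs)" using sp by simp
  have sq: "\<bar>t\<bar> \<le> t * t" for t :: int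
  proof (cases "t = 0")
    case False
    then have "1 * \<bar>t\<bar> \<le> \<bar>t\<bar> * \<bar>t\<bar>" by (intro mult_right_mono) auto
    then show ?thesis by simp
  qed simp
  have "\<bar>fst z - u\<bar> \<le> h z" "\<bar>snd z - v\<bar> \<le> h z" for z
    using sq[of "fst z - u"] sq[of "snd z - v"] by (auto simp: h_def intro: order_trans)
  from this[of f] this[of g] show ?thesis using * by linarith
qed

theorem search_correct:
  assumes xs: "distinct xs"
  shows "(\<exists>M\<in>{1..bound (input_memory xs) (length xs)}. good_period (input_memory xs) (length xs) M) \<longleftrightarrow>
    tiles_plane (set xs)"
proof
  assume "\<exists>M\<in>{1..bound (input_memory xs) (length xs)}. good_period (input_memory xs) (length xs) M"
  then show "tiles_plane (set xs)" using good_period_tiles[OF xs] by auto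
next
  assume tile: "tiles_plane (set xs)"
  define n where "n = length xs"
  define D where "D = spread (input_memory xs) n"
  have n: "card (set xs) = n" using xs by (simp add: n_def distinct_card)
  have "set xs \<noteq> {}" using tile by (auto simp: tiles_plane_iff)
  then have "n \<ge> 1" by (simp add: n_def Suc_le_eq)
  moreover have "1 \<le> D" unfolding D_def by (rule spread_ge_1)
  moreover have "\<bar>fst f - fst g\<bar> \<le> D \<and> \<bar>snd f - snd g\<bar> \<le> D" if "f \<in> set xs" "g \<in> set xs" for f g
    unfolding D_def n_def by (rule spread_bounds_differences[OF xs that])
  ultimately obtain M A where MA: "1 \<le> M" "M \<le> (2 * int (size_bound n) * D) ^ (34 * n ^ 4)"
      "\<forall>x. (\<Sum>f\<in>set xs. indicator A (x - f)) = (1::real)" "\<forall>x z. x + scale M z \<in> A \<longleftrightarrow> x \<in> A"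
    using periodic_tiling[OF _ n _ tile, of D] by auto
  have "int (bound (input_memory xs) n) = (2 * int (size_bound n) * D) ^ (34 * n ^ 4)"
    using \<open>1 \<le> D\<close> by (simp add: bound_def D_def)
  then have "nat M \<in> {1..bound (input_memory xs) n}" using MA(1,2) by (simp add: nat_le_iff le_nat_iff)
  moreover have "good_period (input_memory xs) n (nat M)"
    unfolding n_def by (rule periodic_tiling_good_period[OF xs, of _ A]) (use MA in simp_all)
  ultimately show "\<exists>M\<in>{1..bound (input_memory xs) (length xs)}. good_period (input_memory xs) (length xs) M"
    unfolding n_def by blast
qed

section \<open>The running time\<close>

definition setup_time :: "nat \<Rightarrow> nat" where
  "setup_time n = (n + 2) * (size_bound n * 20 + 51) + n * 71 + 34 * n ^ 4 * 23 + 100"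

text \<open>
  With \<open>q = B * B\<close>, every polynomial factor is absorbed in a power \<open>2 ^ q\<close>.
\<close>

lemma search_time:
  assumes "B \<ge> 1"
  shows "B * (period_time n B + 11) \<le> 151 * (n + 1) * 16 ^ (B * B)"
proof -
  define q where "q = B * B"
  have q: "1 \<le> q" "B \<le> q" using assms by (auto simp: q_def Suc_le_eq)
  have q2: "q \<le> 2 ^ q" by (rule less_imp_le[OF less_exp])
  have qq: "q \<le> q * q" "1 \<le> q * q" using q(1) by simp_all
  have "n * (q * 17 + 71) \<le> n * (88 * q)" using q(1) by (intro mult_le_mono) auto
  then have "q * (n * (q * 17 + 71) + 41) \<le> q * (n * (88 * q) + 41)"
    by (rule mult_le_mono2[OF add_le_mono1])
  also have "\<dots> = 88 * n * (q * q) + 41 * q" by (simp add: algebra_simps)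
  finally have "q * (n * (q * 17 + 71) + 41) + 51 \<le> 88 * n * (q * q) + 41 * (q * q) + 51 * (q * q)"
    using qq by linarith
  also have "\<dots> \<le> 92 * (n + 1) * (q * q)" by (simp add: algebra_simps)
  also have "\<dots> \<le> 92 * (n + 1) * (2 ^ q * 2 ^ q)" using q2 by (intro mult_le_mono order_refl)
  finally have "2 ^ q * (code_time n B + 11) \<le> 2 ^ q * (92 * (n + 1) * (2 ^ q * 2 ^ q))"
    unfolding code_time_def q_def[symmetric] by (intro mult_le_mono order_refl) linarith
  also have "\<dots> = 92 * (n + 1) * 8 ^ q"
    by (simp flip: power_mult_distrib add: mult.left_commute)
  finally have a: "2 ^ q * (code_time n B + 11) \<le> 92 * (n + 1) * 8 ^ q" .
  have "q * 18 + 41 \<le> 59 * q" using q(1) by simp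
  also have "q \<le> 8 ^ q" using q2 power_mono[of 2 "8::nat" q] by simp
  finally have b: "q * 18 + 41 \<le> 59 * (n + 1) * 8 ^ q" by (simp add: algebra_simps)
  have "period_time n B + 11 \<le> 151 * (n + 1) * 8 ^ q"
    using a b unfolding period_time_def q_def[symmetric] by (simp add: algebra_simps)
  moreover have "B \<le> 2 ^ q" using q(2) q2 by linarith
  ultimately have "B * (period_time n B + 11) \<le> 2 ^ q * (151 * (n + 1) * 8 ^ q)"
    by (rule mult_le_mono[rotated])
  also have "\<dots> = 151 * (n + 1) * 16 ^ q" by (simp flip: power_mult_distrib add: mult.left_commute)
  finally show ?thesis by (simp add: q_def)
qed

lemma sixteen_power_le_exp: "(16::real) ^ k \<le> exp (4 * real k)"
proof -
  have "(2::real) \<le> exp 1" using exp_ge_add_one_self[of 1] by simp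
  then have "(2::real) ^ (4 * k) \<le> exp 1 ^ (4 * k)" by (rule power_mono) simp
  moreover have "(16::real) ^ k = 2 ^ (4 * k)" by (simp add: power_mult)
  moreover have "exp (1::real) ^ (4 * k) = exp (4 * real k)"
    by (simp add: exp_of_nat_mult[symmetric])
  ultimately show ?thesis by (simp only:)
qed

definition embed :: "int \<times> int \<Rightarrow> real \<times> real" where
  "embed z = (real_of_int (fst z), real_of_int (snd z))"

lemma diam_embed: "diam F = diameter (embed ` F)"
  unfolding diam_def by (intro arg_cong[where f = diameter] image_cong) (auto simp: embed_def)

lemma dist_embed:
  "(dist (embed f) (embed g))\<^sup>2 =
    real_of_int ((fst f - fst g) * (fst f - fst g) + (snd f - snd g) * (snd f - snd g))"
  by (simp add: embed_def dist_Pair_Pair dist_real_def power2_eq_square)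

lemma dist_le_diam:
  "finite F \<Longrightarrow> f \<in> F \<Longrightarrow> g \<in> F \<Longrightarrow> dist (embed f) (embed g) \<le> diam F"
  unfolding diam_embed by (intro diameter_bounded_bound finite_imp_bounded) auto

lemma diam_ge_1:
  assumes "finite F" "f \<in> F" "g \<in> F" "f \<noteq> g"
  shows "1 \<le> diam F"
proof -
  define k where "k = (fst f - fst g) * (fst f - fst g) + (snd f - snd g) * (snd f - snd g)"
  have "k \<noteq> 0" using assms(4) unfolding k_def sum_squares_eq_zero_iff by (simp add: prod_eq_iff)
  moreover have "0 \<le> k" by (simp add: k_def)
  ultimately have "1\<^sup>2 \<le> (dist (embed f) (embed g))\<^sup>2" unfolding dist_embed k_def[symmetric] by simp
  then have "1 \<le> dist (embed f) (embed g)" by (rule power2_le_imp_le) simp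
  then show ?thesis using dist_le_diam[OF assms(1-3)] by linarith
qed

lemma spread_le_diam:
  assumes xs: "distinct xs" and n: "length xs \<ge> 2"
  shows "real_of_int (spread (input_memory xs) (length xs)) \<le> real (length xs + 1) * (diam (set xs))\<^sup>2"
proof -
  define d where "d = diam (set xs)"
  define g where "g = xs ! 0"
  have len: "0 < length xs" "1 < length xs" using n by linarith+
  note mem = nth_mem[OF len(1)] nth_mem[OF len(2)]
  have g: "g \<in> set xs" using mem(1) by (simp add: g_def)
  have g12: "input_memory xs 1 = fst g" "input_memory xs 2 = snd g"
    using input_memory_point[of 1 xs] n by (simp_all add: g_def)
  define h where "h z = (fst z - fst g) * (fst z - fst g) + (snd z - snd g) * (snd z - snd g)" for z
  have "xs ! 0 \<noteq> xs ! 1" using xs n by (subst nth_eq_iff_index_eq) auto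
  then have d1: "1 \<le> d" unfolding d_def by (rule diam_ge_1[OF finite_set mem])
  have "real_of_int (h z) \<le> d\<^sup>2" if "z \<in> set xs" for z
    unfolding h_def dist_embed[symmetric] d_def
    using dist_le_diam[OF _ that g] by (intro power_mono) auto
  then have "(\<Sum>z\<in>set xs. real_of_int (h z)) \<le> (\<Sum>z\<in>set xs. d\<^sup>2)" by (rule sum_mono)
  also have "\<dots> = real (length xs) * d\<^sup>2" using xs by (simp add: distinct_card)
  finally have "real_of_int (\<Sum>z\<in>set xs. h z) \<le> real (length xs) * d\<^sup>2" by simp
  moreover have "spread (input_memory xs) (length xs) = 1 + (\<Sum>z\<in>set xs. h z)"
    unfolding spread_def h_def g12
    using sum_input_points[OF xs, of "\<lambda>a b. (a - fst g) * (a - fst g) + (b - snd g) * (b - snd g)"] by simp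
  moreover have "1 \<le> d\<^sup>2" using d1 by simp
  ultimately show ?thesis by (simp add: d_def[symmetric] distrib_right)
qed

lemma spread_small: "length xs \<le> 1 \<Longrightarrow> spread (input_memory xs) (length xs) = 1"
  by (cases "length xs") (auto simp: spread_def)

text \<open>
  If there are at least two points, the diameter is at least 1 and \<open>spread\<close> is at most a multiple
  of its square. If there are fewer, \<open>spread\<close> is 1 while the diameter is 0; the summand 1 accounts
  for this case.
\<close>

lemma bound_le_diam:
  fixes xs defines "n \<equiv> length xs"
  assumes xs: "distinct xs"
  shows "real (bound (input_memory xs) n * bound (input_memory xs) n) \<le>
    (2 * real (size_bound n) * real (n + 1)) ^ (68 * n ^ 4) * (1 + diam (set xs) powr (136 * real n ^ 4))"
proof -
  define d where "d = diam (set xs)"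
  define s where "s = real_of_int (spread (input_memory xs) n)"
  have s1: "1 \<le> s" unfolding s_def using spread_ge_1[of "input_memory xs" n] by simp
  have "2 * (34 * n ^ 4) = 68 * n ^ 4" by simp
  then have "real (bound (input_memory xs) n * bound (input_memory xs) n) = (2 * real (size_bound n) * s) ^ (68 * n ^ 4)"
    using spread_ge_1[of "input_memory xs" n]
    by (simp add: bound_def s_def power_add[symmetric])
  also have "\<dots> = (2 * real (size_bound n)) ^ (68 * n ^ 4) * s ^ (68 * n ^ 4)"
    by (rule power_mult_distrib)
  also have "s ^ (68 * n ^ 4) \<le> real (n + 1) ^ (68 * n ^ 4) * (1 + d powr (136 * real n ^ 4))"
  proof (cases "n \<ge> 2")
    case False
    then have "s = 1" using spread_small[of xs] by (simp add: s_def n_def)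
    have "1 * 1 \<le> real (n + 1) ^ (68 * n ^ 4) * (1 + d powr (136 * real n ^ 4))"
      by (intro mult_mono one_le_power) auto
    then show ?thesis using \<open>s = 1\<close> by simp
  next
    case True
    have s: "s \<le> real (n + 1) * d\<^sup>2"
      unfolding s_def d_def n_def by (rule spread_le_diam[OF xs]) (use True n_def in simp)
    have len: "0 < length xs" "1 < length xs" using True unfolding n_def by linarith+
    have "xs ! 0 \<noteq> xs ! 1" using xs True by (subst nth_eq_iff_index_eq) (auto simp: n_def)
    then have d1: "1 \<le> d"
      unfolding d_def by (rule diam_ge_1[OF finite_set nth_mem[OF len(1)] nth_mem[OF len(2)]])
    have "s ^ (68 * n ^ 4) \<le> (real (n + 1) * d\<^sup>2) ^ (68 * n ^ 4)"
      using s s1 by (intro power_mono) auto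
    also have "\<dots> = real (n + 1) ^ (68 * n ^ 4) * d ^ (2 * (68 * n ^ 4))"
      by (simp only: power_mult_distrib power_mult[symmetric])
    also have "d ^ (2 * (68 * n ^ 4)) = d powr real (2 * (68 * n ^ 4))"
      using d1 by (simp only: powr_realpow)
    also have "real (2 * (68 * n ^ 4)) = 136 * real n ^ 4" by simp
    also have "real (n + 1) ^ (68 * n ^ 4) * d powr (136 * real n ^ 4) \<le>
        real (n + 1) ^ (68 * n ^ 4) * (1 + d powr (136 * real n ^ 4))"
      by (intro mult_left_mono) auto
    finally show ?thesis .
  qed
  finally show ?thesis
    by (simp add: d_def power_mult_distrib mult_left_mono mult.assoc)
qed

text \<open>
  The period is at most \<open>(2 * size_bound n * D) ^ (34 * n ^ 4)\<close> with \<open>D\<close> at most quadratic in the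
  diameter, and the search is exponential in the square of the period; this makes
  \<open>c = 34 * 2 * 2\<close>. Everything that depends on \<open>n\<close> only, the whole computation of \<open>size_bound n\<close>
  included, is absorbed in the factors \<open>C n\<close> and \<open>C' n\<close>. For sets with at most one element, of
  diameter 0, the bound is \<open>C n\<close> alone.
\<close>

theorem corollary1p6:
  shows "\<exists>(c::real) (C::nat \<Rightarrow> real) (C'::nat \<Rightarrow> real) (P::com).
    c > 0 \<and> (\<forall>n. C n > 0 \<and> C' n > 0) \<and>
    decides_in_time P tiles_plane
      (\<lambda>F. C (card F) * exp (C' (card F) * diam F powr (c * real (card F) ^ 4)))"
proof -
  define C' where "C' n = 4 * (2 * real (size_bound n) * real (n + 1)) ^ (68 * n ^ 4)" for n
  define C where "C n = (real (setup_time n) + 151 * real (n + 1)) * exp (C' n)" for n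
  have Xpos: "0 < size_bound n" for n
    using le_grow_iter[of "n + 1" "n + 2"] by (simp add: size_bound_def)
  have pos: "C n > 0 \<and> C' n > 0" for n
    using Xpos[of n] by (simp add: C_def C'_def add_nonneg_pos)
  have "decides_in_time tiling_program tiles_plane
      (\<lambda>F. C (card F) * exp (C' (card F) * diam F powr (136 * real (card F) ^ 4)))"
    unfolding decides_in_time_def
  proof (intro allI impI)
    fix F :: "(int \<times> int) set" and xs
    assume xs: "distinct xs" and F: "set xs = F"
    define n where "n = length xs"
    define B where "B = bound (input_memory xs) n"
    define p where "p = diam F powr (136 * real n ^ 4)"
    have n: "card F = n" using xs F by (auto simp: n_def distinct_card)
    obtain t m where run: "exec tiling_program (input_memory xs) t m"
        "t \<le> setup_time n + B * (period_time n B + 11)"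
        "m 0 = (if \<exists>M\<in>{1..B}. good_period (input_memory xs) n M then 1 else 0)"
      using runs_tiling_program[of "input_memory xs" n] unfolding runs_def B_def n_def setup_time_def
      by (auto simp: input_memory_0)
    have "m 0 = (if tiles_plane F then 1 else 0)"
      using run(3) search_correct[OF xs] unfolding B_def n_def F by simp
    moreover have "real t \<le> C n * exp (C' n * p)"
    proof -
      have "B \<ge> 1" unfolding B_def bound_def using Xpos[of n] spread_ge_1[of "input_memory xs" n]
        by (simp add: Suc_le_eq)
      have "t \<le> setup_time n + 151 * (n + 1) * 16 ^ (B * B)"
        using run(2) search_time[OF \<open>B \<ge> 1\<close>, of n] by linarith
      then have "real t \<le> real (setup_time n + 151 * (n + 1) * 16 ^ (B * B))" by (simp only: of_nat_le_iff)
      also have "\<dots> = real (setup_time n) + 151 * real (n + 1) * 16 ^ (B * B)" by simp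
      also have "\<dots> \<le> real (setup_time n) * exp (4 * real (B * B)) + 151 * real (n + 1) * exp (4 * real (B * B))"
      proof (rule add_mono)
        show "real (setup_time n) \<le> real (setup_time n) * exp (4 * real (B * B))"
          using mult_left_mono[of 1 "exp (4 * real (B * B))" "real (setup_time n)"] by simp
        show "151 * real (n + 1) * 16 ^ (B * B) \<le> 151 * real (n + 1) * exp (4 * real (B * B))"
          by (intro mult_left_mono sixteen_power_le_exp) simp
      qed
      also have "\<dots> = (real (setup_time n) + 151 * real (n + 1)) * exp (4 * real (B * B))"
        by (simp add: distrib_right)
      also have "\<dots> \<le> (real (setup_time n) + 151 * real (n + 1)) * exp (C' n * (1 + p))"
      proof (intro mult_left_mono)
        have "real (B * B) \<le> (2 * real (size_bound n) * real (n + 1)) ^ (68 * n ^ 4) * (1 + p)"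
          using bound_le_diam[OF xs] unfolding B_def n_def p_def F .
        then have "4 * real (B * B) \<le> C' n * (1 + p)" by (simp add: C'_def)
        then show "exp (4 * real (B * B)) \<le> exp (C' n * (1 + p))" by simp
      qed simp
      also have "\<dots> = C n * exp (C' n * p)" by (simp add: C_def distrib_left exp_add)
      finally show ?thesis .
    qed
    ultimately show "\<exists>t m. exec tiling_program (input_memory xs) t m \<and> m 0 = (if tiles_plane F then 1 else 0) \<and>
        real t \<le> C (card F) * exp (C' (card F) * diam F powr (136 * real (card F) ^ 4))"
      using run(1) unfolding n p_def by blast
  qed
  then show ?thesis
    using pos by (intro exI[of _ "136 :: real"] exI[of _ C] exI[of _ C'] exI[of _ tiling_program]) simp
qed

end
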